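(* Let $b>c$ be positive integers and $r,s$ positive integers, and let $\lambda=(b+c,b^r,c^s)$ (one part equal to $b+c$, $r$ parts equal to $b$, $s$ parts equal to $c$), a partition of $n=b+c+rb+sc$. Then $X_\lambda$ is not Cohen--Macaulay.
   Context: Work over $\mathbb{C}$. For a partition $\lambda=(\lambda_1\ge\dots\ge\lambda_r)$ of $n$, let $E_\lambda\subset\mathbb{C}^n$ be the subspace defined by $x_1=\cdots=x_{\lambda_1}$, $x_{\lambda_1+1}=\cdots=x_{\lambda_1+\lambda_2}$, ..., $x_{n-\lambda_r+1}=\cdots=x_n$. Let $X_\lambda=S_n\cdot E_\lambda$ be the union of the $S_n$-translates of $E_\lambda$ (a reduced subspace arrangement in $\mathbb{C}^n$). *)

theory Defs
  imports Complex_Main "HOL-Library.Poly_Mapping" "HOL-Library.Extended_Nat"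
    "HOL-Combinatorics.Permutations"
begin

type_synonym mpoly = "(nat \<Rightarrow>\<^sub>0 nat) \<Rightarrow>\<^sub>0 complex"

definition polys :: "nat \<Rightarrow> mpoly set" where
  "polys n = {p. \<forall>m\<in>Poly_Mapping.keys p. \<forall>i\<in>Poly_Mapping.keys m. i < n}"

definition peval :: "mpoly \<Rightarrow> (nat \<Rightarrow> complex) \<Rightarrow> complex" where
  "peval p x = (\<Sum>m\<in>Poly_Mapping.keys p. Poly_Mapping.lookup p m * (\<Prod>i\<in>Poly_Mapping.keys m. x i ^ Poly_Mapping.lookup m i))"

definition cn :: "nat \<Rightarrow> (nat \<Rightarrow> complex) set" where
  "cn n = {x. \<forall>i\<ge>n. x i = 0}"

(* Block index of position i (0-based) for the composition given by the list lam
  of parts: positions 0..lam!0-1 are in block 0, the next lam!1 positions in block 1, etc. *)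
definition blk :: "nat list \<Rightarrow> nat \<Rightarrow> nat" where
  "blk lam i = card {k. k < length lam \<and> sum_list (take (Suc k) lam) \<le> i}"

definition E_sub :: "nat list \<Rightarrow> (nat \<Rightarrow> complex) set" where
  "E_sub lam = {x \<in> cn (sum_list lam).
     \<forall>i<sum_list lam. \<forall>j<sum_list lam. blk lam i = blk lam j \<longrightarrow> x i = x j}"

definition X_arr :: "nat list \<Rightarrow> (nat \<Rightarrow> complex) set" where
  "X_arr lam = (\<Union>\<sigma>\<in>{\<sigma>. \<sigma> permutes {..<sum_list lam}}. (\<lambda>x. x \<circ> \<sigma>) ` E_sub lam)"

definition van_ideal :: "nat \<Rightarrow> (nat \<Rightarrow> complex) set \<Rightarrow> mpoly set" where
  "van_ideal n X = {p \<in> polys n. \<forall>x\<in>X. peval p x = 0}"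

definition is_ideal :: "nat \<Rightarrow> mpoly set \<Rightarrow> bool" where
  "is_ideal n P \<longleftrightarrow> P \<subseteq> polys n \<and> 0 \<in> P \<and> (\<forall>a\<in>P. \<forall>b\<in>P. a + b \<in> P)
     \<and> (\<forall>a\<in>P. \<forall>r\<in>polys n. r * a \<in> P)"

definition is_prime_ideal :: "nat \<Rightarrow> mpoly set \<Rightarrow> bool" where
  "is_prime_ideal n P \<longleftrightarrow> is_ideal n P \<and> P \<noteq> polys n
     \<and> (\<forall>a\<in>polys n. \<forall>b\<in>polys n. a * b \<in> P \<longrightarrow> a \<in> P \<or> b \<in> P)"

definition krull_dim :: "nat \<Rightarrow> mpoly set \<Rightarrow> enat" where
  "krull_dim n I = Sup {enat k | k. \<exists>P :: nat \<Rightarrow> mpoly set.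
      (\<forall>i\<le>k. is_prime_ideal n (P i) \<and> I \<subseteq> P i) \<and> (\<forall>i<k. P i \<subset> P (Suc i))}"

definition ideal_plus :: "nat \<Rightarrow> mpoly set \<Rightarrow> mpoly list \<Rightarrow> mpoly set" where
  "ideal_plus n I fs = {h + (\<Sum>j<length fs. a j * fs ! j) | h a.
      h \<in> I \<and> (\<forall>j<length fs. a j \<in> polys n)}"

definition max_ideal :: "nat \<Rightarrow> mpoly set" where
  "max_ideal n = {p \<in> polys n. Poly_Mapping.lookup p 0 = 0}"

(* (images in R = S/I of) f_1,...,f_k form an R-regular sequence in the maximal
  ideal m R: each f_i is a nonzerodivisor on R/(f_1..f_(i-1))R, and R/(f_1..f_k)R \<noteq> 0. *)
definition regular_seq :: "nat \<Rightarrow> mpoly set \<Rightarrow> mpoly list \<Rightarrow> bool" where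
  "regular_seq n I fs \<longleftrightarrow> set fs \<subseteq> max_ideal n
     \<and> (\<forall>k<length fs. \<forall>g\<in>polys n.
           fs ! k * g \<in> ideal_plus n I (take k fs) \<longrightarrow> g \<in> ideal_plus n I (take k fs))
     \<and> ideal_plus n I fs \<noteq> polys n"

definition depth_ring :: "nat \<Rightarrow> mpoly set \<Rightarrow> enat" where
  "depth_ring n I = Sup {enat (length fs) | fs. regular_seq n I fs}"

definition cohen_macaulay :: "nat \<Rightarrow> mpoly set \<Rightarrow> bool" where
  "cohen_macaulay n I \<longleftrightarrow> depth_ring n I = krull_dim n I"

definition arr_CM :: "nat list \<Rightarrow> bool" where
  "arr_CM lam \<longleftrightarrow> cohen_macaulay (sum_list lam) (van_ideal (sum_list lam) (X_arr lam))"

end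

theory Submission
  imports Defs "HOL-Computational_Algebra.Polynomial"
begin

text \<open>
  Let \<open>d = r + s + 1\<close> be the dimension of \<open>X\<close>. If there were a regular sequence of length \<open>d\<close>, the Koszul
  cohomology of the coordinate ring with respect to any linear forms spanning the maximal ideal
  would vanish in degrees below \<open>d\<close>. Taking coordinates \<open>y\<close> on the flat \<open>F\<close> of dimension \<open>d - 2\<close> on which
  one block of each size is merged into a block of size \<open>2(b + c)\<close>, and the equations \<open>l\<close> of \<open>F\<close>, graded
  Nakayama removes the \<open>y\<close> one at a time and leaves \<open>H^1(l; R) = 0\<close>: a function \<open>h\<close> on \<open>X\<close> off \<open>F\<close> such
  that every \<open>l h\<close> is polynomial is itself polynomial.

  For \<open>(b + c, b, c)\<close> let \<open>x, y, z\<close> be the three block values and let \<open>h\<close> depend on the blocks \<open>A, B, C\<close>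
  (of sizes \<open>b + c\<close>, \<open>b\<close>, \<open>c\<close>) that contain two marked coordinates, antisymmetrically:
  \<open>h = - c (x - y)(x - z)^2(y - z)\<close> if these are \<open>A, B\<close>, \<open>h = b (x - y)^2(x - z)(y - z)\<close> if they are \<open>A, C\<close>,
  and \<open>h = 0\<close> for \<open>B, C\<close>. Off \<open>F\<close> it extends locally to polynomials; the identity \<open>b + c = |A|\<close> enters at the
  strata where \<open>A\<close> and \<open>B \<union> C\<close> can be exchanged. It is not polynomial: averaging over the
  permutations fixing the marked coordinates would express \<open>h\<close> through these coordinates and power
  sums, and the vanishing for \<open>B, C\<close> then forces \<open>h = 0\<close>. For general \<open>r, s\<close> one multiplies \<open>h\<close> by the product
  of all \<open>x_i - x_j\<close> with \<open>i, j\<close> in different blocks of \<open>F\<close>, which kills all components of \<open>X\<close> not containing \<open>F\<close>.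
\<close>

section \<open>Polynomials and their evaluation\<close>

text \<open>Local extensions are glued through the ideal of denominators, the polynomials k for
  which k h is polynomial on X off F. It contains products of differences that isolate one stratum
  each; these yield powers of all x_i - x_j with i, j in the merged block, and the vanishing of H^1,
  applied to k h instead of h, lets the powers be lowered until k = 1. The weights -c and b in h
  come from the mean over B \<union> C: for k in B or C, the sum over B \<union> C minus (b + c) x_k
  is -c (y - z) or b (y - z); call it e. With the first mark i in A and the second mark k in B
  \<union> C, h equals e (x_i - x_k)(x_i - v)^2, where v is the value on the other one of B and C.
  The factor e is polynomial and vanishes as soon as x is constant on B \<union> C, as it is on
  every plane in which A and B \<union> C have changed places, so the two families do not disturb
  each other. Degree 4 keeps the final contradiction finite: once the first power sum is set to
  zero, only four coefficients survive antisymmetrization in the marks.\<close>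

abbreviation supp :: "('a \<Rightarrow>\<^sub>0 'b::zero) \<Rightarrow> 'a set" where "supp \<equiv> Poly_Mapping.keys"
abbreviation lkp :: "('a \<Rightarrow>\<^sub>0 'b::zero) \<Rightarrow> 'a \<Rightarrow> 'b" where "lkp \<equiv> Poly_Mapping.lookup"
abbreviation sgl :: "'a \<Rightarrow> 'b::zero \<Rightarrow> ('a \<Rightarrow>\<^sub>0 'b)" where "sgl \<equiv> Poly_Mapping.single"

definition mon_eval :: "(nat \<Rightarrow>\<^sub>0 nat) \<Rightarrow> (nat \<Rightarrow> complex) \<Rightarrow> complex" where
  "mon_eval m x = (\<Prod>i\<in>supp m. x i ^ lkp m i)"

definition mon_deg :: "(nat \<Rightarrow>\<^sub>0 nat) \<Rightarrow> nat" where
  "mon_deg m = (\<Sum>i\<in>supp m. lkp m i)"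

lemma mon_eval_superset:
  "finite K \<Longrightarrow> supp m \<subseteq> K \<Longrightarrow> mon_eval m x = (\<Prod>i\<in>K. x i ^ lkp m i)"
  unfolding mon_eval_def by (rule prod.mono_neutral_left) (auto simp: in_keys_iff)

lemma mon_deg_superset:
  "finite K \<Longrightarrow> supp m \<subseteq> K \<Longrightarrow> mon_deg m = (\<Sum>i\<in>K. lkp m i)"
  unfolding mon_deg_def by (rule sum.mono_neutral_left) (auto simp: in_keys_iff)

lemma mon_eval_add: "mon_eval (m + m') x = mon_eval m x * mon_eval m' x"
proof -
  let ?K = "supp m \<union> supp m'"
  have "supp (m + m') \<subseteq> ?K" by (rule keys_add)
  then show ?thesis
    by (simp add: mon_eval_superset[of ?K] lookup_add power_add prod.distrib)
qed

lemma mon_deg_add: "mon_deg (m + m') = mon_deg m + mon_deg m'"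
proof -
  let ?K = "supp m \<union> supp m'"
  have "supp (m + m') \<subseteq> ?K" by (rule keys_add)
  then show ?thesis
    by (simp add: mon_deg_superset[of ?K] lookup_add sum.distrib)
qed

lemma mon_eval_scale: "mon_eval m (\<lambda>i. t * x i) = t ^ mon_deg m * mon_eval m x"
  by (simp add: mon_eval_def mon_deg_def power_mult_distrib prod.distrib power_sum)

lemma peval_mon_eval: "peval p x = (\<Sum>m\<in>supp p. lkp p m * mon_eval m x)"
  by (simp add: peval_def mon_eval_def)

lemma peval_superset:
  "finite K \<Longrightarrow> supp p \<subseteq> K \<Longrightarrow> peval p x = (\<Sum>m\<in>K. lkp p m * mon_eval m x)"
  unfolding peval_mon_eval by (rule sum.mono_neutral_left) (auto simp: in_keys_iff)

lemma peval_add: "peval (p + q) x = peval p x + peval q x"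
proof -
  let ?K = "supp p \<union> supp q"
  have "supp (p + q) \<subseteq> ?K" by (rule keys_add)
  then show ?thesis
    by (simp add: peval_superset[of ?K] lookup_add sum.distrib algebra_simps)
qed

lemma peval_single: "peval (sgl m c) x = c * mon_eval m x"
  by (simp add: peval_mon_eval)

lemma mpoly_sum_singles: "(p :: 'a \<Rightarrow>\<^sub>0 'b::comm_monoid_add) = (\<Sum>m\<in>supp p. sgl m (lkp p m))"
proof (rule poly_mapping_eqI)
  fix k
  have "lkp (\<Sum>m\<in>supp p. sgl m (lkp p m)) k
      = (\<Sum>m\<in>supp p. if m = k then lkp p m else 0)"
    by (simp add: lookup_sum lookup_single when_def)
  also have "\<dots> = lkp p k" by (simp add: in_keys_iff)
  finally show "lkp p k = lkp (\<Sum>m\<in>supp p. sgl m (lkp p m)) k" by simp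
qed

lemma mpoly_induct [case_names zero single add]:
  fixes p :: mpoly
  assumes "P 0" "\<And>m c. m \<in> supp p \<Longrightarrow> P (sgl m c)"
    and "\<And>p q. P p \<Longrightarrow> P q \<Longrightarrow> P (p + q)"
  shows "P p"
proof -
  have "finite K \<Longrightarrow> K \<subseteq> supp p \<Longrightarrow> P (\<Sum>m\<in>K. sgl m (lkp p m))" for K
    by (induction K rule: finite_induct) (auto intro: assms)
  then show ?thesis by (subst mpoly_sum_singles) auto
qed

lemma peval_zero [simp]: "peval 0 x = 0" by (simp add: peval_def)

lemma peval_mult: "peval (p * q) x = peval p x * peval q x"
proof (induction p rule: mpoly_induct)
  case (single m c)
  show ?case
    by (induction q rule: mpoly_induct)
      (simp_all add: mult_single peval_single mon_eval_add peval_add algebra_simps)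
qed (simp_all add: peval_add algebra_simps)

lemma peval_one [simp]: "peval 1 x = 1"
  using peval_single[of 0 1 x] by (simp add: mon_eval_def)

lemma peval_uminus: "peval (- p) x = - peval p x"
  using peval_add[of p "- p" x] by (simp add: eq_neg_iff_add_eq_0 add.commute)

lemma peval_diff: "peval (p - q) x = peval p x - peval q x"
  using peval_add[of p "- q" x] by (simp add: peval_uminus)

definition var :: "nat \<Rightarrow> mpoly" where "var i = sgl (sgl i 1) 1"

lemma peval_var [simp]: "peval (var i) x = x i"
  by (simp add: var_def peval_single mon_eval_def)

lemma zero_polys [simp]: "0 \<in> polys n" by (simp add: polys_def)
lemma one_polys [simp]: "1 \<in> polys n" by (simp add: polys_def)
lemma single_polys: "supp m \<subseteq> {..<n} \<Longrightarrow> sgl m c \<in> polys n" by (auto simp: polys_def)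
lemma var_polys [simp]: "i < n \<Longrightarrow> var i \<in> polys n"
  unfolding var_def by (rule single_polys) auto

lemma add_polys: "p \<in> polys n \<Longrightarrow> q \<in> polys n \<Longrightarrow> p + q \<in> polys n"
  unfolding polys_def using keys_add[of p q] by blast

lemma uminus_polys: "p \<in> polys n \<Longrightarrow> - p \<in> polys n"
  by (simp add: polys_def in_keys_iff)

lemma diff_polys: "p \<in> polys n \<Longrightarrow> q \<in> polys n \<Longrightarrow> p - q \<in> polys n"
  using add_polys[of p n "- q"] uminus_polys[of q n] by simp

lemma mult_polys: "p \<in> polys n \<Longrightarrow> q \<in> polys n \<Longrightarrow> p * q \<in> polys n"
  unfolding polys_def
proof safe
  fix m i
  assume *: "\<forall>m\<in>supp p. \<forall>i\<in>supp m. i < n"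
    "\<forall>m\<in>supp q. \<forall>i\<in>supp m. i < n"
    "m \<in> supp (p * q)" "i \<in> supp m"
  then obtain a b where ab: "a \<in> supp p" "b \<in> supp q" "m = a + b"
    using keys_mult[of p q] by blast
  then have "i \<in> supp a \<union> supp b"
    using * keys_add[of a b] by blast
  then show "i < n" using * ab by blast
qed

lemma sum_polys: "(\<And>i. i \<in> A \<Longrightarrow> f i \<in> polys n) \<Longrightarrow> sum f A \<in> polys n"
  by (induction A rule: infinite_finite_induct) (auto intro: add_polys)

subsection \<open>Homogeneous components\<close>

definition homogeneous :: "nat \<Rightarrow> mpoly \<Rightarrow> bool" where
  "homogeneous e p \<longleftrightarrow> (\<forall>m\<in>supp p. mon_deg m = e)"

definition hcomp :: "nat \<Rightarrow> mpoly \<Rightarrow> mpoly" where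
  "hcomp e p = (\<Sum>m\<in>supp p. if mon_deg m = e then sgl m (lkp p m) else 0)"

lemma lookup_hcomp: "lkp (hcomp e p) m = (if mon_deg m = e then lkp p m else 0)"
proof -
  have "lkp (hcomp e p) m
      = (\<Sum>k\<in>supp p. if k = m then (if mon_deg m = e then lkp p m else 0) else 0)"
    unfolding hcomp_def lookup_sum by (intro sum.cong) (auto simp: lookup_single when_def)
  also have "\<dots> = (if mon_deg m = e then lkp p m else 0)" by (simp add: in_keys_iff)
  finally show ?thesis .
qed

lemma hcomp_zero [simp]: "hcomp e 0 = 0" by (simp add: hcomp_def)

lemma hcomp_add: "hcomp e (p + q) = hcomp e p + hcomp e q"
  by (rule poly_mapping_eqI) (simp add: lookup_hcomp lookup_add)

lemma hcomp_diff: "hcomp e (p - q) = hcomp e p - hcomp e q"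
  by (rule poly_mapping_eqI) (simp add: lookup_hcomp lookup_minus)

lemma hcomp_single: "hcomp e (sgl m c) = (if mon_deg m = e then sgl m c else 0)"
  by (rule poly_mapping_eqI) (auto simp: lookup_hcomp lookup_single when_def)

lemma hcomp_homogeneous: "homogeneous e p \<Longrightarrow> hcomp e p = p"
  by (rule poly_mapping_eqI) (auto simp: lookup_hcomp homogeneous_def in_keys_iff)

lemma homogeneous_hcomp [simp]: "homogeneous e (hcomp e p)"
  by (auto simp: homogeneous_def in_keys_iff lookup_hcomp split: if_splits)

lemma hcomp_polys: "p \<in> polys n \<Longrightarrow> hcomp e p \<in> polys n"
  by (auto simp: polys_def in_keys_iff lookup_hcomp split: if_splits)

lemma homogeneous_zero [simp]: "homogeneous e 0" by (simp add: homogeneous_def)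

text \<open>Degree bookkeeping for the Koszul maps. That nothing lands in degree 0 is what starts
  the graded Nakayama induction.\<close>

lemma hcomp_linear_mult:
  assumes "homogeneous 1 l"
  shows "hcomp (Suc e) (l * p) = l * hcomp e p" "hcomp 0 (l * p) = 0"
proof -
  have *: "hcomp (Suc e) (l * p) = l * hcomp e p \<and> hcomp 0 (l * p) = 0"
  proof (induction l rule: mpoly_induct)
    case (single m c)
    then have "mon_deg m = 1" using assms by (simp add: homogeneous_def)
    then show ?case
      by (induction p rule: mpoly_induct)
        (simp_all add: mult_single hcomp_single hcomp_add mon_deg_add distrib_left)
  qed (simp_all add: hcomp_add algebra_simps)
  then show "hcomp (Suc e) (l * p) = l * hcomp e p" "hcomp 0 (l * p) = 0" by auto
qed

lemma homogeneous_var [simp]: "homogeneous 1 (var i)"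
  by (simp add: homogeneous_def var_def mon_deg_def)

lemma homogeneous_diff: "homogeneous e p \<Longrightarrow> homogeneous e q \<Longrightarrow> homogeneous e (p - q)"
  unfolding homogeneous_def by (auto simp: in_keys_iff lookup_minus)

text \<open>On the ray t x the grading of p becomes the grading of a univariate polynomial by powers
  of t, so values of components can be read off as coefficients.\<close>

lemma hcomp_poly_of_scaling:
  "\<exists>r. (\<forall>t. poly r t = peval p (\<lambda>i. t * x i)) \<and> (\<forall>e. coeff r e = peval (hcomp e p) x)"
proof (induction p rule: mpoly_induct)
  case zero
  show ?case by (rule exI[of _ 0]) simp
next
  case (single m c)
  show ?case
    by (rule exI[of _ "monom (c * mon_eval m x) (mon_deg m)"])
      (auto simp: poly_monom peval_single mon_eval_scale hcomp_single)
next
  case (add p q)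
  then obtain r r' where
    "\<forall>t. poly r t = peval p (\<lambda>i. t * x i)" "\<forall>e. coeff r e = peval (hcomp e p) x"
    "\<forall>t. poly r' t = peval q (\<lambda>i. t * x i)" "\<forall>e. coeff r' e = peval (hcomp e q) x" by blast
  then show ?case
    by (intro exI[of _ "r + r'"]) (simp add: peval_add hcomp_add)
qed

lemma poly_eq_nonzero:
  fixes p q :: "complex poly"
  assumes "\<And>t. t \<noteq> 0 \<Longrightarrow> poly p t = poly q t"
  shows "p = q"
proof -
  have "poly ([:0, 1:] * p) = poly ([:0, 1:] * q)"
  proof
    show "poly ([:0, 1:] * p) t = poly ([:0, 1:] * q) t" for t
      by (cases "t = 0") (simp_all add: assms)
  qed
  then have "[:0, 1:] * p = [:0, 1:] * q" by (simp only: poly_eq_poly_eq_iff)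
  then show ?thesis using mult_left_cancel[of "[:0, 1:]" p q] by simp
qed

text \<open>Only t \<noteq> 0 may be assumed, since the complement of a linear subspace is not
  stable under scaling by 0.\<close>

lemma peval_hcomp_eq:
  assumes "\<And>t. t \<noteq> 0 \<Longrightarrow> peval p (\<lambda>i. t * x i) = t ^ e * v"
  shows "peval (hcomp k p) x = (if k = e then v else 0)"
proof -
  obtain r where r: "\<forall>t. poly r t = peval p (\<lambda>i. t * x i)" "\<forall>e. coeff r e = peval (hcomp e p) x"
    using hcomp_poly_of_scaling by blast
  have "r = monom v e"
    by (rule poly_eq_nonzero) (simp add: r(1) assms poly_monom)
  then show ?thesis using r(2)[rule_format, of k] by (auto simp: )
qed

subsection \<open>Polynomial functions\<close>

definition polyfun :: "nat \<Rightarrow> ((nat \<Rightarrow> complex) \<Rightarrow> complex) \<Rightarrow> bool" where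
  "polyfun n f \<longleftrightarrow> (\<exists>p\<in>polys n. \<forall>x. f x = peval p x)"

lemma polyfun_peval: "p \<in> polys n \<Longrightarrow> polyfun n (peval p)"
  by (auto simp: polyfun_def)

lemma polyfun_const [intro!]: "polyfun n (\<lambda>x. c)"
  unfolding polyfun_def
  by (rule bexI[of _ "sgl 0 c"]) (auto simp: peval_single mon_eval_def polys_def)

lemma polyfun_coord [intro]: "i < n \<Longrightarrow> polyfun n (\<lambda>x. x i)"
  unfolding polyfun_def by (rule bexI[of _ "var i"]) auto

lemma polyfun_add [intro!]: "polyfun n f \<Longrightarrow> polyfun n g \<Longrightarrow> polyfun n (\<lambda>x. f x + g x)"
  unfolding polyfun_def by (metis add_polys peval_add)

lemma polyfun_diff [intro!]: "polyfun n f \<Longrightarrow> polyfun n g \<Longrightarrow> polyfun n (\<lambda>x. f x - g x)"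
  unfolding polyfun_def by (metis diff_polys peval_diff)

lemma polyfun_mult [intro!]: "polyfun n f \<Longrightarrow> polyfun n g \<Longrightarrow> polyfun n (\<lambda>x. f x * g x)"
  unfolding polyfun_def by (metis mult_polys peval_mult)

lemma polyfun_uminus [intro!]: "polyfun n f \<Longrightarrow> polyfun n (\<lambda>x. - f x)"
  unfolding polyfun_def by (metis uminus_polys peval_uminus)

lemma polyfun_divide [intro!]: "polyfun n f \<Longrightarrow> polyfun n (\<lambda>x. f x / c)"
  using polyfun_mult[OF _ polyfun_const[of n "1 / c"], of f] by simp

lemma polyfun_power [intro!]: "polyfun n f \<Longrightarrow> polyfun n (\<lambda>x. f x ^ k)"
  by (induction k) auto

lemma polyfun_sum [intro!]:
  "(\<And>i. i \<in> A \<Longrightarrow> polyfun n (f i)) \<Longrightarrow> polyfun n (\<lambda>x. \<Sum>i\<in>A. f i x)"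
  by (induction A rule: infinite_finite_induct) auto

lemma polyfun_prod [intro!]:
  "(\<And>i. i \<in> A \<Longrightarrow> polyfun n (f i)) \<Longrightarrow> polyfun n (\<lambda>x. \<Prod>i\<in>A. f i x)"
  by (induction A rule: infinite_finite_induct) auto

lemma peval_on_line:
  "\<exists>r. \<forall>t. poly r t = peval p (\<lambda>i. u i + t * v i)"
proof (induction p rule: mpoly_induct)
  case zero
  show ?case by (rule exI[of _ 0]) simp
next
  case (single m c)
  show ?case
    by (rule exI[of _ "[:c:] * (\<Prod>i\<in>supp m. [:u i, v i:] ^ lkp m i)"])
      (simp add: peval_single mon_eval_def poly_prod mult.commute)
next
  case (add p q)
  then obtain r r' where "\<forall>t. poly r t = peval p (\<lambda>i. u i + t * v i)"
    "\<forall>t. poly r' t = peval q (\<lambda>i. u i + t * v i)" by blast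
  then show ?case by (intro exI[of _ "r + r'"]) (simp add: peval_add)
qed

section \<open>Koszul cochains and depth\<close>

text \<open>An index list of Booleans marks a subset of the sequence, that is, a basis vector of the
  exterior algebra. The recursion presents the complex of \<open>x # L\<close> as the mapping cone
  of multiplication by x on the complex of \<open>L\<close>; the sign of the cone sits in the
  \<open>True\<close> branch.\<close>

fun koszul :: "mpoly list \<Rightarrow> (bool list \<Rightarrow> mpoly) \<Rightarrow> bool list \<Rightarrow> mpoly" where
  "koszul [] u s = 0"
| "koszul (x # L) u [] = 0"
| "koszul (x # L) u (False # s) = koszul L (\<lambda>s. u (False # s)) s"
| "koszul (x # L) u (True # s) = x * u (False # s) - koszul L (\<lambda>s. u (True # s)) s"

text \<open>Cochains of degree \<open>k - 1\<close>: the index is shifted so that \<open>k = 0\<close> means the zero cochain, which makes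
  the truncated \<open>k - 1\<close> harmless.\<close>

definition cochain :: "nat \<Rightarrow> mpoly list \<Rightarrow> nat \<Rightarrow> (bool list \<Rightarrow> mpoly) \<Rightarrow> bool" where
  "cochain n L k u \<longleftrightarrow>
    (\<forall>s. u s \<in> polys n \<and> (u s \<noteq> 0 \<longrightarrow> length s = length L \<and> Suc (count_list s True) = k))"

lemma koszul_zero [simp]: "koszul L (\<lambda>s. 0) s = 0"
  by (induction L "\<lambda>s::bool list. 0::mpoly" s rule: koszul.induct) auto

lemma koszul_linear: "koszul L (\<lambda>s. r * u s + v s) s = r * koszul L u s + koszul L v s"
proof (induction L arbitrary: u v s)
  case (Cons x L)
  show ?case
  proof (cases s)
    case (Cons t s')
    then show ?thesis using Cons.IH by (cases t) (simp_all add: algebra_simps)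
  qed simp
qed simp

lemma koszul_diff: "koszul L (\<lambda>s. u s - v s) s = koszul L u s - koszul L v s"
  using koszul_linear[of L "-1" v u s] by simp

lemma koszul_mult: "koszul L (\<lambda>s. r * u s) s = r * koszul L u s"
  using koszul_linear[of L r u "\<lambda>s. 0" s] by simp

lemma koszul_koszul: "koszul L (koszul L u) s = 0"
proof (induction L arbitrary: u s)
  case (Cons x L)
  show ?case
  proof (cases s)
    case (Cons t s')
    then show ?thesis
      using Cons.IH by (cases t) (simp_all add: koszul_diff koszul_mult)
  qed simp
qed simp

lemma cochain_False: "cochain n (x # L) k u \<Longrightarrow> cochain n L k (\<lambda>s. u (False # s))"
  unfolding cochain_def by fastforce

lemma cochain_True: "cochain n (x # L) k u \<Longrightarrow> cochain n L (k - 1) (\<lambda>s. u (True # s))"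
  unfolding cochain_def by fastforce

lemma cochain_0: "cochain n L 0 u \<Longrightarrow> u s = 0"
  unfolding cochain_def by auto

lemma cochain_zero [simp]: "cochain n L k (\<lambda>s. 0)"
  unfolding cochain_def by auto

lemma cochain_linear:
  "r \<in> polys n \<Longrightarrow> cochain n L k u \<Longrightarrow> cochain n L k v \<Longrightarrow> cochain n L k (\<lambda>s. r * u s + v s)"
  unfolding cochain_def by (metis add.left_neutral add_polys mult_polys mult_zero_right)

lemma cochain_mult: "r \<in> polys n \<Longrightarrow> cochain n L k u \<Longrightarrow> cochain n L k (\<lambda>s. r * u s)"
  using cochain_linear[of r n L k u "\<lambda>s. 0"] by simp

lemma cochain_diff: "cochain n L k u \<Longrightarrow> cochain n L k v \<Longrightarrow> cochain n L k (\<lambda>s. u s - v s)"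
  using cochain_linear[of "-1" n L k v u] by (simp add: uminus_polys)

lemma cochain_ConsI:
  assumes "u [] = 0" "cochain n L k (\<lambda>s. u (False # s))" "cochain n L (k - 1) (\<lambda>s. u (True # s))"
    "\<And>s. k = 1 \<Longrightarrow> u (True # s) = 0"
  shows "cochain n (x # L) k u"
  unfolding cochain_def
proof (intro allI)
  fix s show "u s \<in> polys n \<and> (u s \<noteq> 0 \<longrightarrow> length s = length (x # L) \<and> Suc (count_list s True) = k)"
  proof (cases s)
    case Nil then show ?thesis using assms(1) by simp
  next
    case (Cons t s')
    show ?thesis
    proof (cases t)
      case True
      have "u (True # s') \<in> polys n" "u (True # s') \<noteq> 0 \<Longrightarrow> length s' = length L \<and> Suc (count_list s' True) = k - 1"
        using assms(3) by (auto simp: cochain_def)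
      then show ?thesis using assms(4)[of s'] Cons True by auto
    next
      case False
      then show ?thesis using assms(2) Cons by (auto simp: cochain_def)
    qed
  qed
qed

lemma cochain_koszul:
  "set L \<subseteq> polys n \<Longrightarrow> cochain n L k u \<Longrightarrow> cochain n L (Suc k) (koszul L u)"
proof (induction L arbitrary: u k)
  case (Cons x L)
  show ?case
  proof (cases k)
    case 0
    then have "u = (\<lambda>s. 0)" using cochain_0 Cons.prems by blast
    moreover have "koszul (x # L) (\<lambda>s. 0) = (\<lambda>s. 0)" by (intro ext) simp
    ultimately show ?thesis by simp
  next
    case (Suc k')
    have u0: "cochain n L k (\<lambda>s. u (False # s))" using Cons.prems cochain_False by blast
    have u1: "cochain n L k' (\<lambda>s. u (True # s))" using Cons.prems cochain_True Suc by force
    show ?thesis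
    proof (rule cochain_ConsI)
      show "cochain n L (Suc k) (\<lambda>s. koszul (x # L) u (False # s))"
        using Cons.IH[OF _ u0] Cons.prems by simp
      have "cochain n L k (koszul L (\<lambda>s. u (True # s)))"
        using Cons.IH[OF _ u1] Cons.prems Suc by simp
      then show "cochain n L (Suc k - 1) (\<lambda>s. koszul (x # L) u (True # s))"
        using u0 Cons.prems by (simp add: cochain_diff cochain_mult)
    qed (use Suc in auto)
  qed
qed (simp add: cochain_def)

lemma ideal_closed:
  assumes "is_ideal n I"
  shows ideal_0: "0 \<in> I" and ideal_add: "a \<in> I \<Longrightarrow> b \<in> I \<Longrightarrow> a + b \<in> I"
    and ideal_mult: "a \<in> I \<Longrightarrow> r \<in> polys n \<Longrightarrow> r * a \<in> I"
    and ideal_uminus: "a \<in> I \<Longrightarrow> - a \<in> I"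
    and ideal_diff: "a \<in> I \<Longrightarrow> b \<in> I \<Longrightarrow> a - b \<in> I"
proof -
  show 0: "0 \<in> I" and add: "a \<in> I \<Longrightarrow> b \<in> I \<Longrightarrow> a + b \<in> I"
    and mult: "a \<in> I \<Longrightarrow> r \<in> polys n \<Longrightarrow> r * a \<in> I" for a b r
    using assms by (auto simp: is_ideal_def)
  show um: "a \<in> I \<Longrightarrow> - a \<in> I" for a
    using mult[of a "-1"] by (simp add: uminus_polys)
  show "a \<in> I \<Longrightarrow> b \<in> I \<Longrightarrow> a - b \<in> I"
    using add[of a "- b"] um[of b] by simp
qed

lemma koszul_ideal:
  assumes "is_ideal n I"
  shows "set L \<subseteq> polys n \<Longrightarrow> \<forall>s. u s \<in> I \<Longrightarrow> koszul L u s \<in> I"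
proof (induction L arbitrary: u s)
  case Nil
  then show ?case using ideal_0[OF assms] by simp
next
  case (Cons x L)
  show ?case
  proof (cases s)
    case Nil
    then show ?thesis using ideal_0[OF assms] by simp
  next
    case (Cons t s')
    then show ?thesis using Cons.IH Cons.prems
      by (cases t) (auto intro!: ideal_diff[OF assms] ideal_mult[OF assms])
  qed
qed

subsection \<open>Homotopies\<close>

text \<open>A contraction making multiplication by f trivial on cohomology. It preserves every
  ideal, so that it descends to S/I, and is linear, so that contractions can be combined and carried
  through the cone.\<close>

definition homotopy :: "nat \<Rightarrow> mpoly list \<Rightarrow> mpoly \<Rightarrow> ((bool list \<Rightarrow> mpoly) \<Rightarrow> bool list \<Rightarrow> mpoly) \<Rightarrow> bool" where
  "homotopy n L f \<iota> \<longleftrightarrow>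
     (\<forall>k u. cochain n L k u \<longrightarrow> cochain n L (k - 1) (\<iota> u))
   \<and> (\<forall>I u s. is_ideal n I \<and> (\<forall>s. u s \<in> I) \<longrightarrow> \<iota> u s \<in> I)
   \<and> (\<forall>r u v s. \<iota> (\<lambda>s. r * u s + v s) s = r * \<iota> u s + \<iota> v s)
   \<and> (\<forall>k u s. cochain n L k u \<longrightarrow> koszul L (\<iota> u) s + \<iota> (koszul L u) s = f * u s)"

lemma homotopyD:
  assumes "homotopy n L f \<iota>"
  shows "cochain n L k u \<Longrightarrow> cochain n L (k - 1) (\<iota> u)"
    "is_ideal n I \<Longrightarrow> \<forall>s. u s \<in> I \<Longrightarrow> \<iota> u s \<in> I"
    "\<iota> (\<lambda>s. r * u s + v s) s = r * \<iota> u s + \<iota> v s"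
    "cochain n L k u \<Longrightarrow> koszul L (\<iota> u) s + \<iota> (koszul L u) s = f * u s"
  using assms unfolding homotopy_def by blast+

lemma homotopy_zero: "homotopy n L 0 (\<lambda>u s. 0)"
  unfolding homotopy_def by (auto intro: ideal_0)

lemma homotopy_add:
  assumes "homotopy n L f \<iota>" "homotopy n L g \<kappa>" "r \<in> polys n"
  shows "homotopy n L (r * f + g) (\<lambda>u s. r * \<iota> u s + \<kappa> u s)"
  unfolding homotopy_def
proof (intro conjI allI impI)
  note i = homotopyD[OF assms(1)] and k = homotopyD[OF assms(2)]
  show "cochain n L (k - 1) (\<lambda>s. r * \<iota> u s + \<kappa> u s)" if "cochain n L k u" for k u
    by (rule cochain_linear[OF assms(3) i(1)[OF that] k(1)[OF that]])
  show "r * \<iota> u s + \<kappa> u s \<in> I" if "is_ideal n I \<and> (\<forall>s. u s \<in> I)" for I u s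
    using that i(2)[of I u s] k(2)[of I u s] assms(3) by (auto intro: ideal_add ideal_mult)
  show "r * \<iota> (\<lambda>s. r' * u s + v s) s + \<kappa> (\<lambda>s. r' * u s + v s) s
      = r' * (r * \<iota> u s + \<kappa> u s) + (r * \<iota> v s + \<kappa> v s)" for r' u v s
    unfolding i(3) k(3) by (simp add: algebra_simps)
  show "koszul L (\<lambda>s. r * \<iota> u s + \<kappa> u s) s + (r * \<iota> (koszul L u) s + \<kappa> (koszul L u) s) = (r * f + g) * u s"
    if "cochain n L k u" for k u s
    unfolding koszul_linear distrib_right mult.assoc i(4)[OF that, of s, symmetric] k(4)[OF that, of s, symmetric]
    by (simp add: distrib_left)
qed

fun contract_head :: "(bool list \<Rightarrow> mpoly) \<Rightarrow> bool list \<Rightarrow> mpoly" where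
  "contract_head u (False # s) = u (True # s)"
| "contract_head u _ = 0"

fun contract_tail :: "((bool list \<Rightarrow> mpoly) \<Rightarrow> bool list \<Rightarrow> mpoly) \<Rightarrow> (bool list \<Rightarrow> mpoly) \<Rightarrow> bool list \<Rightarrow> mpoly" where
  "contract_tail \<iota> u (False # s) = \<iota> (\<lambda>s. u (False # s)) s"
| "contract_tail \<iota> u (True # s) = - \<iota> (\<lambda>s. u (True # s)) s"
| "contract_tail \<iota> u [] = 0"

text \<open>\<open>contract_head\<close> is the interior product with the dual of the first basis
  vector; this is its Cartan formula.\<close>

lemma homotopy_head:
  shows "homotopy n (x # L) x contract_head"
  unfolding homotopy_def
proof (intro conjI allI impI)
  show "cochain n (x # L) (k - 1) (contract_head u)" if u: "cochain n (x # L) k u" for k u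
    by (rule cochain_ConsI) (use cochain_True[OF u] in simp_all)
  show "contract_head u s \<in> I" if "is_ideal n I \<and> (\<forall>s. u s \<in> I)" for I u s
    using that by (cases "(u, s)" rule: contract_head.cases) (auto intro: ideal_0)
  show "contract_head (\<lambda>s. r * u s + v s) s = r * contract_head u s + contract_head v s" for r u v s
    by (cases "(u, s)" rule: contract_head.cases) auto
  show "koszul (x # L) (contract_head u) s + contract_head (koszul (x # L) u) s = x * u s"
    if "cochain n (x # L) k u" for k u s
    using that by (cases "(u, s)" rule: contract_head.cases) (auto simp: cochain_def)
qed

text \<open>The minus sign in the \<open>True\<close> half of \<open>contract_tail\<close> makes it
  anticommute with multiplication by the new head x, so the two mixed terms cancel.\<close>

lemma homotopy_tail:
  assumes "homotopy n L f \<iota>"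
  shows "homotopy n (x # L) f (contract_tail \<iota>)"
  unfolding homotopy_def
proof (intro conjI allI impI)
  note i = homotopyD[OF assms]
  have diff: "\<iota> (\<lambda>s. x * u s - v s) s = x * \<iota> u s - \<iota> v s" for u v s
    using i(3)[of "-1" v "\<lambda>s. x * u s" s] i(3)[of x u "\<lambda>s. 0" s] i(3)[of "-1" "\<lambda>s. 0" "\<lambda>s. 0" s]
    by simp
  have um: "koszul L (\<lambda>s. - w s) s = - koszul L w s" for w s
    using koszul_mult[of L "-1" w s] by simp
  show "cochain n (x # L) (k - 1) (contract_tail \<iota> u)" if u: "cochain n (x # L) k u" for k u
  proof (rule cochain_ConsI)
    have u1: "cochain n L (k - 1) (\<lambda>s. u (True # s))" by (rule cochain_True[OF u])
    show "cochain n L (k - 1 - 1) (\<lambda>s. contract_tail \<iota> u (True # s))"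
      using cochain_mult[of "-1", OF _ i(1)[OF u1]] by (simp add: uminus_polys)
    show "contract_tail \<iota> u (True # s) = 0" if "k - 1 = 1" for s
      using i(1)[OF u1] that by (auto dest: cochain_0)
  qed (use i(1)[OF cochain_False[OF u]] in simp_all)
  show "contract_tail \<iota> u s \<in> I" if "is_ideal n I \<and> (\<forall>s. u s \<in> I)" for I u s
    using that i(2)[of I] by (cases "(u, s)" rule: contract_head.cases) (auto intro: ideal_0 ideal_uminus)
  show "contract_tail \<iota> (\<lambda>s. r * u s + v s) s = r * contract_tail \<iota> u s + contract_tail \<iota> v s" for r u v s
    by (cases "(u, s)" rule: contract_head.cases) (simp_all add: i(3))
  show "koszul (x # L) (contract_tail \<iota> u) s + contract_tail \<iota> (koszul (x # L) u) s = f * u s"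
    if u: "cochain n (x # L) k u" for k u s
  proof (cases s)
    case Nil
    then show ?thesis using u by (auto simp: cochain_def)
  next
    case (Cons t s')
    show ?thesis
    proof (cases t)
      case True
      then show ?thesis using Cons i(4)[OF cochain_True[OF u], of s'] by (simp add: diff um)
    next
      case False
      then show ?thesis using Cons i(4)[OF cochain_False[OF u], of s'] by simp
    qed
  qed
qed

section \<open>Elements annihilating Koszul cohomology\<close>

definition null_homotopic :: "nat \<Rightarrow> mpoly list \<Rightarrow> mpoly \<Rightarrow> bool" where
  "null_homotopic n L f \<longleftrightarrow> (\<exists>\<iota>. homotopy n L f \<iota>)"

lemma null_homotopic_mem: "f \<in> set L \<Longrightarrow> null_homotopic n L f"
proof (induction L)
  case (Cons x L)
  show ?case
  proof (cases "f = x")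
    case True
    then show ?thesis using homotopy_head unfolding null_homotopic_def by blast
  next
    case False
    then show ?thesis using Cons homotopy_tail unfolding null_homotopic_def by fastforce
  qed
qed simp

lemma null_homotopic_zero: "null_homotopic n L 0"
  using homotopy_zero unfolding null_homotopic_def by blast

lemma null_homotopic_linear:
  "null_homotopic n L f \<Longrightarrow> null_homotopic n L g \<Longrightarrow> r \<in> polys n \<Longrightarrow> null_homotopic n L (r * f + g)"
  using homotopy_add unfolding null_homotopic_def by blast

lemma null_homotopic_sum:
  "finite A \<Longrightarrow> (\<And>i. i \<in> A \<Longrightarrow> null_homotopic n L (f i)) \<Longrightarrow> null_homotopic n L (sum f A)"
proof (induction A rule: finite_induct)
  case (insert a A)
  then show ?case using null_homotopic_linear[of n L "f a" "sum f A" 1] by simp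
qed (simp add: null_homotopic_zero)

text \<open>Null-homotopic elements are closed under polynomial combinations, and a polynomial
  without constant term is a combination of variables. This covers arbitrary elements of a regular
  sequence although the Koszul complex is formed on linear forms.\<close>

lemma null_homotopic_max_ideal:
  assumes "f \<in> max_ideal n" "\<And>i. i < n \<Longrightarrow> null_homotopic n L (var i)"
  shows "null_homotopic n L f"
proof -
  have "null_homotopic n L (sgl m (lkp f m))" if m: "m \<in> supp f" for m
  proof -
    have "m \<noteq> 0" using m assms(1) by (auto simp: max_ideal_def in_keys_iff)
    then obtain i where i: "i \<in> supp m" by fastforce
    have less: "j < n" if "j \<in> supp m" for j
      using that m assms(1) by (auto simp: max_ideal_def polys_def)
    define m' where "m' = m - sgl i 1"
    have mm: "m = m' + sgl i 1"
      by (rule poly_mapping_eqI)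
        (use i in \<open>auto simp: m'_def lookup_add lookup_minus lookup_single when_def in_keys_iff\<close>)
    have "supp m' \<subseteq> supp m"
      by (auto simp: m'_def in_keys_iff lookup_minus)
    then have "sgl m' (lkp f m) \<in> polys n" using less by (intro single_polys) auto
    moreover have "sgl m (lkp f m) = sgl m' (lkp f m) * var i"
      unfolding var_def mult_single mm[symmetric] by simp
    ultimately show ?thesis
      using null_homotopic_linear[OF assms(2)[OF less[OF i]] null_homotopic_zero] by simp
  qed
  then have "null_homotopic n L (\<Sum>m\<in>supp f. sgl m (lkp f m))"
    by (intro null_homotopic_sum) auto
  then show ?thesis by (simp flip: mpoly_sum_singles)
qed

subsection \<open>Regular sequences give exactness\<close>

text \<open>Because of the shifted index this is, for positive k, the vanishing of H^(k-1)(L; S/I):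
  cochains have polynomial entries, and the cocycle and coboundary conditions are read modulo
  I.\<close>

definition exact_at :: "nat \<Rightarrow> mpoly set \<Rightarrow> mpoly list \<Rightarrow> nat \<Rightarrow> bool" where
  "exact_at n I L k \<longleftrightarrow> (\<forall>u. cochain n L k u \<and> (\<forall>s. koszul L u s \<in> I)
     \<longrightarrow> (\<exists>w. cochain n L (k - 1) w \<and> (\<forall>s. u s - koszul L w s \<in> I)))"

lemma exact_at_0: "is_ideal n I \<Longrightarrow> exact_at n I L 0"
  unfolding exact_at_def by (auto intro!: exI[of _ "\<lambda>s. 0"] simp: cochain_0 ideal_0)

lemma is_ideal_ideal_plus:
  assumes "is_ideal n I" "set fs \<subseteq> polys n"
  shows "is_ideal n (ideal_plus n I fs)"
  unfolding is_ideal_def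
proof (intro conjI ballI subsetI)
  fix p assume "p \<in> ideal_plus n I fs"
  then obtain h a where "h \<in> I" "\<forall>j<length fs. a j \<in> polys n" "p = h + (\<Sum>j<length fs. a j * fs ! j)"
    unfolding ideal_plus_def by blast
  moreover have "I \<subseteq> polys n" using assms by (simp add: is_ideal_def)
  ultimately show "p \<in> polys n"
    using assms(2) by (auto intro!: add_polys sum_polys mult_polys)
next
  show "0 \<in> ideal_plus n I fs"
    unfolding ideal_plus_def using ideal_0[OF assms(1)]
    by (auto intro!: exI[of _ "0::mpoly"] exI[of _ "\<lambda>_. 0::mpoly"])
next
  fix p q assume "p \<in> ideal_plus n I fs" "q \<in> ideal_plus n I fs"
  then obtain h a h' a' where "h \<in> I" "\<forall>j<length fs. a j \<in> polys n" "p = h + (\<Sum>j<length fs. a j * fs ! j)"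
    "h' \<in> I" "\<forall>j<length fs. a' j \<in> polys n" "q = h' + (\<Sum>j<length fs. a' j * fs ! j)"
    unfolding ideal_plus_def by blast
  then show "p + q \<in> ideal_plus n I fs"
    unfolding ideal_plus_def
    by (auto intro!: exI[of _ "h + h'"] exI[of _ "\<lambda>j. a j + a' j"] add_polys ideal_add[OF assms(1)]
        simp: algebra_simps sum.distrib)
next
  fix p r assume "p \<in> ideal_plus n I fs" "r \<in> polys n"
  moreover from this obtain h a where "h \<in> I" "\<forall>j<length fs. a j \<in> polys n" "p = h + (\<Sum>j<length fs. a j * fs ! j)"
    unfolding ideal_plus_def by blast
  ultimately show "r * p \<in> ideal_plus n I fs"
    unfolding ideal_plus_def
    by (auto intro!: exI[of _ "r * h"] exI[of _ "\<lambda>j. r * a j"] mult_polys ideal_mult[OF assms(1)]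
        simp: algebra_simps sum_distrib_left)
qed

lemma ideal_plus_snoc:
  "ideal_plus n I (fs @ [f]) = {p + a * f | p a. p \<in> ideal_plus n I fs \<and> a \<in> polys n}"
proof (intro equalityI subsetI)
  fix q assume "q \<in> ideal_plus n I (fs @ [f])"
  then obtain h a where ha: "h \<in> I" "\<forall>j<Suc (length fs). a j \<in> polys n"
    "q = h + (\<Sum>j<Suc (length fs). a j * (fs @ [f]) ! j)"
    unfolding ideal_plus_def by auto
  have "q = (h + (\<Sum>j<length fs. a j * fs ! j)) + a (length fs) * f"
    using ha(3) by (simp add: nth_append add.assoc)
  moreover have "h + (\<Sum>j<length fs. a j * fs ! j) \<in> ideal_plus n I fs"
    unfolding ideal_plus_def using ha(1,2) by (auto intro!: exI[of _ h] exI[of _ a])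
  ultimately show "q \<in> {p + a * f | p a. p \<in> ideal_plus n I fs \<and> a \<in> polys n}" using ha by blast
next
  fix q assume "q \<in> {p + a * f | p a. p \<in> ideal_plus n I fs \<and> a \<in> polys n}"
  then obtain h a b where ha: "h \<in> I" "\<forall>j<length fs. a j \<in> polys n" "b \<in> polys n"
    "q = h + (\<Sum>j<length fs. a j * fs ! j) + b * f"
    unfolding ideal_plus_def by blast
  then have "q = h + (\<Sum>j<length (fs @ [f]). (a(length fs := b)) j * (fs @ [f]) ! j)"
    by (simp add: nth_append add.assoc)
  moreover have "\<forall>j<length (fs @ [f]). (a(length fs := b)) j \<in> polys n" using ha by (auto simp: less_Suc_eq)
  ultimately show "q \<in> ideal_plus n I (fs @ [f])" unfolding ideal_plus_def using ha(1) by blast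
qed

text \<open>As \<open>f\<close> is null-homotopic, \<open>f u\<close> is the coboundary of some \<open>w\<close>; modulo \<open>f\<close>, \<open>w\<close> is a cocycle of one
  degree less.\<close>

lemma exact_at_regular_step:
  assumes I: "is_ideal n I" and J: "J = {p + a * f | p a. p \<in> I \<and> a \<in> polys n}" "is_ideal n J"
    and f: "null_homotopic n L f" "f \<in> polys n" "\<And>g. g \<in> polys n \<Longrightarrow> f * g \<in> I \<Longrightarrow> g \<in> I"
    and L: "set L \<subseteq> polys n" and ex: "exact_at n J L k"
  shows "exact_at n I L (Suc k)"
  unfolding exact_at_def
proof (intro allI impI, elim conjE)
  fix u assume u: "cochain n L (Suc k) u" "\<forall>s. koszul L u s \<in> I"
  obtain \<iota> where \<iota>: "homotopy n L f \<iota>" using f(1) by (auto simp: null_homotopic_def)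
  define w where "w = \<iota> u"
  have w: "cochain n L k w" using homotopyD(1)[OF \<iota> u(1)] by (simp add: w_def)
  have IJ: "p \<in> J" if "p \<in> I" for p
    unfolding J using that by (intro CollectI exI[of _ p] exI[of _ 0]) simp
  have fJ: "f * p \<in> J" if "p \<in> polys n" for p
    unfolding J using that ideal_0[OF I]
    by (intro CollectI exI[of _ "0::mpoly"] exI[of _ p]) (simp add: mult.commute)
  have dw: "koszul L w s - f * u s \<in> I" for s
  proof -
    have "koszul L w s - f * u s = - \<iota> (koszul L u) s"
      unfolding w_def homotopyD(4)[OF \<iota> u(1), of s, symmetric] by simp
    then show ?thesis using ideal_uminus[OF I homotopyD(2)[OF \<iota> I u(2), of s]] by simp
  qed
  have "koszul L w s \<in> J" for s
    using ideal_add[OF J(2) IJ[OF dw[of s]] fJ[of "u s"]] u(1) by (simp add: cochain_def)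
  then obtain v where v: "cochain n L (k - 1) v" "\<forall>s. w s - koszul L v s \<in> J"
    using ex w unfolding exact_at_def by blast
  \<comment> \<open>Choosing 0 wherever \<open>w s - koszul L v s\<close> is 0 keeps the quotient
    \<open>w'\<close> supported in the right degree.\<close>
  have "\<exists>a. a \<in> polys n \<and> w s - koszul L v s - a * f \<in> I \<and> (w s - koszul L v s = 0 \<longrightarrow> a = 0)" for s
  proof (cases "w s - koszul L v s = 0")
    case True
    then show ?thesis using ideal_0[OF I] by (auto intro!: exI[of _ 0])
  next
    case False
    obtain p a where "p \<in> I" "a \<in> polys n" "w s - koszul L v s = p + a * f"
      using v(2) unfolding J by blast
    then show ?thesis using False by (intro exI[of _ a]) simp
  qed
  then obtain w' where w': "\<And>s. w' s \<in> polys n" "\<And>s. w s - koszul L v s - w' s * f \<in> I"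
    "\<And>s. w s - koszul L v s = 0 \<Longrightarrow> w' s = 0" by metis
  have cw: "cochain n L k (\<lambda>s. w s - koszul L v s)"
  proof (cases k)
    case 0
    then have "v = (\<lambda>s. 0)" using v(1) cochain_0 by fastforce
    then show ?thesis using w by simp
  next
    case (Suc k')
    then show ?thesis using cochain_diff[OF w] cochain_koszul[OF L v(1)] by simp
  qed
  have cw': "cochain n L k w'"
    unfolding cochain_def using w' cw unfolding cochain_def by blast
  have "u s - koszul L w' s \<in> I" for s
  proof -
    \<comment> \<open>The differential of w - dv - f w' is dw - f dw', because ddv = 0; combined
      with dw = f u modulo I this leaves f (u - dw').\<close>
    have "koszul L (\<lambda>s. (w s - koszul L v s) - f * w' s) s \<in> I"
      using w'(2) by (intro koszul_ideal[OF I L]) (simp add: mult.commute)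
    then have "koszul L w s - f * koszul L w' s \<in> I"
      by (simp add: koszul_diff koszul_mult koszul_koszul)
    from ideal_diff[OF I this dw[of s]] have "f * (u s - koszul L w' s) \<in> I"
      by (simp add: algebra_simps)
    moreover have "u s - koszul L w' s \<in> polys n"
      using u(1) cochain_koszul[OF L cw'] by (auto simp: cochain_def intro: diff_polys)
    ultimately show ?thesis using f(3) by blast
  qed
  then show "\<exists>w. cochain n L (Suc k - 1) w \<and> (\<forall>s. u s - koszul L w s \<in> I)"
    using cw' by auto
qed

text \<open>Induction on the number j of elements not yet divided out: undoing one division gains
  one degree of exactness, starting from the trivial index 0 at j = 0. The only link between
  \<open>L\<close> and \<open>fs\<close> is that each element of \<open>fs\<close> is null-homotopic
  over \<open>L\<close>.\<close>

lemma exact_at_regular_seq: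
  assumes I: "is_ideal n I" and reg: "regular_seq n I fs" and L: "set L \<subseteq> polys n"
    and null: "\<And>f. f \<in> set fs \<Longrightarrow> null_homotopic n L f"
  shows "m + j = length fs \<Longrightarrow> k \<le> j \<Longrightarrow> exact_at n (ideal_plus n I (take m fs)) L k"
proof (induction j arbitrary: m k)
  have fs: "set fs \<subseteq> polys n" using reg by (auto simp: regular_seq_def max_ideal_def)
  have ideal: "is_ideal n (ideal_plus n I (take m fs))" for m
    using is_ideal_ideal_plus[OF I] fs set_take_subset by (metis subset_trans)
  {
    case 0
    then show ?case using exact_at_0[OF ideal[of m]] by simp
  next
    case (Suc j)
    show ?case
    proof (cases k)
      case 0
      then show ?thesis using exact_at_0[OF ideal[of m]] by simp
    next
      case (Suc k')
      have m: "m < length fs" using Suc.prems by simp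
      have tk: "take (Suc m) fs = take m fs @ [fs ! m]" using m by (simp add: take_Suc_conv_app_nth)
      show ?thesis unfolding Suc
      proof (rule exact_at_regular_step[OF ideal])
        show "ideal_plus n I (take (Suc m) fs) = {p + a * fs ! m | p a. p \<in> ideal_plus n I (take m fs) \<and> a \<in> polys n}"
          unfolding tk ideal_plus_snoc ..
        show "exact_at n (ideal_plus n I (take (Suc m) fs)) L k'"
          using Suc.IH[of "Suc m" k'] Suc.prems Suc by simp
        show "g \<in> ideal_plus n I (take m fs)" if "g \<in> polys n" "fs ! m * g \<in> ideal_plus n I (take m fs)" for g
          using reg m that unfolding regular_seq_def by blast
      qed (use m fs null L ideal in auto)
    qed
  }
qed

subsection \<open>Graded Nakayama: removing parameters\<close>

text \<open>All entries of the cocycle have one degree e, which gives an induction on e; no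
  homogeneity is asked of the primitive w.\<close>

definition graded_exact_at :: "nat \<Rightarrow> mpoly set \<Rightarrow> mpoly list \<Rightarrow> nat \<Rightarrow> bool" where
  "graded_exact_at n I L k \<longleftrightarrow>
    (\<forall>e u. cochain n L k u \<and> (\<forall>s. homogeneous e (u s)) \<and> (\<forall>s. koszul L u s \<in> I)
     \<longrightarrow> (\<exists>w. cochain n L (k - 1) w \<and> (\<forall>s. u s - koszul L w s \<in> I)))"

lemma koszul_hcomp:
  assumes "\<forall>l\<in>set L. homogeneous 1 l"
  shows "koszul L (\<lambda>s. hcomp e (u s)) s = hcomp (Suc e) (koszul L u s)" "hcomp 0 (koszul L u s) = 0"
proof -
  have "koszul L (\<lambda>s. hcomp e (u s)) s = hcomp (Suc e) (koszul L u s) \<and> hcomp 0 (koszul L u s) = 0"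
    using assms
  proof (induction L arbitrary: u s)
    case (Cons x L)
    show ?case
    proof (cases s)
      case (Cons t s')
      then show ?thesis using Cons.IH Cons.prems
        by (cases t) (simp_all add: hcomp_diff hcomp_linear_mult)
    qed simp
  qed simp
  then show "koszul L (\<lambda>s. hcomp e (u s)) s = hcomp (Suc e) (koszul L u s)" "hcomp 0 (koszul L u s) = 0"
    by auto
qed

lemma cochain_hcomp: "cochain n L k u \<Longrightarrow> cochain n L k (\<lambda>s. hcomp e (u s))"
  unfolding cochain_def by (metis hcomp_polys hcomp_zero)

text \<open>The long exact sequence makes \<open>y\<close> surjective on the cohomology of \<open>L\<close>, whose internal degrees are
  bounded below.\<close>

lemma graded_exact_at_remove:
  assumes I: "is_ideal n I" "\<And>p e. p \<in> I \<Longrightarrow> hcomp e p \<in> I"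
    and y: "homogeneous 1 y" "y \<in> polys n"
    and L: "\<forall>l\<in>set L. homogeneous 1 l" "set L \<subseteq> polys n"
    and ex: "graded_exact_at n I (y # L) (Suc k)"
  shows "graded_exact_at n I L k"
proof -
  have surj: "\<exists>v w. cochain n L k v \<and> cochain n L (k - 1) w \<and> (\<forall>s. koszul L v s \<in> I)
      \<and> (\<forall>s. u s - (y * v s - koszul L w s) \<in> I)"
    if u: "cochain n L k u" "\<forall>s. homogeneous e (u s)" "\<forall>s. koszul L u s \<in> I" for u e
  proof -
    \<comment> \<open>U is u times the basis vector of y. That it is a cocycle of
      \<open>y # L\<close>, hence a coboundary, is the part of the long exact sequence that writes u
      as y v modulo coboundaries.\<close>
    define U where "U s = (case s of True # s' \<Rightarrow> u s' | _ \<Rightarrow> 0)" for s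
    have U: "U [] = 0" "U (False # s) = 0" "U (True # s) = u s" for s by (auto simp: U_def)
    have "cochain n (y # L) (Suc k) U"
      by (rule cochain_ConsI) (use u(1) in \<open>auto simp: U dest: cochain_0\<close>)
    moreover have "homogeneous e (U s)" for s
      using u(2) by (auto simp: U_def split: list.split bool.split)
    moreover have "koszul (y # L) U s \<in> I" for s
    proof (cases s)
      case Nil then show ?thesis using ideal_0[OF I(1)] by simp
    next
      case (Cons t s')
      then show ?thesis using u(3) ideal_0[OF I(1)] by (cases t) (auto simp: U intro: ideal_uminus[OF I(1)])
    qed
    ultimately obtain W where W: "cochain n (y # L) k W" "\<forall>s. U s - koszul (y # L) W s \<in> I"
      using ex unfolding graded_exact_at_def by fastforce
    have "koszul L (\<lambda>s. W (False # s)) s \<in> I" for s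
      using ideal_uminus[OF I(1) W(2)[rule_format, of "False # s"]] by (simp add: U)
    moreover have "u s - (y * W (False # s) - koszul L (\<lambda>s. W (True # s)) s) \<in> I" for s
      using W(2)[rule_format, of "True # s"] by (simp add: U)
    ultimately show ?thesis using cochain_False[OF W(1)] cochain_True[OF W(1)] by blast
  qed
  show ?thesis
    unfolding graded_exact_at_def
  proof (intro allI impI, elim conjE)
    fix e u
    assume "cochain n L k u" "\<forall>s. homogeneous e (u s)" "\<forall>s. koszul L u s \<in> I"
    then show "\<exists>w. cochain n L (k - 1) w \<and> (\<forall>s. u s - koszul L w s \<in> I)"
    proof (induction e arbitrary: u)
      case (0 u)
      \<comment> \<open>In degree 0 neither y v nor the coboundary has a component, so u itself lies
        in I.\<close>
      obtain v w where "\<forall>s. u s - (y * v s - koszul L w s) \<in> I" using surj[OF 0] by blast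
      then have "hcomp 0 (u s - (y * v s - koszul L w s)) \<in> I" for s using I(2) by blast
      then have "u s \<in> I" for s
        using "0.prems"(2) by (simp add: hcomp_diff hcomp_linear_mult[OF y(1)] koszul_hcomp(2)[OF L(1)] hcomp_homogeneous)
      then show ?case by (intro exI[of _ "\<lambda>s. 0"]) simp
    next
      case (Suc e)
      obtain v w where vw: "cochain n L k v" "cochain n L (k - 1) w" "\<forall>s. koszul L v s \<in> I"
        "\<forall>s. u s - (y * v s - koszul L w s) \<in> I" using surj[OF Suc.prems] by blast
      define v' w' where "v' s = hcomp e (v s)" and "w' s = hcomp e (w s)" for s
      have "hcomp (Suc e) (u s - (y * v s - koszul L w s)) \<in> I" for s using I(2) vw(4) by blast
      then have eq: "u s - (y * v' s - koszul L w' s) \<in> I" for s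
        using Suc.prems(2) unfolding v'_def w'_def koszul_hcomp(1)[OF L(1)]
        by (simp add: hcomp_diff hcomp_linear_mult[OF y(1)] hcomp_homogeneous)
      have "\<forall>s. koszul L v' s \<in> I"
        using I(2) vw(3) unfolding v'_def koszul_hcomp(1)[OF L(1)] by blast
      moreover have "cochain n L k v'" unfolding v'_def by (rule cochain_hcomp[OF vw(1)])
      moreover have "\<forall>s. homogeneous e (v' s)" by (simp add: v'_def)
      ultimately obtain z where z: "cochain n L (k - 1) z" "\<forall>s. v' s - koszul L z s \<in> I"
        using Suc.IH by blast
      \<comment> \<open>By induction v' = dz modulo I, whence y v' - dw' = d(y z - w').\<close>
      have "u s - koszul L (\<lambda>s. y * z s - w' s) s \<in> I" for s
      proof -
        have "(u s - (y * v' s - koszul L w' s)) + y * (v' s - koszul L z s) \<in> I"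
          by (intro ideal_add[OF I(1)] ideal_mult[OF I(1)] eq z(2)[rule_format] y(2))
        then show ?thesis by (simp add: koszul_diff koszul_mult algebra_simps)
      qed
      moreover have "cochain n L (k - 1) (\<lambda>s. y * z s - w' s)"
        unfolding w'_def by (intro cochain_diff cochain_mult cochain_hcomp vw z y)
      ultimately show ?case by blast
    qed
  qed
qed

lemma graded_exact_at_remove_list:
  assumes "is_ideal n I" "\<And>p e. p \<in> I \<Longrightarrow> hcomp e p \<in> I"
    and "\<forall>l\<in>set L. homogeneous 1 l" "set L \<subseteq> polys n"
  shows "\<forall>y\<in>set ys. homogeneous 1 y \<and> y \<in> polys n \<Longrightarrow>
    graded_exact_at n I (ys @ L) (length ys + k) \<Longrightarrow> graded_exact_at n I L k"
proof (induction ys)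
  case (Cons y ys)
  have "graded_exact_at n I (ys @ L) (length ys + k)"
    by (rule graded_exact_at_remove[OF assms(1,2)]) (use Cons.prems assms(3,4) in auto)
  then show ?case using Cons by simp
qed simp

subsection \<open>The first cohomology\<close>

fun one_cochain :: "mpoly list \<Rightarrow> bool list \<Rightarrow> mpoly" where
  "one_cochain [] s = 0"
| "one_cochain (g # gs) [] = 0"
| "one_cochain (g # gs) (False # s) = one_cochain gs s"
| "one_cochain (g # gs) (True # s) = (if s = replicate (length gs) False then g else 0)"

lemma koszul_const:
  "koszul L (\<lambda>s. if s = replicate (length L) False then x else 0) s = one_cochain (map (\<lambda>l. l * x) L) s"
proof (induction L arbitrary: s)
  case (Cons l L)
  show ?case
  proof (cases s)
    case (Cons t s')
    then show ?thesis using Cons.IH[of s'] by (cases t) simp_all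
  qed simp
qed simp

lemma cochain_one_cochain:
  "set gs \<subseteq> polys n \<Longrightarrow> length gs = length L \<Longrightarrow> cochain n L 2 (one_cochain gs)"
proof (induction gs arbitrary: L)
  case (Cons g gs)
  obtain l L' where L: "L = l # L'" using Cons.prems by (cases L) auto
  have "count_list (replicate k False) True = 0" for k by (induction k) auto
  then show ?case unfolding L using Cons L
    by (intro cochain_ConsI) (auto simp: cochain_def)
qed (simp add: cochain_def)

lemma one_cochain_diff_ideal:
  assumes "is_ideal n I"
  shows "length gs = length hs \<Longrightarrow> \<forall>i<length gs. r * gs ! i - hs ! i \<in> I
    \<Longrightarrow> r * one_cochain gs s - one_cochain hs s \<in> I"
proof (induction gs arbitrary: hs s)
  case (Cons g gs)
  obtain h hs' where hs: "hs = h # hs'" using Cons.prems by (cases hs) auto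
  show ?case
  proof (cases s)
    case Nil
    then show ?thesis using hs ideal_0[OF assms] by simp
  next
    case (Cons t s')
    have "\<forall>i<length gs. r * gs ! i - hs' ! i \<in> I" "r * g - h \<in> I"
      using Cons.prems(2) hs by force+
    then show ?thesis using Cons.IH[of hs' s'] Cons.prems(1) Cons hs ideal_0[OF assms]
      by (cases t) auto
  qed
qed (use ideal_0[OF assms] in simp)

text \<open>The differential of (g_i) has the coefficients l_i g_j - l_j g_i. Head and tail are
  compared through \<open>koszul_const\<close>: the coboundary of the constant g has exactly the
  entries l_j g.\<close>

lemma koszul_one_cochain:
  assumes I: "is_ideal n I"
  shows "length gs = length L \<Longrightarrow> \<forall>i<length L. \<forall>j<length L. L ! i * gs ! j - L ! j * gs ! i \<in> I
    \<Longrightarrow> koszul L (one_cochain gs) s \<in> I"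
proof (induction gs arbitrary: L s)
  case (Cons g gs)
  obtain l L' where L: "L = l # L'" using Cons.prems by (cases L) auto
  have 1: "\<forall>i<length L'. \<forall>j<length L'. L' ! i * gs ! j - L' ! j * gs ! i \<in> I"
    using Cons.prems(2) unfolding L by force
  have 2: "\<forall>j<length L'. l * gs ! j - L' ! j * g \<in> I"
    using Cons.prems(2) unfolding L by force
  show ?case
  proof (cases s)
    case Nil
    then show ?thesis using L ideal_0[OF I] by simp
  next
    case (Cons t s')
    show ?thesis
    proof (cases t)
      case True
      have len: "length gs = length L'" using Cons.prems(1) L by simp
      have "l * one_cochain gs s' - one_cochain (map (\<lambda>l. l * g) L') s' \<in> I"
        by (rule one_cochain_diff_ideal[OF I]) (use len 2 in auto)
      then show ?thesis using L Cons True len by (simp add: koszul_const[symmetric])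
    next
      case False
      then show ?thesis using L Cons Cons.IH[of L' s'] Cons.prems(1) 1 by simp
    qed
  qed
qed (use ideal_0[OF I] in simp)

lemma one_cochain_nth:
  "i < length gs \<Longrightarrow> one_cochain gs (replicate i False @ True # replicate (length gs - Suc i) False) = gs ! i"
proof (induction gs arbitrary: i)
  case (Cons g gs)
  then show ?case by (cases i) auto
qed simp

text \<open>H^1 = 0 in elementary terms: if the g_i behave modulo I like the numerators of one
  fraction over the denominators l_i, then this fraction is represented by a ring element.\<close>

lemma graded_exact_at_2:
  assumes I: "is_ideal n I" and ex: "graded_exact_at n I L 2"
    and gs: "set gs \<subseteq> polys n" "\<forall>g\<in>set gs. homogeneous e g" "length gs = length L"
    and comp: "\<forall>i<length L. \<forall>j<length L. L ! i * gs ! j - L ! j * gs ! i \<in> I"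
  shows "\<exists>w\<in>polys n. \<forall>i<length L. gs ! i - L ! i * w \<in> I"
proof -
  have "homogeneous e (one_cochain gs s)" for s
    using gs(2) by (induction gs s rule: one_cochain.induct) auto
  then have "\<exists>w. cochain n L (2 - 1) w \<and> (\<forall>s. one_cochain gs s - koszul L w s \<in> I)"
    using ex[unfolded graded_exact_at_def, rule_format, of "one_cochain gs" e]
      cochain_one_cochain[OF gs(1,3)] koszul_one_cochain[OF I gs(3) comp] by blast
  then obtain w where w: "cochain n L 1 w" "\<forall>s. one_cochain gs s - koszul L w s \<in> I" by auto
  define x where "x = w (replicate (length L) False)"
  have rep: "s = replicate (length s) False" if "count_list s True = 0" for s
    using that by (induction s) (auto split: if_splits)
  \<comment> \<open>Shifted degree 1 means that the index contains no \<open>True\<close>, so w is a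
    single polynomial.\<close>
  have "w = (\<lambda>s. if s = replicate (length L) False then x else 0)"
  proof
    fix s show "w s = (if s = replicate (length L) False then x else 0)"
      using w(1) rep[of s] unfolding cochain_def x_def by auto
  qed
  then have eq: "one_cochain gs s - one_cochain (map (\<lambda>l. l * x) L) s \<in> I" for s
    using w(2) koszul_const[of L x] by metis
  have "gs ! i - L ! i * x \<in> I" if "i < length L" for i
    using eq[of "replicate i False @ True # replicate (length L - Suc i) False"]
      one_cochain_nth[of i gs] one_cochain_nth[of i "map (\<lambda>l. l * x) L"] that gs(3) by simp
  moreover have "x \<in> polys n" using w(1) by (simp add: cochain_def x_def)
  ultimately show ?thesis by blast
qed

section \<open>Vanishing ideals of cones\<close>

lemma is_ideal_van_ideal: "is_ideal n (van_ideal n X)"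
  unfolding is_ideal_def van_ideal_def by (auto simp: peval_add peval_mult add_polys mult_polys)

lemma van_ideal_hcomp:
  assumes cone: "\<And>x t. x \<in> X \<Longrightarrow> (\<lambda>i. t * x i) \<in> X" and p: "p \<in> van_ideal n X"
  shows "hcomp e p \<in> van_ideal n X"
proof -
  have "peval (hcomp e p) x = 0" if "x \<in> X" for x
    using peval_hcomp_eq[of p x e 0 e] p cone[OF that] by (simp add: van_ideal_def)
  then show ?thesis using p by (simp add: van_ideal_def hcomp_polys)
qed

lemma ideal_plus_Nil: "ideal_plus n I [] = I"
  by (simp add: ideal_plus_def)

text \<open>A Hartogs property: a long enough regular sequence makes functions on X off F extend
  across F. The variables in \<open>rs\<close> span the linear forms on F, the differences x_i -
  x_(\<rho> i) are its equations, and together they generate the maximal ideal. Removing the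
  variables in \<open>rs\<close> from the Koszul complex costs one degree each and leaves H^1 of the
  equations.\<close>

lemma regular_seq_extension:
  assumes cone: "\<And>x t. x \<in> X \<Longrightarrow> (\<lambda>i. t * x i) \<in> X"
    and reg: "regular_seq n (van_ideal n X) fs"
    and rs: "set rs \<subseteq> {..<n}" "\<And>i. i < n \<Longrightarrow> \<rho> i \<in> set rs" "length rs + 2 \<le> length fs"
    and F: "F = {x. \<forall>i<n. x i = x (\<rho> i)}"
    and hom: "\<And>x t. x \<in> X \<Longrightarrow> t \<noteq> 0 \<Longrightarrow> \<phi> (\<lambda>i. t * x i) = t ^ E * \<phi> x"
    and mult: "\<And>i. i < n \<Longrightarrow> \<exists>g\<in>polys n. \<forall>x\<in>X - F. peval g x = (x i - x (\<rho> i)) * \<phi> x"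
  shows "\<exists>w\<in>polys n. \<forall>x\<in>X - F. peval w x = \<phi> x"
proof -
  let ?I = "van_ideal n X"
  define Y where "Y = map var rs"
  define L where "L = map (\<lambda>i. var i - var (\<rho> i)) [0..<n]"
  note I = is_ideal_van_ideal[of n X]
  have \<rho>: "\<rho> i < n" if "i < n" for i using rs that by blast
  have Y: "\<forall>y\<in>set Y. homogeneous 1 y \<and> y \<in> polys n"
    using rs(1) homogeneous_var unfolding Y_def by auto
  have L: "\<forall>l\<in>set L. homogeneous 1 l" "set L \<subseteq> polys n"
    using \<rho> homogeneous_diff[OF homogeneous_var homogeneous_var]
    by (auto simp: L_def intro!: diff_polys)
  have null_var: "null_homotopic n (Y @ L) (var i)" if "i < n" for i
  proof -
    have "var i - var (\<rho> i) \<in> set (Y @ L)" "var (\<rho> i) \<in> set (Y @ L)"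
      using that rs(2) by (auto simp: Y_def L_def)
    from null_homotopic_linear[OF null_homotopic_mem[OF this(1)] null_homotopic_mem[OF this(2)], of 1]
    show ?thesis by simp
  qed
  have fs: "set fs \<subseteq> max_ideal n" using reg unfolding regular_seq_def by blast
  have null: "null_homotopic n (Y @ L) f" if "f \<in> set fs" for f
    by (rule null_homotopic_max_ideal[OF _ null_var]) (use fs that in blast)
  have YL: "set (Y @ L) \<subseteq> polys n" using Y L(2) by auto
  have "exact_at n (ideal_plus n ?I (take 0 fs)) (Y @ L) (length rs + 2)"
    by (rule exact_at_regular_seq[OF I reg YL null, of 0 "length fs"]) (use rs(3) in simp_all)
  then have "exact_at n ?I (Y @ L) (length rs + 2)"
    by (simp only: take_0 ideal_plus_Nil)
  then have "graded_exact_at n ?I (Y @ L) (length Y + 2)"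
    unfolding exact_at_def graded_exact_at_def Y_def length_map by blast
  then have ex: "graded_exact_at n ?I L 2"
    using graded_exact_at_remove_list[OF I van_ideal_hcomp[OF cone] L Y] by blast
  obtain g where g: "\<And>i. i < n \<Longrightarrow> g i \<in> polys n"
    "\<And>i x. i < n \<Longrightarrow> x \<in> X - F \<Longrightarrow> peval (g i) x = (x i - x (\<rho> i)) * \<phi> x"
    using mult by metis
  \<comment> \<open>Exactness is known for homogeneous cocycles, so only the component of degree E +
    1, the degree of (x_i - x_(\<rho> i)) \<phi>, is kept; the values on X off F do not
    change.\<close>
  define g' where "g' i = hcomp (Suc E) (g i)" for i
  have scale: "(\<lambda>i. t * x i) \<in> X - F" if "x \<in> X - F" "t \<noteq> 0" for x t
    using that cone by (auto simp: F)
  have g': "peval (g' i) x = (x i - x (\<rho> i)) * \<phi> x" if "i < n" "x \<in> X - F" for i x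
  proof -
    have "peval (g i) (\<lambda>i. t * x i) = t ^ Suc E * ((x i - x (\<rho> i)) * \<phi> x)" if "t \<noteq> 0" for t
      using g(2)[OF \<open>i < n\<close> scale[OF \<open>x \<in> X - F\<close> that]] hom[of x t] \<open>x \<in> X - F\<close> that
      by (simp add: algebra_simps)
    then show ?thesis unfolding g'_def by (subst peval_hcomp_eq) auto
  qed
  have comp: "(var i - var (\<rho> i)) * g' j - (var j - var (\<rho> j)) * g' i \<in> ?I" if "i < n" "j < n" for i j
  proof -
    have "peval ((var i - var (\<rho> i)) * g' j - (var j - var (\<rho> j)) * g' i) x = 0" if "x \<in> X" for x
    proof (cases "x \<in> F")
      \<comment> \<open>On F both linear forms vanish, so compatibility holds whatever the values of
        g' are there.\<close>
      case True
      then show ?thesis using \<open>i < n\<close> \<open>j < n\<close> by (simp add: F peval_diff peval_mult)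
    next
      case False
      then show ?thesis using \<open>i < n\<close> \<open>j < n\<close> that by (simp add: peval_diff peval_mult g')
    qed
    then show ?thesis using that g(1) \<rho> unfolding van_ideal_def g'_def
      by (auto intro!: diff_polys mult_polys hcomp_polys)
  qed
  have "\<exists>w\<in>polys n. \<forall>i<length L. map g' [0..<n] ! i - L ! i * w \<in> ?I"
  proof (rule graded_exact_at_2[OF I ex])
    show "set (map g' [0..<n]) \<subseteq> polys n" using g(1) by (auto simp: g'_def intro: hcomp_polys)
    show "\<forall>g\<in>set (map g' [0..<n]). homogeneous (Suc E) g" by (auto simp: g'_def)
  qed (use comp in \<open>auto simp: L_def\<close>)
  then obtain w where w: "w \<in> polys n" "\<And>i. i < n \<Longrightarrow> g' i - (var i - var (\<rho> i)) * w \<in> ?I"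
    by (auto simp: L_def)
  have "peval w x = \<phi> x" if x: "x \<in> X - F" for x
  proof -
    obtain i where i: "i < n" "x i \<noteq> x (\<rho> i)" using x by (auto simp: F)
    have "peval (g' i) x - (x i - x (\<rho> i)) * peval w x = 0"
      using w(2)[OF i(1)] x by (simp add: van_ideal_def peval_diff peval_mult)
    then show ?thesis using g'[OF i(1) x] i(2) by simp
  qed
  then show ?thesis using w(1) by blast
qed

section \<open>The arrangement\<close>

lemma blk_Nil [simp]: "blk [] i = 0"
  by (simp add: blk_def)

lemma blk_Cons: "blk (p # lam) i = (if i < p then 0 else Suc (blk lam (i - p)))"
proof -
  let ?S = "{k. k < length lam \<and> sum_list (take (Suc k) lam) \<le> i - p}"
  have eq: "{k. k < length (p # lam) \<and> sum_list (take (Suc k) (p # lam)) \<le> i}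
      = (if i < p then {} else insert 0 (Suc ` ?S))"
  proof (intro equalityI subsetI)
    fix k assume "k \<in> {k. k < length (p # lam) \<and> sum_list (take (Suc k) (p # lam)) \<le> i}"
    then show "k \<in> (if i < p then {} else insert 0 (Suc ` ?S))"
      by (cases k) auto
  next
    fix k assume "k \<in> (if i < p then {} else insert 0 (Suc ` ?S))"
    then show "k \<in> {k. k < length (p # lam) \<and> sum_list (take (Suc k) (p # lam)) \<le> i}"
      by (auto split: if_splits)
  qed
  have "card (insert 0 (Suc ` ?S)) = Suc (card ?S)"
    by (subst card_insert_disjoint) (auto simp: card_image)
  then show ?thesis unfolding blk_def eq by auto
qed

lemma blk_less: "i < sum_list lam \<Longrightarrow> blk lam i < length lam"
  by (induction lam arbitrary: i) (auto simp: blk_Cons)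

lemma card_blk: "k < length lam \<Longrightarrow> card {i. i < sum_list lam \<and> blk lam i = k} = lam ! k"
proof (induction lam arbitrary: k)
  case (Cons p lam)
  show ?case
  proof (cases k)
    case 0
    have "{i. i < sum_list (p # lam) \<and> blk (p # lam) i = 0} = {..<p}"
      by (auto simp: blk_Cons)
    then show ?thesis using 0 by simp
  next
    case (Suc k')
    have "{i. i < sum_list (p # lam) \<and> blk (p # lam) i = k} = (+) p ` {i. i < sum_list lam \<and> blk lam i = k'}"
    proof (intro equalityI subsetI)
      fix i assume "i \<in> {i. i < sum_list (p # lam) \<and> blk (p # lam) i = k}"
      then show "i \<in> (+) p ` {i. i < sum_list lam \<and> blk lam i = k'}"
        using Suc by (intro image_eqI[of _ _ "i - p"]) (auto simp: blk_Cons split: if_splits)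
    qed (auto simp: blk_Cons Suc)
    then have "card {i. i < sum_list (p # lam) \<and> blk (p # lam) i = k} = card {i. i < sum_list lam \<and> blk lam i = k'}"
      by (simp add: card_image)
    then show ?thesis using Cons Suc by simp
  qed
qed simp

text \<open>Permutations are traded for labellings: two labellings with equal fibre sizes have the
  same multiset of labels and so differ by a permutation. Points of the arrangement can then be
  given by their blocks.\<close>

lemma X_arr_iff:
  "x \<in> X_arr lam \<longleftrightarrow> x \<in> cn (sum_list lam) \<and>
    (\<exists>w. (\<forall>i<sum_list lam. w i < length lam) \<and>
         (\<forall>k<length lam. card {i. i < sum_list lam \<and> w i = k} = lam ! k) \<and>
         (\<forall>i<sum_list lam. \<forall>j<sum_list lam. w i = w j \<longrightarrow> x i = x j))" (is "?l \<longleftrightarrow> ?r")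
proof
  let ?n = "sum_list lam"
  assume ?l
  then obtain \<sigma> y where \<sigma>: "\<sigma> permutes {..<?n}" and y: "y \<in> E_sub lam" and x: "x = y \<circ> \<sigma>"
    unfolding X_arr_def by blast
  have less: "\<sigma> i < ?n \<longleftrightarrow> i < ?n" for i using permutes_in_image[OF \<sigma>, of i] by simp
  have "x i = 0" if "\<not> i < ?n" for i
    using y less[of i] that unfolding x E_sub_def cn_def by simp
  then have "x \<in> cn ?n" by (simp add: cn_def)
  moreover have "card {i. i < ?n \<and> blk lam (\<sigma> i) = k} = lam ! k" if "k < length lam" for k
  proof -
    have "\<sigma> ` {i. i < ?n \<and> blk lam (\<sigma> i) = k} = {i. i < ?n \<and> blk lam i = k}"
    proof (intro equalityI subsetI)
      fix j assume "j \<in> {i. i < ?n \<and> blk lam i = k}"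
      then show "j \<in> \<sigma> ` {i. i < ?n \<and> blk lam (\<sigma> i) = k}"
        using less[of "inv \<sigma> j"] permutes_inverses(1)[OF \<sigma>, of j]
        by (intro image_eqI[of _ _ "inv \<sigma> j"]) auto
    qed (auto simp: less)
    then show ?thesis
      using card_blk[OF that] card_image[OF permutes_inj_on[OF \<sigma>, of "{i. i < ?n \<and> blk lam (\<sigma> i) = k}"]] by simp
  qed
  moreover have "\<forall>i<?n. \<forall>j<?n. blk lam (\<sigma> i) = blk lam (\<sigma> j) \<longrightarrow> x i = x j"
    using y less unfolding x E_sub_def comp_def by blast
  moreover have "\<forall>i<?n. blk lam (\<sigma> i) < length lam"
    using blk_less less by blast
  ultimately show ?r by (intro conjI exI[of _ "\<lambda>i. blk lam (\<sigma> i)"] allI impI) blast+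
next
  let ?n = "sum_list lam"
  assume ?r
  then obtain w where xc: "x \<in> cn ?n" and w: "\<forall>i<?n. w i < length lam"
    "\<forall>k<length lam. card {i. i < ?n \<and> w i = k} = lam ! k"
    "\<forall>i<?n. \<forall>j<?n. w i = w j \<longrightarrow> x i = x j" by blast
  have cnt: "count (image_mset f (mset_set {..<?n})) k = card {i. i < ?n \<and> f i = k}" for f :: "nat \<Rightarrow> nat" and k
    by (auto simp: count_image_mset' intro!: arg_cong[of _ _ card])
  have "image_mset w (mset_set {..<?n}) = image_mset (blk lam) (mset_set {..<?n})"
  proof (rule multiset_eqI)
    fix k
    show "count (image_mset w (mset_set {..<?n})) k = count (image_mset (blk lam) (mset_set {..<?n})) k"
    proof (cases "k < length lam")
      case True
      then show ?thesis unfolding cnt using w(2) card_blk by simp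
    next
      case False
      then have "{i. i < ?n \<and> w i = k} = {}" "{i. i < ?n \<and> blk lam i = k} = {}"
        using w(1) blk_less by auto
      then show ?thesis unfolding cnt by (simp only:)
    qed
  qed
  then obtain \<sigma> where \<sigma>: "\<sigma> permutes {..<?n}" "\<forall>i\<in>{..<?n}. w i = blk lam (\<sigma> i)"
    using image_mset_eq_implies_permutes[of "{..<?n}" w "blk lam"] by auto
  have inv: "inv \<sigma> permutes {..<?n}" by (rule permutes_inv[OF \<sigma>(1)])
  have less: "inv \<sigma> i < ?n \<longleftrightarrow> i < ?n" for i using permutes_in_image[OF inv, of i] by simp
  have "x \<circ> inv \<sigma> \<in> E_sub lam"
    unfolding E_sub_def
  proof (intro CollectI conjI allI impI)
    have "(x \<circ> inv \<sigma>) i = 0" if "\<not> i < ?n" for i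
      using xc less[of i] that unfolding cn_def by simp
    then show "x \<circ> inv \<sigma> \<in> cn ?n" by (simp add: cn_def)
  next
    fix i j assume "i < ?n" "j < ?n" "blk lam i = blk lam j"
    then have "w (inv \<sigma> i) = w (inv \<sigma> j)"
      using \<sigma>(2) less permutes_inverses(1)[OF \<sigma>(1)] by simp
    then show "(x \<circ> inv \<sigma>) i = (x \<circ> inv \<sigma>) j"
      using w(3) less \<open>i < ?n\<close> \<open>j < ?n\<close> unfolding comp_def by blast
  qed
  moreover have "x = (x \<circ> inv \<sigma>) \<circ> \<sigma>" using permutes_inverses(2)[OF \<sigma>(1)] by auto
  ultimately show ?l unfolding X_arr_def using \<sigma>(1) by blast
qed

lemma X_arr_cone: "x \<in> X_arr lam \<Longrightarrow> (\<lambda>i. t * x i) \<in> X_arr lam"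
  unfolding X_arr_iff cn_def
  by (elim conjE exE, intro conjI, simp, rule exI, intro conjI, assumption, assumption) metis

lemma E_sub_X_arr: "E_sub lam \<subseteq> X_arr lam"
  unfolding X_arr_def by (auto intro!: bexI[of _ id] permutes_id)

subsection \<open>Krull dimension\<close>

text \<open>If a(u) and b(v) are nonzero, restrict to the line through u and v: there a b is a
  product of two nonzero univariate polynomials and cannot vanish identically.\<close>

lemma is_prime_ideal_van_ideal:
  assumes line: "\<And>u v t. u \<in> V \<Longrightarrow> v \<in> V \<Longrightarrow> (\<lambda>i. u i + t * (v i - u i)) \<in> V" and "V \<noteq> {}"
  shows "is_prime_ideal n (van_ideal n V)"
  unfolding is_prime_ideal_def
proof (intro conjI ballI impI)
  show "is_ideal n (van_ideal n V)" by (rule is_ideal_van_ideal)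
  have "1 \<notin> van_ideal n V" using assms(2) by (auto simp: van_ideal_def)
  then show "van_ideal n V \<noteq> polys n" by force
  fix a b assume ab: "a \<in> polys n" "b \<in> polys n" "a * b \<in> van_ideal n V"
  show "a \<in> van_ideal n V \<or> b \<in> van_ideal n V"
  proof (rule ccontr)
    assume "\<not> ?thesis"
    then obtain u v where uv: "u \<in> V" "peval a u \<noteq> 0" "v \<in> V" "peval b v \<noteq> 0"
      using ab by (auto simp: van_ideal_def)
    obtain r where r: "\<And>t. poly r t = peval a (\<lambda>i. u i + t * (v i - u i))"
      using peval_on_line[of a u "\<lambda>i. v i - u i"] by blast
    obtain q where q: "\<And>t. poly q t = peval b (\<lambda>i. u i + t * (v i - u i))"
      using peval_on_line[of b u "\<lambda>i. v i - u i"] by blast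
    have "poly (r * q) = poly 0"
      using ab(3) line[OF uv(1,3)] by (auto simp: van_ideal_def peval_mult r q)
    then have "r * q = 0" by (simp only: poly_eq_poly_eq_iff)
    moreover have "r \<noteq> 0" using r[of 0] uv(2) by auto
    moreover have "q \<noteq> 0" using q[of 1] uv(4) by auto
    ultimately show False by simp
  qed
qed

text \<open>The chain comes from the flats obtained from \<open>E_sub\<close> by setting its blocks
  to zero one after another; a coordinate of block i separates step i from step i + 1.\<close>

lemma krull_dim_X_arr:
  assumes pos: "\<forall>p\<in>set lam. 0 < p"
  shows "enat (length lam) \<le> krull_dim (sum_list lam) (van_ideal (sum_list lam) (X_arr lam))"
proof -
  let ?n = "sum_list lam"
  define V where "V i = {x \<in> E_sub lam. \<forall>j<?n. blk lam j < i \<longrightarrow> x j = 0}" for i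
  define P where "P i = van_ideal ?n (V i)" for i
  have "is_prime_ideal ?n (P i)" for i
    unfolding P_def
  proof (rule is_prime_ideal_van_ideal)
    show "(\<lambda>k. u k + t * (v k - u k)) \<in> V i" if "u \<in> V i" "v \<in> V i" for u v t
    proof -
      let ?x = "\<lambda>k. u k + t * (v k - u k)"
      have "\<forall>j\<ge>?n. u j = 0 \<and> v j = 0" "\<forall>j<?n. blk lam j < i \<longrightarrow> u j = 0 \<and> v j = 0"
        using that unfolding V_def E_sub_def cn_def by blast+
      then have "?x \<in> cn ?n" "\<forall>j<?n. blk lam j < i \<longrightarrow> ?x j = 0"
        unfolding cn_def by simp_all
      moreover have "?x k = ?x l" if "k < ?n" "l < ?n" "blk lam k = blk lam l" for k l
      proof -
        have "u k = u l" "v k = v l"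
          using that \<open>u \<in> V i\<close> \<open>v \<in> V i\<close> unfolding V_def E_sub_def by blast+
        then show ?thesis by simp
      qed
      ultimately show ?thesis unfolding V_def E_sub_def by blast
    qed
    have "(\<lambda>k. 0) \<in> V i" by (auto simp: V_def E_sub_def cn_def)
    then show "V i \<noteq> {}" by blast
  qed
  moreover have "van_ideal ?n (X_arr lam) \<subseteq> P i" for i
    using E_sub_X_arr unfolding P_def van_ideal_def V_def by blast
  moreover have "P i \<subset> P (Suc i)" if i: "i < length lam" for i
  proof -
    have "{j. j < ?n \<and> blk lam j = i} \<noteq> {}"
      using card_blk[OF i] pos i nth_mem[OF i] by (metis card.empty less_not_refl)
    then obtain j where j: "j < ?n" "blk lam j = i" by blast
    define x :: "nat \<Rightarrow> complex" where "x = (\<lambda>k. if k < ?n \<and> i \<le> blk lam k then 1 else 0)"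
    have "x \<in> V i" by (auto simp: V_def E_sub_def cn_def x_def)
    moreover have "x j = 1" using j by (simp add: x_def)
    ultimately have "var j \<notin> P i" unfolding P_def van_ideal_def by force
    moreover have "var j \<in> P (Suc i)" using j by (auto simp: P_def van_ideal_def V_def)
    moreover have "P i \<subseteq> P (Suc i)" by (auto simp: P_def van_ideal_def V_def)
    ultimately show ?thesis by blast
  qed
  ultimately show ?thesis
    unfolding krull_dim_def by (intro Sup_upper CollectI exI[of _ "length lam"] conjI exI[of _ P]) auto
qed

section \<open>A non-extendable function on the basic arrangement\<close>

definition plane :: "nat \<Rightarrow> nat \<Rightarrow> nat set \<Rightarrow> nat set \<Rightarrow> nat set \<Rightarrow> bool" where
  "plane b c A B C \<longleftrightarrow> A \<union> B \<union> C = {..<2 * (b + c)} \<and> A \<inter> B = {} \<and> A \<inter> C = {} \<and> B \<inter> C = {} \<and>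
     card A = b + c \<and> card B = b \<and> card C = c"

definition on_plane :: "(nat \<Rightarrow> complex) \<Rightarrow> nat set \<Rightarrow> nat set \<Rightarrow> nat set \<Rightarrow> complex \<Rightarrow> complex \<Rightarrow> complex \<Rightarrow> bool" where
  "on_plane x A B C X Y Z \<longleftrightarrow> (\<forall>i\<in>A. x i = X) \<and> (\<forall>i\<in>B. x i = Y) \<and> (\<forall>i\<in>C. x i = Z)"

text \<open>The marked coordinates are \<open>0\<close> and \<open>1\<close>.\<close>

definition plane_val :: "nat \<Rightarrow> nat \<Rightarrow> nat set \<Rightarrow> nat set \<Rightarrow> nat set \<Rightarrow> complex \<Rightarrow> complex \<Rightarrow> complex \<Rightarrow> complex" where
  "plane_val b c A B C X Y Z =
    (let \<alpha> = (\<lambda>i. if i \<in> A then 1 else 0);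
         \<beta> = (\<lambda>i. if i \<in> C then of_nat b * (X - Y) else if i \<in> B then - of_nat c * (X - Z) else 0)
     in (X - Y) * (X - Z) * (Y - Z) * (\<alpha> (0::nat) * \<beta> 1 - \<alpha> 1 * \<beta> 0))"

text \<open>With X, Y, Z distinct the point determines its plane. At coincidences several planes may
  meet, but the factor (X - Y)(X - Z)(Y - Z) makes all their values 0, which is the default.\<close>

definition plane_fun :: "nat \<Rightarrow> nat \<Rightarrow> (nat \<Rightarrow> complex) \<Rightarrow> complex" where
  "plane_fun b c x =
    (if \<exists>A B C X Y Z. plane b c A B C \<and> on_plane x A B C X Y Z \<and> X \<noteq> Y \<and> X \<noteq> Z \<and> Y \<noteq> Z
     then THE v. \<exists>A B C X Y Z. plane b c A B C \<and> on_plane x A B C X Y Z \<and> X \<noteq> Y \<and> X \<noteq> Z \<and> Y \<noteq> Z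
       \<and> v = plane_val b c A B C X Y Z
     else 0)"

lemma plane_finite: "plane b c A B C \<Longrightarrow> finite A \<and> finite B \<and> finite C"
  unfolding plane_def by (metis finite_Un finite_lessThan)

lemma plane_subset: "plane b c A B C \<Longrightarrow> A \<subseteq> {..<2 * (b + c)} \<and> B \<subseteq> {..<2 * (b + c)} \<and> C \<subseteq> {..<2 * (b + c)}"
  unfolding plane_def by blast

lemma plane_nonempty: "plane b c A B C \<Longrightarrow> 0 < b \<Longrightarrow> 0 < c \<Longrightarrow> A \<noteq> {} \<and> B \<noteq> {} \<and> C \<noteq> {}"
  unfolding plane_def by auto

lemma plane_swap: "plane b c A B C \<Longrightarrow> plane c b A C B"
  unfolding plane_def by (auto simp: add.commute)

lemma on_plane_swap: "on_plane x A B C X Y Z \<Longrightarrow> on_plane x A C B X Z Y"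
  unfolding on_plane_def by auto

text \<open>Two sign changes cancel, one from Y - Z and one from the weights \<beta>; thus a
  statement with B fixed follows from the one with C fixed.\<close>

lemma plane_val_swap: "B \<inter> C = {} \<Longrightarrow> plane_val c b A C B X Z Y = plane_val b c A B C X Y Z"
  unfolding plane_val_def Let_def by (auto simp: algebra_simps)

lemma plane_val_scale: "plane_val b c A B C (t * X) (t * Y) (t * Z) = t ^ 4 * plane_val b c A B C X Y Z"
  unfolding plane_val_def Let_def by (simp add: algebra_simps power4_eq_xxxx)

lemma plane_level_sets:
  assumes "plane b c A B C" "on_plane x A B C X Y Z" "X \<noteq> Y" "X \<noteq> Z" "Y \<noteq> Z"
  shows "A = {i. i < 2 * (b + c) \<and> x i = X}" "B = {i. i < 2 * (b + c) \<and> x i = Y}"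
    "C = {i. i < 2 * (b + c) \<and> x i = Z}"
proof -
  have "A \<union> B \<union> C = {..<2 * (b + c)}" using assms(1) by (simp add: plane_def)
  then have "i < 2 * (b + c) \<longleftrightarrow> i \<in> A \<or> i \<in> B \<or> i \<in> C" for i by blast
  then show "A = {i. i < 2 * (b + c) \<and> x i = X}" "B = {i. i < 2 * (b + c) \<and> x i = Y}"
    "C = {i. i < 2 * (b + c) \<and> x i = Z}"
    using assms(2-5) unfolding on_plane_def by auto
qed

text \<open>The sizes b + c, b, c are pairwise distinct, so the level sets of x reveal which value
  belongs to which block.\<close>

lemma plane_unique:
  assumes "plane b c A B C" "on_plane x A B C X Y Z" "X \<noteq> Y" "X \<noteq> Z" "Y \<noteq> Z"
    and "plane b c A' B' C'" "on_plane x A' B' C' X' Y' Z'" "X' \<noteq> Y'" "X' \<noteq> Z'" "Y' \<noteq> Z'"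
    and bc: "b \<noteq> c" "0 < b" "0 < c"
  shows "A' = A \<and> B' = B \<and> C' = C \<and> X' = X \<and> Y' = Y \<and> Z' = Z"
proof -
  define L where "L v = card {i. i < 2 * (b + c) \<and> x i = v}" for v
  note l = plane_level_sets[OF assms(1-5)] and l' = plane_level_sets[OF assms(6-10)]
  have L: "L X = b + c" "L Y = b" "L Z = c"
    using assms(1) unfolding L_def l[symmetric] plane_def by blast+
  have L': "L X' = b + c" "L Y' = b" "L Z' = c"
    using assms(6) unfolding L_def l'[symmetric] plane_def by blast+
  have other: "v \<in> {X, Y, Z}" if "L v \<noteq> 0" for v
  proof -
    have "{i. i < 2 * (b + c) \<and> x i = v} \<noteq> {}" using that unfolding L_def by (metis card.empty)
    then obtain i where "i < 2 * (b + c)" "x i = v" by blast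
    moreover from this have "i \<in> A \<union> B \<union> C" using assms(1) by (auto simp: plane_def)
    ultimately show ?thesis using assms(2) by (auto simp: on_plane_def)
  qed
  have "X' = X" "Y' = Y" "Z' = Z"
    using other[of X'] other[of Y'] other[of Z'] L L' bc by auto
  then show ?thesis using l l' by simp
qed

lemma plane_fun_eq:
  assumes pl: "plane b c A B C" "on_plane x A B C X Y Z" and bc: "b \<noteq> c" "0 < b" "0 < c"
  shows "plane_fun b c x = plane_val b c A B C X Y Z"
proof (cases "X \<noteq> Y \<and> X \<noteq> Z \<and> Y \<noteq> Z")
  case True
  then have ex: "\<exists>A B C X Y Z. plane b c A B C \<and> on_plane x A B C X Y Z \<and> X \<noteq> Y \<and> X \<noteq> Z \<and> Y \<noteq> Z"
    using pl by blast
  show ?thesis unfolding plane_fun_def if_P[OF ex]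
  proof (rule the_equality)
    show "\<exists>A' B' C' X' Y' Z'. plane b c A' B' C' \<and> on_plane x A' B' C' X' Y' Z' \<and> X' \<noteq> Y' \<and> X' \<noteq> Z' \<and> Y' \<noteq> Z'
       \<and> plane_val b c A B C X Y Z = plane_val b c A' B' C' X' Y' Z'"
      using True pl by blast
    show "v = plane_val b c A B C X Y Z"
      if "\<exists>A B C X Y Z. plane b c A B C \<and> on_plane x A B C X Y Z \<and> X \<noteq> Y \<and> X \<noteq> Z \<and> Y \<noteq> Z
        \<and> v = plane_val b c A B C X Y Z" for v
      using that plane_unique[OF pl _ _ _ _ _ _ _ _ bc] True by blast
  qed
next
  case False
  have "\<not> (\<exists>A B C X Y Z. plane b c A B C \<and> on_plane x A B C X Y Z \<and> X \<noteq> Y \<and> X \<noteq> Z \<and> Y \<noteq> Z)"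
  proof (intro notI, elim exE conjE)
    fix A' B' C' X' Y' Z'
    assume *: "plane b c A' B' C'" "on_plane x A' B' C' X' Y' Z'" "X' \<noteq> Y'" "X' \<noteq> Z'" "Y' \<noteq> Z'"
    have img: "x i \<in> {X, Y, Z}" if "i < 2 * (b + c)" for i
    proof -
      have "i \<in> A \<union> B \<union> C" using pl(1) that by (auto simp: plane_def)
      then show ?thesis using pl(2) by (auto simp: on_plane_def)
    qed
    obtain i j k where "i \<in> A'" "j \<in> B'" "k \<in> C'" using plane_nonempty[OF *(1) bc(2,3)] by blast
    then have "X' \<in> {X, Y, Z}" "Y' \<in> {X, Y, Z}" "Z' \<in> {X, Y, Z}"
      using *(2) plane_subset[OF *(1)] img unfolding on_plane_def by (metis lessThan_iff subsetD)+
    then show False using *(3-5) False by auto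
  qed
  then have "plane_fun b c x = 0" unfolding plane_fun_def by (simp only: if_False)
  then show ?thesis using False by (auto simp: plane_val_def)
qed

lemma plane_sums:
  assumes "plane b c A B C" "on_plane x A B C X Y Z"
  shows "(\<Sum>i\<in>A. x i ^ k) = of_nat (b + c) * X ^ k" "(\<Sum>i\<in>B. x i ^ k) = of_nat b * Y ^ k"
    "(\<Sum>i\<in>C. x i ^ k) = of_nat c * Z ^ k"
proof -
  have "(\<Sum>i\<in>A. x i ^ k) = (\<Sum>i\<in>A. X ^ k)" "(\<Sum>i\<in>B. x i ^ k) = (\<Sum>i\<in>B. Y ^ k)" "(\<Sum>i\<in>C. x i ^ k) = (\<Sum>i\<in>C. Z ^ k)"
    using assms(2) unfolding on_plane_def by (auto intro!: sum.cong)
  then show "(\<Sum>i\<in>A. x i ^ k) = of_nat (b + c) * X ^ k" "(\<Sum>i\<in>B. x i ^ k) = of_nat b * Y ^ k"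
    "(\<Sum>i\<in>C. x i ^ k) = of_nat c * Z ^ k"
    using assms(1) unfolding plane_def by simp_all
qed

subsection \<open>Polynomial extensions off the codimension-one strata\<close>

text \<open>With C fixed, A \<union> B is fixed too. Hence its power sums s and v, an entry of C for
  Z and the marked coordinates are available, and X, Y and the membership of a mark in A have to be
  expressed through them. The cases are the positions of the marks relative to C.\<close>

lemma extension_fixed_C:
  assumes bc: "b \<noteq> c" "0 < b" "0 < c" and n: "2 * (b + c) \<le> n"
    and S: "S \<subseteq> {..<2 * (b + c)}" "card S = c"
  shows "\<exists>p. polyfun n p \<and> (\<forall>A B x X Y Z. plane b c A B S \<and> on_plane x A B S X Y Z \<longrightarrow> p x = plane_val b c A B S X Y Z)"
proof -
  define \<beta> \<gamma> :: complex where "\<beta> = of_nat b" and "\<gamma> = of_nat c"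
  have nz: "\<beta> \<noteq> 0" "\<gamma> \<noteq> 0" "\<beta> + \<gamma> \<noteq> 0" "\<beta> + \<beta> + \<gamma> \<noteq> 0"
    using bc by (auto simp: \<beta>_def \<gamma>_def simp flip: of_nat_add)
  define M where "M = {..<2 * (b + c)} - S"
  define s v :: "(nat \<Rightarrow> complex) \<Rightarrow> complex" where "s x = (\<Sum>i\<in>M. x i)" and "v x = (\<Sum>i\<in>M. x i ^ 2)" for x
  obtain j where j: "j \<in> S" using S(2) bc(3) by fastforce
  have jn: "j < n" using j S(1) n by auto
  have pf: "polyfun n s" "polyfun n v" "polyfun n (\<lambda>x. x j)" "polyfun n (\<lambda>x. x 0)" "polyfun n (\<lambda>x. x 1)"
    using n bc jn unfolding s_def[abs_def] v_def[abs_def] M_def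
    by (auto intro!: polyfun_sum polyfun_power polyfun_coord)
  have facts: "s x = (\<beta> + \<gamma>) * X + \<beta> * Y" "v x = (\<beta> + \<gamma>) * X\<^sup>2 + \<beta> * Y\<^sup>2" "x j = Z"
    if pl: "plane b c A B S" "on_plane x A B S X Y Z" for A B x X Y Z
  proof -
    have M: "M = A \<union> B" "A \<inter> B = {}" using pl(1) unfolding plane_def M_def by auto
    have fin: "finite A" "finite B" using plane_finite[OF pl(1)] by auto
    show "s x = (\<beta> + \<gamma>) * X + \<beta> * Y"
      using plane_sums(1,2)[OF pl, of 1] fin M unfolding s_def by (simp add: sum.union_disjoint \<beta>_def \<gamma>_def)
    show "v x = (\<beta> + \<gamma>) * X\<^sup>2 + \<beta> * Y\<^sup>2"
      using plane_sums(1,2)[OF pl, of 2] fin M unfolding v_def by (simp add: sum.union_disjoint \<beta>_def \<gamma>_def)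
    show "x j = Z" using pl(2) j by (auto simp: on_plane_def)
  qed
  have ge2: "0 \<in> {..<2 * (b + c)}" "1 \<in> {..<2 * (b + c)}" using bc by auto
  \<comment> \<open>The quotient by \<open>\<beta>^2 - (\<beta> + \<gamma>)^2\<close> is \<open>(X - Y)^2\<close> if \<open>k \<in> A\<close> and \<open>0\<close> if \<open>k \<in> B\<close>.\<close>
  define P where "P k x = \<beta> * ((((s x - (\<beta> + \<gamma> + \<beta>) * x k)\<^sup>2
      - (\<beta> + \<gamma>)\<^sup>2 * (((\<beta> + \<gamma> + \<beta>) * v x - (s x)\<^sup>2) / ((\<beta> + \<gamma>) * \<beta>))) / (\<beta>\<^sup>2 - (\<beta> + \<gamma>)\<^sup>2))
      * (x k - x j) * ((s x - (\<beta> + \<gamma>) * x k) / \<beta> - x j))" for k :: nat and x :: "nat \<Rightarrow> complex"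
  have dsq: "\<beta>\<^sup>2 - (\<beta> + \<gamma>)\<^sup>2 \<noteq> 0"
  proof -
    have "\<beta>\<^sup>2 - (\<beta> + \<gamma>)\<^sup>2 = - \<gamma> * (\<beta> + \<beta> + \<gamma>)" by (simp add: power2_eq_square algebra_simps)
    then show ?thesis using nz by simp
  qed
  have P: "P k x = (if k \<in> A then \<beta> * (X - Y)\<^sup>2 * (X - Z) * (Y - Z) else 0)"
    if pl: "plane b c A B S" "on_plane x A B S X Y Z" and k: "k \<in> A \<union> B" for k A B x X Y Z
  proof -
    \<comment> \<open>A variance: for two values of multiplicities \<beta> + \<gamma> and \<beta> it
      is proportional to (X - Y)^2.\<close>
    have D: "((\<beta> + \<gamma> + \<beta>) * v x - (s x)\<^sup>2) / ((\<beta> + \<gamma>) * \<beta>) = (X - Y)\<^sup>2"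
    proof -
      have "(\<beta> + \<gamma>) * \<beta> \<noteq> 0" using nz by simp
      note eq = nonzero_divide_eq_eq[OF this]
      show ?thesis unfolding facts[OF pl] eq by (simp add: power2_eq_square algebra_simps)
    qed
    show ?thesis
    proof (cases "k \<in> A")
      case True
      then have xk: "x k = X" using pl(2) by (simp add: on_plane_def)
      have e: "s x - (\<beta> + \<gamma> + \<beta>) * x k = \<beta> * (Y - X)" unfolding facts[OF pl] xk by (simp add: algebra_simps)
      have y: "(s x - (\<beta> + \<gamma>) * x k) / \<beta> = Y" unfolding facts[OF pl] xk using nz by (simp add: field_simps)
      have E: "((\<beta> * (Y - X))\<^sup>2 - (\<beta> + \<gamma>)\<^sup>2 * (X - Y)\<^sup>2) / (\<beta>\<^sup>2 - (\<beta> + \<gamma>)\<^sup>2) = (X - Y)\<^sup>2"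
        unfolding nonzero_divide_eq_eq[OF dsq] by (simp add: power2_eq_square algebra_simps)
      show ?thesis unfolding P_def D e y E unfolding xk facts(3)[OF pl] using True by simp
    next
      case False
      then have xk: "x k = Y" using pl(2) k by (simp add: on_plane_def)
      have e: "s x - (\<beta> + \<gamma> + \<beta>) * x k = (\<beta> + \<gamma>) * (X - Y)" unfolding facts[OF pl] xk by (simp add: algebra_simps)
      show ?thesis unfolding P_def D e using False by (simp add: power_mult_distrib)
    qed
  qed
  have pfP: "polyfun n (P 0)" "polyfun n (P 1)"
    unfolding P_def[abs_def] by (intro polyfun_mult polyfun_divide polyfun_diff polyfun_power polyfun_const pf)+
  have Pval: "P k x = (if k \<in> A then of_nat b * (X - Y)\<^sup>2 * (X - Z) * (Y - Z) else 0)"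
    if "plane b c A B S" "on_plane x A B S X Y Z" "k \<in> A \<union> B" for k A B x X Y Z
    using P[OF that] by (simp add: \<beta>_def)
  have AB: "k \<in> A \<union> B" if "plane b c A B S" "k \<notin> S" "k \<in> {..<2 * (b + c)}" for k A B
    using that unfolding plane_def by blast
  have dis: "A \<inter> S = {}" "B \<inter> S = {}" "A \<inter> B = {}" if "plane b c A B S" for A B
    using that unfolding plane_def by auto
  consider (none) "0 \<notin> S" "1 \<notin> S" | (fst) "0 \<in> S" "1 \<notin> S" | (snd) "0 \<notin> S" "1 \<in> S" | (both) "0 \<in> S" "1 \<in> S"
    by blast
  then show ?thesis
  proof cases
    case none
    \<comment> \<open>If the marks lie one in A and one in B, then x 0 + x 1 = X + Y, and
      subtracting \<beta> (X + Y) from s leaves \<gamma> X. If they share a block, the factor x 0 -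
      x 1 of \<open>p\<close> gives 0.\<close>
    define X' where "X' x = (s x - \<beta> * (x 0 + x 1)) / \<gamma>" for x
    define p where "p x = (x 0 - x 1) * (- \<gamma>) * (X' x - x j)\<^sup>2 * ((x 0 + x 1 - X' x) - x j)" for x
    have "polyfun n p" unfolding p_def[abs_def] X'_def
      by (intro polyfun_mult polyfun_divide polyfun_diff polyfun_add polyfun_power polyfun_const pf)
    moreover have "p x = plane_val b c A B S X Y Z"
      if pl: "plane b c A B S" "on_plane x A B S X Y Z" for A B x X Y Z
    proof -
      have m: "0 \<in> A \<union> B" "1 \<in> A \<union> B" using AB[OF pl(1)] none ge2 by blast+
      have val: "x k = (if k \<in> A then X else Y)" if "k \<in> A \<union> B" for k
        using that pl(2) dis[OF pl(1)] by (auto simp: on_plane_def)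
      show ?thesis
      proof (cases "0 \<in> A \<longleftrightarrow> 1 \<in> A")
        case True
        then have "x 0 = x 1" using val[OF m(1)] val[OF m(2)] by simp
        then show ?thesis using True m none dis[OF pl(1)] by (auto simp: p_def plane_val_def)
      next
        case False
        then have xx: "x 0 + x 1 = X + Y" using val[OF m(1)] val[OF m(2)] by (auto split: if_splits)
        have X': "X' x = X" unfolding X'_def xx facts[OF pl] using nz by (simp add: field_simps)
        show ?thesis
        proof (cases "0 \<in> A")
          case True
          then have "1 \<notin> A" "1 \<in> B" using False m by auto
          then show ?thesis using True val[OF m(1)] val[OF m(2)] none
            unfolding p_def X' facts(3)[OF pl] plane_val_def Let_def
            by (simp add: \<gamma>_def power2_eq_square algebra_simps)
        next
          case F: False
          then have "1 \<in> A" "0 \<in> B" using False m by auto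
          then show ?thesis using F val[OF m(1)] val[OF m(2)] none
            unfolding p_def X' facts(3)[OF pl] plane_val_def Let_def
            by (simp add: \<gamma>_def power2_eq_square algebra_simps)
        qed
      qed
    qed
    ultimately show ?thesis by blast
  next
    case fst
    have "- P 1 x = plane_val b c A B S X Y Z"
      if pl: "plane b c A B S" "on_plane x A B S X Y Z" for A B x X Y Z
      unfolding Pval[OF pl AB[OF pl(1) fst(2) ge2(2)]]
      using fst dis[OF pl(1)] by (auto simp: plane_val_def power2_eq_square)
    then show ?thesis using polyfun_uminus[OF pfP(2)] by (intro exI[of _ "\<lambda>x. - P 1 x"]) blast
  next
    case snd
    have "P 0 x = plane_val b c A B S X Y Z"
      if pl: "plane b c A B S" "on_plane x A B S X Y Z" for A B x X Y Z
      unfolding Pval[OF pl AB[OF pl(1) snd(1) ge2(1)]]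
      using snd dis[OF pl(1)] by (auto simp: plane_val_def power2_eq_square)
    then show ?thesis using pfP(1) by blast
  next
    case both
    then have "0 = plane_val b c A B S X Y Z" if "plane b c A B S" for A B X Y Z
      using dis[OF that] by (auto simp: plane_val_def)
    then show ?thesis using polyfun_const[of n 0] by blast
  qed
qed

lemma extension_fixed_B:
  assumes bc: "b \<noteq> c" "0 < b" "0 < c" and n: "2 * (b + c) \<le> n"
    and S: "S \<subseteq> {..<2 * (b + c)}" "card S = b"
  shows "\<exists>p. polyfun n p \<and> (\<forall>A C x X Y Z. plane b c A S C \<and> on_plane x A S C X Y Z \<longrightarrow> p x = plane_val b c A S C X Y Z)"
proof -
  obtain p where p: "polyfun n p"
    "\<And>A C x X Y Z. plane c b A C S \<Longrightarrow> on_plane x A C S X Y Z \<Longrightarrow> p x = plane_val c b A C S X Y Z"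
    using extension_fixed_C[of c b n S] assms by (auto simp: add.commute)
  have "p x = plane_val b c A S C X Y Z" if "plane b c A S C" "on_plane x A S C X Y Z" for A C x X Y Z
    using p(2)[OF plane_swap[OF that(1)] on_plane_swap[OF that(2)]] plane_val_swap[of S C c b A X Z Y] that(1)
    unfolding plane_def by simp
  then show ?thesis using p(1) by blast
qed

text \<open>For k in D = B \<union> C let z be the value on the one of B, C not containing k.
  Expanding (x_i - z)^2 around x_k gives \<open>pp\<close>, where \<open>e\<close> is the scaled
  deviation of x_k from the mean over D, \<epsilon> is e (z - x_k) and \<delta> is (z - x_k)^2; all
  three are polynomial in x_k and the power sums over D. As A and D have equal size, planes with A =
  P and with A = Q can meet, and one polynomial must serve both.\<close>

lemma extension_fixed_A_aux:
  assumes bc: "b \<noteq> c" "0 < b" "0 < c" and n: "2 * (b + c) \<le> n"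
    and PQ: "P \<union> Q = {..<2 * (b + c)}" "P \<inter> Q = {}" "0 \<in> P" "1 \<in> Q"
  shows "\<exists>p. polyfun n p \<and> (\<forall>A B C x X Y Z. plane b c A B C \<and> on_plane x A B C X Y Z \<and> (A = P \<or> A = Q)
    \<longrightarrow> p x = plane_val b c A B C X Y Z)"
proof -
  define \<beta> \<gamma> :: complex where "\<beta> = of_nat b" and "\<gamma> = of_nat c"
  have nz: "\<beta> \<noteq> 0" "\<gamma> \<noteq> 0" "\<beta> + \<gamma> \<noteq> 0"
    using bc by (auto simp: \<beta>_def \<gamma>_def simp flip: of_nat_add)
  define s v :: "nat set \<Rightarrow> (nat \<Rightarrow> complex) \<Rightarrow> complex"
    where "s D x = (\<Sum>i\<in>D. x i)" and "v D x = (\<Sum>i\<in>D. x i ^ 2)" for D x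
  define e where "e D k x = s D x - (\<beta> + \<gamma>) * x k" for D k x
  define \<delta> where "\<delta> D x = ((\<beta> + \<gamma>) * v D x - (s D x)\<^sup>2) / (\<beta> * \<gamma>)" for D x
  define \<epsilon> where "\<epsilon> D k x = ((e D k x)\<^sup>2 + \<beta> * \<gamma> * \<delta> D x) / (\<beta> + \<gamma>)" for D k x
  \<comment> \<open>\<open>e\<close> and \<open>\<epsilon>\<close> vanish where \<open>x\<close> is constant on \<open>D\<close>, so the two summands below do not interfere.\<close>
  define pp where "pp i k D x = (x i - x k) * (e D k x * (x i - x k)\<^sup>2 - 2 * (x i - x k) * \<epsilon> D k x + e D k x * \<delta> D x)"
    for i k D x
  have pf: "polyfun n (s D)" "polyfun n (v D)" if "D \<subseteq> {..<2 * (b + c)}" for D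
    using n that unfolding s_def[abs_def] v_def[abs_def]
    by (auto intro!: polyfun_sum polyfun_power polyfun_coord)
  have pf01: "polyfun n (\<lambda>x. x 0)" "polyfun n (\<lambda>x. x 1)" using n bc by (auto intro!: polyfun_coord)
  have "polyfun n (\<lambda>x. pp 0 1 Q x - pp 1 0 P x)"
    unfolding pp_def \<epsilon>_def e_def \<delta>_def
    by (intro polyfun_mult polyfun_divide polyfun_diff polyfun_add polyfun_power polyfun_const pf pf01)
      (use PQ in auto)
  moreover have "pp 0 1 Q x - pp 1 0 P x = plane_val b c A B C X Y Z"
    if pl: "plane b c A B C" "on_plane x A B C X Y Z" and A: "A = P \<or> A = Q" for A B C x X Y Z
  proof -
    have fin: "finite B" "finite C" using plane_finite[OF pl(1)] by auto
    have dis: "A \<inter> B = {}" "A \<inter> C = {}" "B \<inter> C = {}" using pl(1) by (auto simp: plane_def)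
    have A_zero: "pp i k A x = 0" if "k \<in> A" for i k
    proof -
      have "x k = X" using that pl(2) by (simp add: on_plane_def)
      moreover have "s A x = (\<beta> + \<gamma>) * X" "v A x = (\<beta> + \<gamma>) * X\<^sup>2"
        using plane_sums(1)[OF pl, of 1] plane_sums(1)[OF pl, of 2] by (simp_all add: s_def v_def \<beta>_def \<gamma>_def)
      ultimately have "e A k x = 0" "\<delta> A x = 0" by (simp_all add: e_def \<delta>_def power2_eq_square)
      then show ?thesis by (simp add: pp_def \<epsilon>_def)
    qed
    have BC_val: "pp i k (B \<union> C) x = (X - Y) * (X - Z) * (Y - Z) * (if k \<in> C then \<beta> * (X - Y) else - \<gamma> * (X - Z))"
      if "i \<in> A" "k \<in> B \<union> C" for i k
    proof -
      have xi: "x i = X" using that pl(2) by (simp add: on_plane_def)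
      have sv: "s (B \<union> C) x = \<beta> * Y + \<gamma> * Z" "v (B \<union> C) x = \<beta> * Y\<^sup>2 + \<gamma> * Z\<^sup>2"
        using plane_sums(2,3)[OF pl, of 1] plane_sums(2,3)[OF pl, of 2] fin dis
        by (simp_all add: s_def v_def \<beta>_def \<gamma>_def sum.union_disjoint)
      have \<delta>: "\<delta> (B \<union> C) x = (Y - Z)\<^sup>2"
      proof -
        have "\<beta> * \<gamma> \<noteq> 0" using nz by simp
        note eq = nonzero_divide_eq_eq[OF this]
        show ?thesis unfolding \<delta>_def sv eq
          by (simp add: power2_eq_square algebra_simps)
      qed
      show ?thesis
      proof (cases "k \<in> C")
        case True
        then have xk: "x k = Z" using pl(2) by (simp add: on_plane_def)
        have e: "e (B \<union> C) k x = \<beta> * (Y - Z)" unfolding e_def sv xk by (simp add: algebra_simps)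
        have \<epsilon>: "\<epsilon> (B \<union> C) k x = \<beta> * (Y - Z)\<^sup>2"
          unfolding \<epsilon>_def e \<delta> nonzero_divide_eq_eq[OF nz(3)]
          by (simp add: power2_eq_square algebra_simps)
        show ?thesis using True unfolding pp_def e \<epsilon> \<delta> xi xk by (simp add: power2_eq_square algebra_simps)
      next
        case False
        then have xk: "x k = Y" using pl(2) that by (simp add: on_plane_def)
        have e: "e (B \<union> C) k x = \<gamma> * (Z - Y)" unfolding e_def sv xk by (simp add: algebra_simps)
        have \<epsilon>: "\<epsilon> (B \<union> C) k x = \<gamma> * (Y - Z)\<^sup>2"
          unfolding \<epsilon>_def e \<delta> nonzero_divide_eq_eq[OF nz(3)]
          by (simp add: power2_eq_square algebra_simps)
        show ?thesis using False unfolding pp_def e \<epsilon> \<delta> xi xk by (simp add: power2_eq_square algebra_simps)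
      qed
    qed
    have BC: "B \<union> C = {..<2 * (b + c)} - A" using pl(1) unfolding plane_def by blast
    have comp: "Q = {..<2 * (b + c)} - P" "P = {..<2 * (b + c)} - Q" using PQ(1,2) by blast+
    show ?thesis
    proof (cases "A = P")
      case True
      then have Q: "Q = B \<union> C" using BC comp(1) by simp
      show ?thesis
      proof -
        have m: "0 \<in> A" "1 \<in> B \<union> C" "1 \<notin> A" "0 \<notin> B" "0 \<notin> C" using PQ(3,4) True Q dis by blast+
        have "pp 1 0 P x = 0" unfolding True[symmetric] by (rule A_zero[OF m(1)])
        then show ?thesis unfolding Q BC_val[OF m(1,2)]
          using m by (auto simp: plane_val_def \<beta>_def \<gamma>_def)
      qed
    next
      case False
      then have A: "A = Q" using A by simp
      then have P: "P = B \<union> C" using BC comp(2) by simp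
      show ?thesis
      proof -
        have m: "1 \<in> A" "0 \<in> B \<union> C" "0 \<notin> A" "1 \<notin> B" "1 \<notin> C" using PQ(3,4) A P dis by blast+
        have "pp 0 1 Q x = 0" unfolding A[symmetric] by (rule A_zero[OF m(1)])
        then show ?thesis unfolding P BC_val[OF m(1,2)]
          using m by (auto simp: plane_val_def \<beta>_def \<gamma>_def)
      qed
    qed
  qed
  ultimately show ?thesis by (intro exI[of _ "\<lambda>x. pp 0 1 Q x - pp 1 0 P x"]) blast
qed

lemma extension_fixed_A:
  assumes bc: "b \<noteq> c" "0 < b" "0 < c" and n: "2 * (b + c) \<le> n"
    and S: "S \<subseteq> {..<2 * (b + c)}"
  shows "\<exists>p. polyfun n p \<and> (\<forall>A B C x X Y Z. plane b c A B C \<and> on_plane x A B C X Y Z \<and> (A = S \<or> A = {..<2 * (b + c)} - S)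
    \<longrightarrow> p x = plane_val b c A B C X Y Z)"
proof -
  let ?S = "{..<2 * (b + c)} - S"
  have ge2: "0 \<in> {..<2 * (b + c)}" "1 \<in> {..<2 * (b + c)}" using bc by auto
  consider "0 \<in> S" "1 \<in> ?S" | "0 \<in> ?S" "1 \<in> S" | "0 \<in> S \<longleftrightarrow> 1 \<in> S" using ge2 by blast
  then show ?thesis
  proof cases
    case 1
    then show ?thesis using extension_fixed_A_aux[OF bc n, of S ?S] S by auto
  next
    case 2
    then show ?thesis using extension_fixed_A_aux[OF bc n, of ?S S] S by (auto simp: disj_commute)
  next
    case 3
    have "0 = plane_val b c A B C X Y Z"
      if "plane b c A B C" "A = S \<or> A = ?S" for A B C X Y Z
    proof -
      have "0 \<in> A \<longleftrightarrow> 1 \<in> A" "A \<inter> B = {}" "A \<inter> C = {}"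
        using that 3 ge2 by (auto simp: plane_def)
      then show ?thesis by (auto simp: plane_val_def)
    qed
    then show ?thesis using polyfun_const[of n 0] by blast
  qed
qed

section \<open>The ideal of denoms\<close>

text \<open>The denominators of h on T. They form an ideal, and h is polynomial on T exactly when 1
  belongs to it.\<close>

definition denoms :: "nat \<Rightarrow> (nat \<Rightarrow> complex) set \<Rightarrow> ((nat \<Rightarrow> complex) \<Rightarrow> complex) \<Rightarrow> ((nat \<Rightarrow> complex) \<Rightarrow> complex) set" where
  "denoms n T h = {k. polyfun n k \<and> (\<exists>g. polyfun n g \<and> (\<forall>x\<in>T. g x = k x * h x))}"

lemma denoms_add:
  assumes "k \<in> denoms n T h" "l \<in> denoms n T h"
  shows "(\<lambda>x. k x + l x) \<in> denoms n T h"
proof -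
  obtain g g' where "polyfun n g" "\<forall>x\<in>T. g x = k x * h x" "polyfun n g'" "\<forall>x\<in>T. g' x = l x * h x"
    using assms unfolding denoms_def by blast
  then show ?thesis using assms unfolding denoms_def
    by (auto intro!: exI[of _ "\<lambda>x. g x + g' x"] simp: algebra_simps)
qed

lemma denoms_mult:
  assumes "polyfun n r" "k \<in> denoms n T h"
  shows "(\<lambda>x. r x * k x) \<in> denoms n T h"
proof -
  obtain g where "polyfun n g" "\<forall>x\<in>T. g x = k x * h x"
    using assms unfolding denoms_def by blast
  then show ?thesis using assms unfolding denoms_def
    by (auto intro!: exI[of _ "\<lambda>x. r x * g x"] simp: algebra_simps)
qed

lemma denoms_vanish:
  "polyfun n k \<Longrightarrow> (\<And>x. x \<in> T \<Longrightarrow> k x * h x = 0) \<Longrightarrow> k \<in> denoms n T h"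
  unfolding denoms_def by (auto intro!: exI[of _ "\<lambda>x. 0"])

lemma denoms_polyfun: "k \<in> denoms n T h \<Longrightarrow> polyfun n k"
  unfolding denoms_def by simp

section \<open>Separators: products of differences that isolate a stratum\<close>

definition separator :: "nat set \<Rightarrow> nat set \<Rightarrow> (nat \<Rightarrow> complex) \<Rightarrow> complex" where
  "separator N S x = (\<Prod>i\<in>S. \<Prod>j\<in>N - S. x i - x j)"

lemma polyfun_separator: "N \<subseteq> {..<n} \<Longrightarrow> S \<subseteq> N \<Longrightarrow> polyfun n (separator N S)"
  unfolding separator_def[abs_def] by (intro polyfun_prod polyfun_diff polyfun_coord) auto

text \<open>A set on which x is constant and which meets both S and its complement contributes a
  zero factor.\<close>

lemma separator_nonzero:
  assumes "finite N" "S \<subseteq> N" "separator N S x \<noteq> 0" "D \<subseteq> N" "\<And>i j. i \<in> D \<Longrightarrow> j \<in> D \<Longrightarrow> x i = x j"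
  shows "D \<subseteq> S \<or> D \<inter> S = {}"
proof (rule ccontr)
  assume "\<not> ?thesis"
  then obtain i j where ij: "i \<in> D" "i \<in> S" "j \<in> D" "j \<notin> S" by blast
  then have "x i - x j = 0" using assms(5)[of i j] by simp
  then have "(\<Prod>j\<in>N - S. x i - x j) = 0"
    using ij assms(1,4) by (intro prod_zero) auto
  then have "separator N S x = 0"
    unfolding separator_def using ij(2) finite_subset[OF assms(2,1)] by (intro prod_zero) auto
  then show False using assms(3) by simp
qed

text \<open>S is a union of blocks of sizes b + c, b, c. Only in size b + c do two unions compete, A
  and B \<union> C, which is why an extension for fixed A has to serve the complement as
  well.\<close>

lemma separator_plane:
  assumes pl: "plane b c A B C" "on_plane x A B C X Y Z" and bc: "b \<noteq> c" "0 < b" "0 < c"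
    and S: "S \<subseteq> {..<2 * (b + c)}" "separator {..<2 * (b + c)} S x \<noteq> 0"
  shows "card S = c \<Longrightarrow> S = C" "card S = b \<Longrightarrow> S = B"
    "card S = b + c \<Longrightarrow> A = S \<or> A = {..<2 * (b + c)} - S"
proof -
  have fin: "finite A" "finite B" "finite C" using plane_finite[OF pl(1)] by auto
  have finS: "finite S" using S(1) finite_subset by blast
  have cards: "card A = b + c" "card B = b" "card C = c" using pl(1) by (auto simp: plane_def)
  have un: "A \<union> B \<union> C = {..<2 * (b + c)}" "A \<inter> B = {}" "A \<inter> C = {}" "B \<inter> C = {}"
    using pl(1) by (auto simp: plane_def)
  have "A \<subseteq> S \<or> A \<inter> S = {}" "B \<subseteq> S \<or> B \<inter> S = {}" "C \<subseteq> S \<or> C \<inter> S = {}"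
    by (rule separator_nonzero[OF finite_lessThan S]; use un pl(2) in \<open>auto simp: on_plane_def\<close>)+
  note alt = this
  have le: "D \<subseteq> S \<Longrightarrow> card D \<le> card S" for D using card_mono[OF finS] by blast
  have BC: "card (B \<union> C) = b + c" using fin un cards by (simp add: card_Un_disjoint)
  have small: "(S = C \<or> S = B \<or> S = {})" if "card S < b + c"
  proof -
    have "A \<inter> S = {}" using le[of A] alt(1) cards that by auto
    then have SBC: "S \<subseteq> B \<union> C" using S(1) un(1) by blast
    have "\<not> B \<union> C \<subseteq> S" using le[of "B \<union> C"] BC that by auto
    then show ?thesis using alt(2,3) SBC by auto
  qed
  show "card S = c \<Longrightarrow> S = C" using small cards bc by auto
  show "card S = b \<Longrightarrow> S = B" using small cards bc by auto
  assume cS: "card S = b + c"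
  show "A = S \<or> A = {..<2 * (b + c)} - S"
  proof (cases "A \<subseteq> S")
    case True
    then show ?thesis using card_subset_eq[OF finS True] cards cS by simp
  next
    case False
    then have "A \<inter> S = {}" using alt by blast
    then have "S \<subseteq> B \<union> C" using S(1) un(1) by blast
    then have "S = B \<union> C" using card_subset_eq[of "B \<union> C" S] fin BC cS by simp
    then show ?thesis using un by blast
  qed
qed

text \<open>Where the separator of S is nonzero, S is a prescribed block of the plane (up to
  complement in size b + c) and the polynomial extensions apply; where it vanishes, both sides are
  0.\<close>

lemma separator_denominator:
  assumes bc: "b \<noteq> c" "0 < b" "0 < c" and n: "2 * (b + c) \<le> n"
    and T: "\<And>x. x \<in> T \<Longrightarrow> Q x \<noteq> 0 \<Longrightarrow> \<exists>A B C X Y Z. plane b c A B C \<and> on_plane x A B C X Y Z"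
    and Q: "polyfun n Q"
    and S: "S \<subseteq> {..<2 * (b + c)}" "card S \<in> {b, c, b + c}"
  shows "separator {..<2 * (b + c)} S \<in> denoms n T (\<lambda>x. Q x * plane_fun b c x)"
proof -
  let ?q = "separator {..<2 * (b + c)} S"
  have pq: "polyfun n ?q" by (rule polyfun_separator) (use n S in auto)
  have "\<exists>p. polyfun n p \<and> (\<forall>A B C x X Y Z. plane b c A B C \<and> on_plane x A B C X Y Z \<and> ?q x \<noteq> 0
    \<longrightarrow> p x = plane_val b c A B C X Y Z)"
  proof -
    consider "card S = c" | "card S = b" | "card S = b + c" using S(2) by blast
    then show ?thesis
    proof cases
      case 1
      then show ?thesis using extension_fixed_C[OF bc n S(1) 1] separator_plane(1)[OF _ _ bc S(1) _ 1] by metis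
    next
      case 2
      then show ?thesis using extension_fixed_B[OF bc n S(1) 2] separator_plane(2)[OF _ _ bc S(1) _ 2] by metis
    next
      case 3
      obtain p where p0: "polyfun n p" "\<forall>A B C x X Y Z. plane b c A B C \<and> on_plane x A B C X Y Z \<and>
          (A = S \<or> A = {..<2 * (b + c)} - S) \<longrightarrow> p x = plane_val b c A B C X Y Z"
        using extension_fixed_A[OF bc n S(1)] by (elim exE conjE)
      note p = p0(1) p0(2)[rule_format]
      have "p x = plane_val b c A B C X Y Z"
        if "plane b c A B C \<and> on_plane x A B C X Y Z \<and> ?q x \<noteq> 0" for A B C x X Y Z
        using p(2) separator_plane(3)[OF _ _ bc S(1) _ 3] that by (elim conjE) simp
      then show ?thesis using p(1) by (intro exI[of _ p] conjI allI impI)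
    qed
  qed
  then obtain p where p: "polyfun n p" "\<forall>A B C x X Y Z. plane b c A B C \<and> on_plane x A B C X Y Z \<and> ?q x \<noteq> 0
    \<longrightarrow> p x = plane_val b c A B C X Y Z"
    by (elim exE conjE)
  have "?q x * (Q x * p x) = ?q x * (Q x * plane_fun b c x)" if x: "x \<in> T" for x
  proof (cases "Q x = 0 \<or> ?q x = 0")
    case False
    then obtain A B C X Y Z where pl: "plane b c A B C" "on_plane x A B C X Y Z" using T[OF x] by blast
    then show ?thesis using p(2)[rule_format, of A B C x X Y Z] plane_fun_eq[OF pl bc] False by simp
  qed auto
  moreover have "polyfun n (\<lambda>x. ?q x * (Q x * p x))" by (intro polyfun_mult pq Q p)
  ultimately show ?thesis unfolding denoms_def using pq by blast
qed

lemma separator_three_blocks: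
  assumes "U \<union> V \<union> W = N" "U \<inter> V = {}" "U \<inter> W = {}" "V \<inter> W = {}" "finite N"
    and "\<And>i. i \<in> U \<Longrightarrow> x i = p" "\<And>i. i \<in> V \<Longrightarrow> x i = q" "\<And>i. i \<in> W \<Longrightarrow> x i = r"
  shows "separator N U x = (p - q) ^ (card V * card U) * (p - r) ^ (card W * card U)"
proof -
  have fin: "finite V" "finite W" using assms(1,5) by auto
  have "N - U = V \<union> W" using assms(1-4) by blast
  then have "(\<Prod>j\<in>N - U. x i - x j) = (p - q) ^ card V * (p - r) ^ card W" if "i \<in> U" for i
    using that fin assms(4,6-8) by (simp add: prod.union_disjoint)
  then have "separator N U x = (\<Prod>i\<in>U. (p - q) ^ card V * (p - r) ^ card W)"
    unfolding separator_def by (intro prod.cong) auto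
  then show ?thesis by (simp add: power_mult_distrib power_mult)
qed

text \<open>(p - q)^(k + l) lies in the ideal (p^k, q^l), as every binomial term contains one of the
  two powers. The induction peels off one factor p - q and lowers k in its p-part and l in its
  q-part.\<close>

lemma diff_power_split:
  assumes "polyfun n p" "polyfun n q"
  shows "\<exists>U W. polyfun n U \<and> polyfun n W \<and> (\<forall>x. (p x - q x) ^ (k + l) = U x * p x ^ k + W x * q x ^ l)"
proof (induction "k + l" arbitrary: k l)
  case 0
  then show ?case by (intro exI[of _ "\<lambda>x. 1"] exI[of _ "\<lambda>x. 0"]) auto
next
  case (Suc m)
  show ?case
  proof (cases "k = 0 \<or> l = 0")
    case True
    have d: "polyfun n (\<lambda>x. (p x - q x) ^ (k + l))" using assms by auto
    from True show ?thesis
    proof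
      assume "k = 0"
      then show ?thesis using d by (intro exI[of _ "\<lambda>x. (p x - q x) ^ (k + l)"] exI[of _ "\<lambda>x. 0"]) auto
    next
      assume "l = 0"
      then show ?thesis using d by (intro exI[of _ "\<lambda>x. 0"] exI[of _ "\<lambda>x. (p x - q x) ^ (k + l)"]) auto
    qed
  next
    case False
    then obtain k' l' where kl: "k = Suc k'" "l = Suc l'" by (cases k; cases l) auto
    obtain U W where UW: "polyfun n U" "polyfun n W" "\<And>x. (p x - q x) ^ m = U x * p x ^ k' + W x * q x ^ l"
      using Suc.hyps(1)[of k' l] Suc.hyps(2) kl by auto
    obtain U' W' where UW': "polyfun n U'" "polyfun n W'" "\<And>x. (p x - q x) ^ m = U' x * p x ^ k + W' x * q x ^ l'"
      using Suc.hyps(1)[of k l'] Suc.hyps(2) kl by auto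
    have "(p x - q x) ^ (k + l) = (U x - q x * U' x) * p x ^ k + (p x * W x - W' x) * q x ^ l" for x
    proof -
      have "(p x - q x) ^ (k + l) = p x * (p x - q x) ^ m - q x * (p x - q x) ^ m"
        using Suc.hyps(2) by (simp flip: Suc.hyps(2) add: algebra_simps)
      also have "\<dots> = p x * (U x * p x ^ k' + W x * q x ^ l) - q x * (U' x * p x ^ k + W' x * q x ^ l')"
        using UW(3) UW'(3) by simp
      finally show ?thesis by (simp add: kl algebra_simps)
    qed
    moreover have "polyfun n (\<lambda>x. U x - q x * U' x)" "polyfun n (\<lambda>x. p x * W x - W' x)"
      using UW(1,2) UW'(1,2) assms by auto
    ultimately show ?thesis by blast
  qed
qed

text \<open>At values p, q, r the separators of U and V, filled up to exponent m, become (p - q)^m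
  (p - r)^m and (p - q)^m (q - r)^m; an even m absorbs the sign. As p - q is the difference of p - r
  and q - r, \<open>diff_power_split\<close> puts (p - q)^(2m) into the ideal of the last factors,
  whence the exponent 3m.\<close>

lemma block_difference_power:
  assumes UVW: "U \<union> V \<union> W = N" "U \<inter> V = {}" "U \<inter> W = {}" "V \<inter> W = {}" "finite N" "N \<subseteq> {..<n}"
    and J: "separator N U \<in> denoms n T h" "separator N V \<in> denoms n T h"
    and ijk: "i \<in> U" "j \<in> V" "k \<in> W"
    and m: "card V * card U \<le> m" "card W * card U \<le> m" "card W * card V \<le> m" "even m"
  shows "\<exists>d\<in>denoms n T h. \<forall>x p q r. (\<forall>i\<in>U. x i = p) \<and> (\<forall>i\<in>V. x i = q) \<and> (\<forall>i\<in>W. x i = r)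
    \<longrightarrow> (x i - x j) ^ (3 * m) = d x"
proof -
  have pf: "polyfun n (\<lambda>x. x i)" "polyfun n (\<lambda>x. x j)" "polyfun n (\<lambda>x. x k)"
    using UVW ijk by (auto intro!: polyfun_coord)
  obtain R R' where R: "polyfun n R" "polyfun n R'"
    "\<And>x. ((x i - x k) - (x j - x k)) ^ (m + m) = R x * (x i - x k) ^ m + R' x * (x j - x k) ^ m"
    using diff_power_split[OF polyfun_diff[OF pf(1,3)] polyfun_diff[OF pf(2,3)], of m m] by blast
  define d1 where "d1 x = ((x i - x j) ^ (m - card V * card U) * (x i - x k) ^ (m - card W * card U)) * separator N U x" for x
  define d2 where "d2 x = ((x j - x i) ^ (m - card U * card V) * (x j - x k) ^ (m - card W * card V)) * separator N V x" for x
  have d: "d1 \<in> denoms n T h" "d2 \<in> denoms n T h"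
    unfolding d1_def d2_def by (intro denoms_mult J polyfun_mult polyfun_power polyfun_diff pf)+
  have "(\<lambda>x. R x * d1 x + R' x * d2 x) \<in> denoms n T h"
    by (intro denoms_add denoms_mult R d)
  moreover have "(x i - x j) ^ (3 * m) = R x * d1 x + R' x * d2 x"
    if x: "\<forall>i\<in>U. x i = p" "\<forall>i\<in>V. x i = q" "\<forall>i\<in>W. x i = r" for x p q r
  proof -
    have xi: "x i = p" "x j = q" "x k = r" using x ijk by auto
    have s1: "separator N U x = (p - q) ^ (card V * card U) * (p - r) ^ (card W * card U)"
      by (rule separator_three_blocks) (use UVW x in auto)
    have s2: "separator N V x = (q - p) ^ (card U * card V) * (q - r) ^ (card W * card V)"
      by (rule separator_three_blocks) (use UVW x in auto)
    have "d1 x = ((p - q) ^ (m - card V * card U) * (p - q) ^ (card V * card U)) * ((p - r) ^ (m - card W * card U) * (p - r) ^ (card W * card U))"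
      unfolding d1_def s1 xi by (simp add: algebra_simps)
    also have "\<dots> = (p - q) ^ m * (p - r) ^ m"
      using m by (simp flip: power_add)
    finally have e1: "d1 x = (p - q) ^ m * (p - r) ^ m" .
    have "d2 x = ((q - p) ^ (m - card U * card V) * (q - p) ^ (card U * card V)) * ((q - r) ^ (m - card W * card V) * (q - r) ^ (card W * card V))"
      unfolding d2_def s2 xi by (simp add: algebra_simps)
    also have "\<dots> = (q - p) ^ m * (q - r) ^ m"
      using m by (simp add: mult.commute flip: power_add)
    also have "(q - p) ^ m = (p - q) ^ m" using m(4) by (metis minus_diff_eq power_minus_even)
    finally have e2: "d2 x = (p - q) ^ m * (q - r) ^ m" .
    have "(x i - x j) ^ (3 * m) = (p - q) ^ m * ((x i - x k) - (x j - x k)) ^ (m + m)"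
    proof -
      have "3 * m = m + (m + m)" by simp
      moreover have "(x i - x k) - (x j - x k) = p - q" by (simp add: xi)
      ultimately show ?thesis by (simp only: power_add xi)
    qed
    also have "\<dots> = (p - q) ^ m * (R x * (p - r) ^ m + R' x * (q - r) ^ m)"
      unfolding R(3) unfolding xi ..
    also have "\<dots> = R x * ((p - q) ^ m * (p - r) ^ m) + R' x * ((p - q) ^ m * (q - r) ^ m)"
      by (simp only: distrib_left mult.left_commute)
    also have "\<dots> = R x * d1 x + R' x * d2 x" unfolding e1 e2 ..
    finally show ?thesis .
  qed
  ultimately show ?thesis by (intro bexI[of _ "\<lambda>x. R x * d1 x + R' x * d2 x"] allI impI) (elim conjE)
qed

lemma plane_difference_power:
  assumes bc: "b \<noteq> c" "0 < b" "0 < c" and n: "2 * (b + c) \<le> n"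
    and T: "\<And>x. x \<in> T \<Longrightarrow> Q x \<noteq> 0 \<Longrightarrow> \<exists>A B C X Y Z. plane b c A B C \<and> on_plane x A B C X Y Z"
    and Q: "polyfun n Q" and pl: "plane b c A B C"
    and ij: "i < 2 * (b + c)" "j < 2 * (b + c)"
    and m: "m = (2 * (b + c)) * (2 * (b + c))"
  shows "\<exists>d\<in>denoms n T (\<lambda>x. Q x * plane_fun b c x).
    \<forall>x X Y Z. on_plane x A B C X Y Z \<longrightarrow> (x i - x j) ^ (3 * m) = d x"
proof -
  let ?N = "{..<2 * (b + c)}" and ?J = "denoms n T (\<lambda>x. Q x * plane_fun b c x)"
  have un: "A \<union> B \<union> C = ?N" "A \<inter> B = {}" "A \<inter> C = {}" "B \<inter> C = {}"
    and cards: "card A = b + c" "card B = b" "card C = c"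
    using pl by (auto simp: plane_def)
  have J: "separator ?N D \<in> ?J" if "D = A \<or> D = B \<or> D = C" for D
    by (rule separator_denominator[OF bc n T Q]) (use that un cards in auto)
  obtain kA kB kC where k: "kA \<in> A" "kB \<in> B" "kC \<in> C" using plane_nonempty[OF pl bc(2,3)] by blast
  have le: "card D * card D' \<le> m" if "D \<subseteq> ?N" "D' \<subseteq> ?N" for D D'
    using card_mono[OF _ that(1)] card_mono[OF _ that(2)] unfolding m by (intro mult_le_mono) auto
  have even: "even m" by (simp add: m)
  have N: "?N \<subseteq> {..<n}" using n by auto
  have sub: "A \<subseteq> ?N" "B \<subseteq> ?N" "C \<subseteq> ?N" using un by auto
  have gen: "\<exists>d\<in>?J. \<forall>x X Y Z. on_plane x A B C X Y Z \<longrightarrow> (x i - x j) ^ (3 * m) = d x"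
    if "U \<union> V \<union> W = ?N" "U \<inter> V = {}" "U \<inter> W = {}" "V \<inter> W = {}"
      "U = A \<or> U = B \<or> U = C" "V = A \<or> V = B \<or> V = C" "W = A \<or> W = B \<or> W = C"
      "i \<in> U" "j \<in> V" for U V W
  proof -
    note blocks = that(5-7)
    have W: "\<exists>k. k \<in> W" using that(7) k by blast
    then obtain k where "k \<in> W" ..
    have subs: "U \<subseteq> ?N" "V \<subseteq> ?N" "W \<subseteq> ?N" using that(1) by auto
    from block_difference_power[OF that(1-4) finite_lessThan N J[OF that(5)] J[OF that(6)] that(8,9) \<open>k \<in> W\<close>
        le[OF subs(2,1)] le[OF subs(3,1)] le[OF subs(3,2)] even]
    obtain d where d: "d \<in> ?J" "\<And>x p q r. (\<forall>i\<in>U. x i = p) \<and> (\<forall>i\<in>V. x i = q) \<and> (\<forall>i\<in>W. x i = r)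
      \<longrightarrow> (x i - x j) ^ (3 * m) = d x" by blast
    have "(x i - x j) ^ (3 * m) = d x" if "on_plane x A B C X Y Z" for x X Y Z
    proof -
      have const: "\<exists>p. \<forall>i\<in>D. x i = p" if "D = A \<or> D = B \<or> D = C" for D
        using that \<open>on_plane x A B C X Y Z\<close> unfolding on_plane_def by blast
      obtain p where "\<forall>i\<in>U. x i = p" using const[OF blocks(1)] by blast
      moreover obtain q where "\<forall>i\<in>V. x i = q" using const[OF blocks(2)] by blast
      moreover obtain r where "\<forall>i\<in>W. x i = r" using const[OF blocks(3)] by blast
      ultimately show ?thesis using d(2)[of x p q r] by blast
    qed
    then show ?thesis using d(1) by blast
  qed
  consider (same) "i \<in> A \<and> j \<in> A \<or> i \<in> B \<and> j \<in> B \<or> i \<in> C \<and> j \<in> C"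
    | (AB) "i \<in> A" "j \<in> B" | (AC) "i \<in> A" "j \<in> C" | (BA) "i \<in> B" "j \<in> A"
    | (BC) "i \<in> B" "j \<in> C" | (CA) "i \<in> C" "j \<in> A" | (CB) "i \<in> C" "j \<in> B"
    using ij un(1) by (metis Un_iff lessThan_iff)
  then show ?thesis
  proof cases
    case same
    have "m > 0" using bc m by simp
    then have "(x i - x j) ^ (3 * m) = 0" if "on_plane x A B C X Y Z" for x X Y Z
      using that same by (auto simp: on_plane_def)
    moreover have "(\<lambda>x. 0) \<in> ?J" by (rule denoms_vanish) auto
    ultimately show ?thesis by (intro bexI[of _ "\<lambda>x. 0"]) auto
  next
    case AB
    show ?thesis by (rule gen[of A B C]) (use un AB in auto)
  next
    case AC
    show ?thesis by (rule gen[of A C B]) (use un AC in auto)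
  next
    case BA
    show ?thesis by (rule gen[of B A C]) (use un BA in auto)
  next
    case BC
    show ?thesis by (rule gen[of B C A]) (use un BC in auto)
  next
    case CA
    show ?thesis by (rule gen[of C A B]) (use un CA in auto)
  next
    case CB
    show ?thesis by (rule gen[of C B A]) (use un CB in auto)
  qed
qed

text \<open>The denominator d that equals u = (x_i - x_j)^(3m) on a plane depends on the plane. The
  product of u - d over the finitely many planes vanishes at the points of T where Q does not, so it
  is a denominator; expanded, it is a power of u minus a denominator.\<close>

lemma difference_power_denominator:
  assumes bc: "b \<noteq> c" "0 < b" "0 < c" and n: "2 * (b + c) \<le> n"
    and T: "\<And>x. x \<in> T \<Longrightarrow> Q x \<noteq> 0 \<Longrightarrow> \<exists>A B C X Y Z. plane b c A B C \<and> on_plane x A B C X Y Z"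
    and Q: "polyfun n Q"
  shows "\<exists>M. \<forall>i<2 * (b + c). \<forall>j<2 * (b + c).
    (\<lambda>x. (x i - x j) ^ M) \<in> denoms n T (\<lambda>x. Q x * plane_fun b c x)"
proof -
  let ?N = "{..<2 * (b + c)}" and ?h = "\<lambda>x. Q x * plane_fun b c x"
  let ?J = "denoms n T ?h"
  define m where "m = (2 * (b + c)) * (2 * (b + c))"
  define Pl where "Pl = {(A, B, C). plane b c A B C}"
  have "Pl \<subseteq> Pow ?N \<times> Pow ?N \<times> Pow ?N" unfolding Pl_def plane_def by blast
  then have finPl: "finite Pl" by (rule finite_subset) auto
  have "(\<lambda>x. (x i - x j) ^ (3 * m * card Pl)) \<in> ?J" if ij: "i < 2 * (b + c)" "j < 2 * (b + c)" for i j
  proof -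
    have "\<forall>A B C. \<exists>d. plane b c A B C \<longrightarrow> d \<in> ?J \<and> (\<forall>x X Y Z. on_plane x A B C X Y Z \<longrightarrow> (x i - x j) ^ (3 * m) = d x)"
      using plane_difference_power[OF bc n T Q _ ij m_def] by meson
    then obtain d where d: "\<And>A B C. plane b c A B C \<Longrightarrow> d A B C \<in> ?J"
      "\<And>A B C x X Y Z. plane b c A B C \<Longrightarrow> on_plane x A B C X Y Z \<Longrightarrow> (x i - x j) ^ (3 * m) = d A B C x"
      by metis
    define u where "u x = (x i - x j) ^ (3 * m)" for x :: "nat \<Rightarrow> complex"
    have pu: "polyfun n u" unfolding u_def[abs_def] using ij n by (intro polyfun_power polyfun_diff polyfun_coord) auto
    have "\<exists>e\<in>?J. \<forall>x. (\<Prod>(A, B, C)\<in>F. u x - d A B C x) = u x ^ card F - e x" if "finite F" "F \<subseteq> Pl" for F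
      using that
    proof (induction F rule: finite_induct)
      case empty
      have "(\<lambda>x. 0) \<in> ?J" by (rule denoms_vanish) auto
      then show ?case by (intro bexI[of _ "\<lambda>x. 0"]) auto
    next
      case (insert P F)
      obtain A B C where P: "P = (A, B, C)" by (cases P) auto
      have dJ: "d A B C \<in> ?J" using insert.prems P d(1) by (auto simp: Pl_def)
      obtain e where e: "e \<in> ?J" "\<And>x. (\<Prod>(A, B, C)\<in>F. u x - d A B C x) = u x ^ card F - e x"
        using insert.IH insert.prems by auto
      define e' where "e' x = u x * e x + (u x ^ card F - e x) * d A B C x" for x
      have "e' \<in> ?J" unfolding e'_def[abs_def]
        by (intro denoms_add denoms_mult pu e(1) dJ polyfun_diff polyfun_power denoms_polyfun[OF e(1)])
      moreover have "(\<Prod>(A, B, C)\<in>insert P F. u x - d A B C x) = u x ^ card (insert P F) - e' x" for x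
      proof -
        have "(\<Prod>(A, B, C)\<in>insert P F. u x - d A B C x) = (u x - d A B C x) * (u x ^ card F - e x)"
          using insert.hyps by (simp add: P flip: e(2))
        then show ?thesis using insert.hyps by (simp add: e'_def algebra_simps)
      qed
      ultimately show ?case by blast
    qed
    from this[OF finPl] obtain e where e: "e \<in> ?J" "\<And>x. (\<Prod>(A, B, C)\<in>Pl. u x - d A B C x) = u x ^ card Pl - e x"
      by auto
    have "(\<lambda>x. u x ^ card Pl - e x) \<in> ?J"
    proof (rule denoms_vanish)
      show "polyfun n (\<lambda>x. u x ^ card Pl - e x)" by (intro polyfun_diff polyfun_power pu denoms_polyfun[OF e(1)])
      fix x assume x: "x \<in> T"
      show "(u x ^ card Pl - e x) * ?h x = 0"
      proof (cases "Q x = 0")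
        case False
        then obtain A B C X Y Z where pl: "plane b c A B C" "on_plane x A B C X Y Z" using T[OF x] by blast
        have "u x - d A B C x = 0" using d(2)[OF pl] by (simp add: u_def)
        moreover have "(A, B, C) \<in> Pl" using pl by (simp add: Pl_def)
        ultimately have "(\<Prod>(A, B, C)\<in>Pl. u x - d A B C x) = 0"
          using finPl by (intro prod_zero) (auto intro!: bexI[of _ "(A, B, C)"])
        then show ?thesis using e(2) by simp
      qed simp
    qed
    from denoms_add[OF this e(1)] show ?thesis by (simp add: u_def power_mult)
  qed
  then show ?thesis by blast
qed

text \<open>Descent over products of powers of the x_i - x_0: such a product is a denominator once
  some exponent reaches M, and \<open>sat\<close> passes from all exponent vectors one step up to
  the vector itself, down to the zero vector.\<close>

lemma one_denominator:
  assumes bc: "b \<noteq> c" "0 < b" "0 < c" and n: "2 * (b + c) \<le> n"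
    and T: "\<And>x. x \<in> T \<Longrightarrow> Q x \<noteq> 0 \<Longrightarrow> \<exists>A B C X Y Z. plane b c A B C \<and> on_plane x A B C X Y Z"
    and Q: "polyfun n Q"
    and sat: "\<And>k e. polyfun n k \<Longrightarrow> (\<And>t x. k (\<lambda>i. t * x i) = t ^ e * k x) \<Longrightarrow>
      (\<And>i. i < 2 * (b + c) \<Longrightarrow> (\<lambda>x. (x i - x 0) * k x) \<in> denoms n T (\<lambda>x. Q x * plane_fun b c x)) \<Longrightarrow>
      k \<in> denoms n T (\<lambda>x. Q x * plane_fun b c x)"
  shows "(\<lambda>x. 1) \<in> denoms n T (\<lambda>x. Q x * plane_fun b c x)"
proof -
  let ?N = "{..<2 * (b + c)}" and ?J = "denoms n T (\<lambda>x. Q x * plane_fun b c x)"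
  obtain M where M: "\<And>i j. i \<in> ?N \<Longrightarrow> j \<in> ?N \<Longrightarrow> (\<lambda>x. (x i - x j) ^ M) \<in> ?J"
    using difference_power_denominator[OF bc n, of T Q, OF T Q] by auto
  have 0: "0 \<in> ?N" using bc by auto
  define k where "k e x = (\<Prod>i\<in>?N. (x i - x 0) ^ e i)" for e :: "nat \<Rightarrow> nat" and x :: "nat \<Rightarrow> complex"
  have pk: "polyfun n (k e)" for e
    unfolding k_def[abs_def] using n bc by (intro polyfun_prod polyfun_power polyfun_diff polyfun_coord) auto
  have split: "k e x = (x i - x 0) ^ e i * (\<Prod>i\<in>?N - {i}. (x i - x 0) ^ e i)" if "i \<in> ?N" for e i x
    unfolding k_def using that by (simp add: prod.remove)
  have "k e \<in> ?J" for e
  proof (induction "\<Sum>i\<in>?N. M - e i" arbitrary: e rule: less_induct)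
    case less
    show ?case
    proof (cases "\<exists>i\<in>?N. M \<le> e i")
      case True
      then obtain i where i: "i \<in> ?N" "M \<le> e i" by blast
      define r where "r x = (x i - x 0) ^ (e i - M) * (\<Prod>i\<in>?N - {i}. (x i - x 0) ^ e i)" for x :: "nat \<Rightarrow> complex"
      have "polyfun n r" unfolding r_def[abs_def] using n bc i
        by (intro polyfun_mult polyfun_prod polyfun_power polyfun_diff polyfun_coord) auto
      from denoms_mult[OF this M[OF i(1) 0]] have "(\<lambda>x. r x * (x i - x 0) ^ M) \<in> ?J" .
      also have "(\<lambda>x. r x * (x i - x 0) ^ M) = k e"
      proof
        fix x :: "nat \<Rightarrow> complex"
        have "(x i - x 0) ^ e i = (x i - x 0) ^ (e i - M) * (x i - x 0) ^ M"
          using i(2) by (simp flip: power_add)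
        then show "r x * (x i - x 0) ^ M = k e x" unfolding split[OF i(1)] r_def by simp
      qed
      finally show ?thesis .
    next
      case False
      show ?thesis
      proof (rule sat[OF pk])
        show "k e (\<lambda>i. t * x i) = t ^ (\<Sum>i\<in>?N. e i) * k e x" for t x
        proof -
          have "k e (\<lambda>i. t * x i) = (\<Prod>i\<in>?N. t ^ e i * (x i - x 0) ^ e i)"
            unfolding k_def by (intro prod.cong refl) (simp add: power_mult_distrib flip: right_diff_distrib)
          then show ?thesis by (simp add: prod.distrib k_def power_sum)
        qed
        fix i assume "i < 2 * (b + c)"
        then have i: "i \<in> ?N" by simp
        let ?e = "e(i := Suc (e i))"
        have "e i < M" using False i by force
        then have "(\<Sum>i\<in>?N. M - ?e i) < (\<Sum>i\<in>?N. M - e i)"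
          by (intro sum_strict_mono_ex1) (use i in \<open>auto intro!: bexI[of _ i]\<close>)
        then have "k ?e \<in> ?J" using less by blast
        also have "k ?e = (\<lambda>x. (x i - x 0) * k e x)"
          unfolding split[OF i] by (intro ext) (simp add: mult.assoc)
        finally show "(\<lambda>x. (x i - x 0) * k e x) \<in> ?J" .
      qed
    qed
  qed
  from this[of "\<lambda>i. 0"] show ?thesis by (simp add: k_def[abs_def])
qed

section \<open>Non-extendability\<close>

subsection \<open>Symmetrized monomials in terms of power sums\<close>

definition psum :: "nat \<Rightarrow> nat \<Rightarrow> (nat \<Rightarrow> complex) \<Rightarrow> complex" where
  "psum N k y = (\<Sum>i<N. y i ^ k)"

text \<open>The weight-e part of the algebra generated by the marked coordinates and the power sums.
  The power sums run over all N coordinates, marks included, because then their values on a plane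
  depend on X, Y, Z alone.\<close>

inductive psum_form :: "nat \<Rightarrow> nat \<Rightarrow> ((nat \<Rightarrow> complex) \<Rightarrow> complex) \<Rightarrow> bool" for N where
  const: "psum_form N 0 (\<lambda>y. c)"
| fst: "psum_form N e f \<Longrightarrow> psum_form N (Suc e) (\<lambda>y. y 0 * f y)"
| snd: "psum_form N e f \<Longrightarrow> psum_form N (Suc e) (\<lambda>y. y 1 * f y)"
| psum: "psum_form N e f \<Longrightarrow> 0 < k \<Longrightarrow> psum_form N (e + k) (\<lambda>y. psum N k y * f y)"
| add: "psum_form N e f \<Longrightarrow> psum_form N e g \<Longrightarrow> psum_form N e (\<lambda>y. f y + g y)"
| scale: "psum_form N e f \<Longrightarrow> psum_form N e (\<lambda>y. c * f y)"

lemma psum_form_zero: "psum_form N e (\<lambda>y. 0)"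
proof -
  have "psum_form N e (\<lambda>y. y 0 ^ e * 1)"
  proof (induction e)
    case 0
    show ?case using psum_form.const[of N 1] by simp
  next
    case (Suc e)
    show ?case using psum_form.fst[OF Suc] by (simp add: mult.assoc)
  qed
  from psum_form.scale[OF this, of 0] show ?thesis by simp
qed

lemma psum_form_sum:
  "(\<And>i. i \<in> A \<Longrightarrow> psum_form N e (f i)) \<Longrightarrow> psum_form N e (\<lambda>y. \<Sum>i\<in>A. f i y)"
  by (induction A rule: infinite_finite_induct) (auto intro: psum_form_zero psum_form.add)

lemma psum_form_diff:
  "psum_form N e f \<Longrightarrow> psum_form N e g \<Longrightarrow> psum_form N e (\<lambda>y. f y - g y)"
  using psum_form.add[of N e f "\<lambda>y. -1 * g y"] psum_form.scale[of N e g "-1"] by simp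

lemma psum_form_power:
  assumes "psum_form N e f"
  shows "psum_form N (e + k) (\<lambda>y. y 0 ^ k * f y)" "psum_form N (e + k) (\<lambda>y. y 1 ^ k * f y)"
proof -
  show "psum_form N (e + k) (\<lambda>y. y 0 ^ k * f y)"
  proof (induction k)
    case (Suc k)
    show ?case using psum_form.fst[OF Suc] by (simp add: mult.assoc)
  qed (use assms in simp)
  show "psum_form N (e + k) (\<lambda>y. y 1 ^ k * f y)"
  proof (induction k)
    case (Suc k)
    show ?case using psum_form.snd[OF Suc] by (simp add: mult.assoc)
  qed (use assms in simp)
qed

definition sym_monomial :: "nat set \<Rightarrow> (nat \<Rightarrow> nat) \<Rightarrow> (nat \<Rightarrow> complex) \<Rightarrow> complex" where
  "sym_monomial D m y = (\<Sum>\<sigma> | \<sigma> permutes D. \<Prod>i\<in>D. y (\<sigma> i) ^ m i)"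

lemma sym_monomial_permute:
  assumes "\<tau> permutes D"
  shows "sym_monomial D (m \<circ> \<tau>) y = sym_monomial D m y"
proof -
  have "sym_monomial D m y = (\<Sum>\<sigma> | \<sigma> permutes D. \<Prod>i\<in>D. y ((\<sigma> \<circ> inv \<tau>) i) ^ m i)"
    unfolding sym_monomial_def by (rule sum_permutations_compose_right[OF permutes_inv[OF assms]])
  also have "\<dots> = sym_monomial D (m \<circ> \<tau>) y"
    unfolding sym_monomial_def
  proof (intro sum.cong refl)
    fix \<sigma>
    show "(\<Prod>i\<in>D. y ((\<sigma> \<circ> inv \<tau>) i) ^ m i) = (\<Prod>i\<in>D. y (\<sigma> i) ^ (m \<circ> \<tau>) i)"
      using prod.permute[OF assms, of "\<lambda>i. y ((\<sigma> \<circ> inv \<tau>) i) ^ m i"]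
      by (simp add: permutes_inverses[OF assms])
  qed
  finally show ?thesis ..
qed

lemma sym_monomial_psum:
  assumes "finite D"
  shows "(\<Sum>j\<in>D. y j ^ k) * sym_monomial D m y = (\<Sum>j\<in>D. sym_monomial D (m(j := m j + k)) y)"
proof -
  have eq: "(\<Sum>j\<in>D. y j ^ k) * (\<Prod>i\<in>D. y (\<sigma> i) ^ m i) = (\<Sum>j\<in>D. \<Prod>i\<in>D. y (\<sigma> i) ^ (m(j := m j + k)) i)"
    if "\<sigma> permutes D" for \<sigma>
  proof -
    have "(\<Sum>j\<in>D. y j ^ k) = (\<Sum>j\<in>D. y (\<sigma> j) ^ k)"
      using sum.permute[OF that, of "\<lambda>j. y j ^ k"] by simp
    moreover have "y (\<sigma> j) ^ k * (\<Prod>i\<in>D. y (\<sigma> i) ^ m i) = (\<Prod>i\<in>D. y (\<sigma> i) ^ (m(j := m j + k)) i)" if "j \<in> D" for j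
      using assms that by (simp add: prod.remove[of D j] power_add)
    ultimately show ?thesis by (simp add: sum_distrib_right)
  qed
  have "(\<Sum>j\<in>D. y j ^ k) * sym_monomial D m y
      = (\<Sum>\<sigma> | \<sigma> permutes D. \<Sum>j\<in>D. \<Prod>i\<in>D. y (\<sigma> i) ^ (m(j := m j + k)) i)"
    unfolding sym_monomial_def sum_distrib_left[of _ _ "{\<sigma>. \<sigma> permutes D}"]
    by (intro sum.cong refl eq) simp
  also have "\<dots> = (\<Sum>j\<in>D. sym_monomial D (m(j := m j + k)) y)"
    unfolding sym_monomial_def by (rule sum.swap)
  finally show ?thesis .
qed

text \<open>Multiplying by a power sum either enlarges the support of the exponent or raises one of its entries;
  solving for the first kind of term reduces the support.\<close>

lemma psum_form_sym_monomial:
  assumes N: "2 \<le> N"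
  shows "psum_form N (\<Sum>i\<in>{2..<N}. m i) (sym_monomial {2..<N} m)"
proof (induction "card {i \<in> {2..<N}. m i \<noteq> 0}" arbitrary: m rule: less_induct)
  case less
  let ?D = "{2..<N}"
  show ?case
  proof (cases "\<exists>i\<in>?D. m i \<noteq> 0")
    case False
    then have "sym_monomial ?D m = (\<lambda>y. of_nat (card {\<sigma>. \<sigma> permutes ?D}))" "(\<Sum>i\<in>?D. m i) = 0"
      by (auto simp: sym_monomial_def)
    then show ?thesis using psum_form.const by simp
  next
    case True
    then obtain i where i: "i \<in> ?D" "m i \<noteq> 0" by blast
    define k where "k = m i"
    define m' where "m' = m(i := 0)"
    define Z where "Z = {j \<in> ?D. m' j = 0}"
    have iZ: "i \<in> Z" using i by (simp add: Z_def m'_def)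
    have supp: "{j \<in> ?D. m' j \<noteq> 0} \<subset> {j \<in> ?D. m j \<noteq> 0}" using i by (auto simp: m'_def)
    then have card: "card {j \<in> ?D. m' j \<noteq> 0} < card {j \<in> ?D. m j \<noteq> 0}"
      by (intro psubset_card_mono) auto
    have wt: "(\<Sum>j\<in>?D. m j) = (\<Sum>j\<in>?D. m' j) + k"
      using i by (simp add: sum.remove[of ?D i] m'_def k_def)
    have wt_upd: "(\<Sum>j\<in>?D. (m'(l := m' l + k)) j) = (\<Sum>j\<in>?D. m' j) + k" if "l \<in> ?D" for l
      using that by (simp add: sum.remove[of ?D l])
    have f1: "psum_form N (\<Sum>j\<in>?D. m j) (\<lambda>y. (\<Sum>j\<in>?D. y j ^ k) * sym_monomial ?D m' y)"
    proof -
      note f = less[OF card]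
      have "psum_form N (\<Sum>j\<in>?D. m j) (\<lambda>y. psum N k y * sym_monomial ?D m' y
          - y 0 ^ k * sym_monomial ?D m' y - y 1 ^ k * sym_monomial ?D m' y)"
        unfolding wt using i(2)
        by (intro psum_form_diff psum_form.psum psum_form_power f) (simp add: k_def)
      moreover have "(\<Sum>j\<in>?D. y j ^ k) = psum N k y - y 0 ^ k - y 1 ^ k" for y
      proof -
        have "{..<N} = insert 0 (insert 1 ?D)" using N by auto
        then show ?thesis by (simp add: psum_def)
      qed
      ultimately show ?thesis by (simp only: left_diff_distrib)
    qed
    have f2: "psum_form N (\<Sum>j\<in>?D. m j) (sym_monomial ?D (m'(l := m' l + k)))" if "l \<in> ?D - Z" for l
    proof -
      have "{j \<in> ?D. (m'(l := m' l + k)) j \<noteq> 0} = {j \<in> ?D. m' j \<noteq> 0}" using that by (auto simp: Z_def)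
      then have "card {j \<in> ?D. (m'(l := m' l + k)) j \<noteq> 0} < card {j \<in> ?D. m j \<noteq> 0}" using card by simp
      moreover have "l \<in> ?D" using that by simp
      ultimately show ?thesis using less[of "m'(l := m' l + k)"] by (simp only: wt wt_upd)
    qed
    \<comment> \<open>For l outside the support of m', placing the exponent k at l instead of i
      changes m only by the transposition of i and l.\<close>
    have sym: "sym_monomial ?D (m'(l := m' l + k)) y = sym_monomial ?D m y" if "l \<in> Z" for l y
    proof -
      have "m'(l := m' l + k) = m \<circ> transpose i l"
        using that by (auto simp: fun_eq_iff m'_def Z_def k_def transpose_def)
      moreover have "transpose i l permutes ?D" using that i by (intro permutes_swap_id) (auto simp: Z_def)
      ultimately show ?thesis by (simp add: sym_monomial_permute)
    qed
    have "of_nat (card Z) * sym_monomial ?D m y =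
      (\<Sum>j\<in>?D. y j ^ k) * sym_monomial ?D m' y - (\<Sum>l\<in>?D - Z. sym_monomial ?D (m'(l := m' l + k)) y)" for y
    proof -
      have "(\<Sum>l\<in>?D. sym_monomial ?D (m'(l := m' l + k)) y)
          = (\<Sum>l\<in>?D - Z. sym_monomial ?D (m'(l := m' l + k)) y) + (\<Sum>l\<in>Z. sym_monomial ?D (m'(l := m' l + k)) y)"
        by (rule sum.subset_diff) (auto simp: Z_def)
      also have "(\<Sum>l\<in>Z. sym_monomial ?D (m'(l := m' l + k)) y) = of_nat (card Z) * sym_monomial ?D m y"
        by (simp add: sym)
      finally show ?thesis unfolding sym_monomial_psum[OF finite_atLeastLessThan] by (simp del: fun_upd_apply)
    qed
    moreover have "card Z \<noteq> 0" using iZ by (auto simp: Z_def)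
    ultimately have eq: "sym_monomial ?D m = (\<lambda>y. (1 / of_nat (card Z)) *
      ((\<Sum>j\<in>?D. y j ^ k) * sym_monomial ?D m' y - (\<Sum>l\<in>?D - Z. sym_monomial ?D (m'(l := m' l + k)) y)))"
      by (simp add: fun_eq_iff field_simps)
    show ?thesis
      by (subst eq) (intro psum_form.scale psum_form_diff f1 psum_form_sum f2)
  qed
qed

text \<open>The general form of weight \<open>e \<le> 4\<close> in the marked coordinates \<open>t, u\<close> and the power sums \<open>p, q, r\<close> of
  weights \<open>2, 3, 4\<close>, the first power sum being zero.\<close>

fun wt_form :: "nat \<Rightarrow> (nat \<Rightarrow> complex) \<Rightarrow> complex \<Rightarrow> complex \<Rightarrow> complex \<Rightarrow> complex \<Rightarrow> complex \<Rightarrow> complex" where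
  "wt_form e c t u p q r =
    (if e = 0 then c 0
     else if e = 1 then c 0 * t + c 1 * u
     else if e = 2 then c 0 * t^2 + c 1 * t * u + c 2 * u^2 + c 3 * p
     else if e = 3 then c 0 * t^3 + c 1 * t^2 * u + c 2 * t * u^2 + c 3 * u^3 + p * (c 4 * t + c 5 * u) + c 6 * q
     else c 0 * t^4 + c 1 * t^3 * u + c 2 * t^2 * u^2 + c 3 * t * u^3 + c 4 * u^4
       + p * (c 5 * t^2 + c 6 * t * u + c 7 * u^2) + q * (c 8 * t + c 9 * u) + c 10 * r + c 11 * p^2)"

lemma wt_form_linear:
  "wt_form e (\<lambda>i. a * c i + d i) t u p q r = a * wt_form e c t u p q r + wt_form e d t u p q r"
  by (simp add: algebra_simps)

lemma wt_form_zero: "wt_form e (\<lambda>i. 0) t u p q r = 0"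
  by simp

text \<open>The coefficient lists record where each monomial of weight e lands among those of weight
  e + 1.\<close>

lemma wt_form_fst:
  "e \<le> 3 \<Longrightarrow> \<exists>d. \<forall>t u p q r. t * wt_form e c t u p q r = wt_form (Suc e) d t u p q r"
proof -
  assume "e \<le> 3"
  then consider "e = 0" | "e = 1" | "e = 2" | "e = 3" by linarith
  then show ?thesis
  proof cases
    case 1 then show ?thesis by (intro exI[of _ "(!) [c 0, 0]"]) simp
  next
    case 2 then show ?thesis
      by (intro exI[of _ "(!) [c 0, c 1, 0, 0]"]) (simp add: algebra_simps power2_eq_square)
  next
    case 3 then show ?thesis
      by (intro exI[of _ "(!) [c 0, c 1, c 2, 0, c 3, 0, 0]"]) (simp add: algebra_simps power2_eq_square power3_eq_cube)
  next
    case 4 then show ?thesis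
      by (intro exI[of _ "(!) [c 0, c 1, c 2, c 3, 0, c 4, c 5, 0, c 6, 0, 0, 0]"])
        (simp add: algebra_simps power2_eq_square power3_eq_cube power4_eq_xxxx)
  qed
qed

lemma wt_form_snd:
  "e \<le> 3 \<Longrightarrow> \<exists>d. \<forall>t u p q r. u * wt_form e c t u p q r = wt_form (Suc e) d t u p q r"
proof -
  assume "e \<le> 3"
  then consider "e = 0" | "e = 1" | "e = 2" | "e = 3" by linarith
  then show ?thesis
  proof cases
    case 1 then show ?thesis by (intro exI[of _ "(!) [0, c 0]"]) simp
  next
    case 2 then show ?thesis
      by (intro exI[of _ "(!) [0, c 0, c 1, 0]"]) (simp add: algebra_simps power2_eq_square)
  next
    case 3 then show ?thesis
      by (intro exI[of _ "(!) [0, c 0, c 1, c 2, 0, c 3, 0]"]) (simp add: algebra_simps power2_eq_square power3_eq_cube)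
  next
    case 4 then show ?thesis
      by (intro exI[of _ "(!) [0, c 0, c 1, c 2, c 3, 0, c 4, c 5, 0, c 6, 0, 0]"])
        (simp add: algebra_simps power2_eq_square power3_eq_cube power4_eq_xxxx)
  qed
qed

lemma wt_form_psum:
  "e + k \<le> 4 \<Longrightarrow> 2 \<le> k \<Longrightarrow> \<exists>d. \<forall>t u p q r. (if k = 2 then p else if k = 3 then q else r) * wt_form e c t u p q r
    = wt_form (e + k) d t u p q r"
proof -
  assume "e + k \<le> 4" "2 \<le> k"
  then consider "k = 2" "e = 0" | "k = 2" "e = 1" | "k = 2" "e = 2" | "k = 3" "e = 0" | "k = 3" "e = 1" | "k = 4" "e = 0"
    by linarith
  then show ?thesis
  proof cases
    case 1 then show ?thesis by (intro exI[of _ "(!) [0, 0, 0, c 0]"]) simp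
  next
    case 2 then show ?thesis by (intro exI[of _ "(!) [0, 0, 0, 0, c 0, c 1, 0]"]) simp
  next
    case 3 then show ?thesis
      by (intro exI[of _ "(!) [0, 0, 0, 0, 0, c 0, c 1, c 2, 0, 0, 0, c 3]"]) (simp add: algebra_simps power2_eq_square)
  next
    case 4 then show ?thesis by (intro exI[of _ "(!) [0, 0, 0, 0, 0, 0, c 0]"]) simp
  next
    case 5 then show ?thesis
      by (intro exI[of _ "(!) [0, 0, 0, 0, 0, 0, 0, 0, c 0, c 1, 0, 0]"]) (simp add: algebra_simps)
  next
    case 6 then show ?thesis by (intro exI[of _ "(!) [0, 0, 0, 0, 0, 0, 0, 0, 0, 0, c 0, 0]"]) simp
  qed
qed

lemma psum_form_weighted:
  assumes "psum_form N e f"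
  shows "e \<le> 4 \<Longrightarrow> \<exists>c. \<forall>y. psum N 1 y = 0 \<longrightarrow> f y = wt_form e c (y 0) (y 1) (psum N 2 y) (psum N 3 y) (psum N 4 y)"
  using assms
proof (induction rule: psum_form.induct)
  case (const c)
  show ?case by (intro exI[of _ "\<lambda>_. c"]) simp
next
  case (fst e f)
  then obtain c where c: "\<And>y. psum N 1 y = 0 \<Longrightarrow> f y = wt_form e c (y 0) (y 1) (psum N 2 y) (psum N 3 y) (psum N 4 y)"
    by fastforce
  obtain d where "\<forall>t u p q r. t * wt_form e c t u p q r = wt_form (Suc e) d t u p q r"
    using wt_form_fst[of e c] fst.prems by auto
  then show ?case using c by (intro exI[of _ d]) (simp del: wt_form.simps)
next
  case (snd e f)
  then obtain c where c: "\<And>y. psum N 1 y = 0 \<Longrightarrow> f y = wt_form e c (y 0) (y 1) (psum N 2 y) (psum N 3 y) (psum N 4 y)"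
    by fastforce
  obtain d where "\<forall>t u p q r. u * wt_form e c t u p q r = wt_form (Suc e) d t u p q r"
    using wt_form_snd[of e c] snd.prems by auto
  then show ?case using c by (intro exI[of _ d]) (simp del: wt_form.simps)
next
  case (psum e f k)
  then obtain c where c: "\<And>y. psum N 1 y = 0 \<Longrightarrow> f y = wt_form e c (y 0) (y 1) (psum N 2 y) (psum N 3 y) (psum N 4 y)"
    by fastforce
  show ?case
  proof (cases "k = 1")
    \<comment> \<open>The first power sum vanishes on the hyperplane considered, so zero
      coefficients serve.\<close>
    case True
    then show ?thesis by (intro exI[of _ "\<lambda>i. 0"]) (simp only: wt_form_zero, simp)
  next
    case False
    then have k: "2 \<le> k" "e + k \<le> 4" "k = 2 \<or> k = 3 \<or> k = 4" using psum by auto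
    obtain d where "\<forall>t u p q r. (if k = 2 then p else if k = 3 then q else r) * wt_form e c t u p q r
        = wt_form (e + k) d t u p q r"
      using wt_form_psum[OF k(2,1), of c] by blast
    moreover have "psum N k y = (if k = 2 then psum N 2 y else if k = 3 then psum N 3 y else psum N 4 y)" for y
      using k(3) by auto
    ultimately show ?thesis using c by (intro exI[of _ d]) (simp del: wt_form.simps)
  qed
next
  case (add e f g)
  then obtain c d where
    "\<And>y. psum N 1 y = 0 \<Longrightarrow> f y = wt_form e c (y 0) (y 1) (psum N 2 y) (psum N 3 y) (psum N 4 y)"
    "\<And>y. psum N 1 y = 0 \<Longrightarrow> g y = wt_form e d (y 0) (y 1) (psum N 2 y) (psum N 3 y) (psum N 4 y)"
    by blast
  then show ?case by (intro exI[of _ "\<lambda>i. 1 * c i + d i"]) (simp only: wt_form_linear, simp)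
next
  case (scale e f a)
  then obtain c where
    "\<And>y. psum N 1 y = 0 \<Longrightarrow> f y = wt_form e c (y 0) (y 1) (psum N 2 y) (psum N 3 y) (psum N 4 y)"
    by blast
  then show ?case by (intro exI[of _ "\<lambda>i. a * c i + 0"]) (simp only: wt_form_linear wt_form_zero, simp)
qed

subsection \<open>The quartic part\<close>

lemma split_three:
  assumes "finite D" "card D = a + b + c"
  shows "\<exists>A B C. A \<union> B \<union> C = D \<and> A \<inter> B = {} \<and> A \<inter> C = {} \<and> B \<inter> C = {} \<and> card A = a \<and> card B = b \<and> card C = c"
proof -
  obtain A where A: "A \<subseteq> D" "card A = a" using obtain_subset_with_card_n[of a D] assms by auto
  have "card (D - A) = b + c" using A assms by (simp add: card_Diff_subset finite_subset)
  then obtain B where B: "B \<subseteq> D - A" "card B = b" using obtain_subset_with_card_n[of b "D - A"] by auto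
  have "card (D - A - B) = card (D - A) - card B"
    by (rule card_Diff_subset) (use B assms(1) finite_subset in blast)+
  then have "card (D - A - B) = c" using B \<open>card (D - A) = b + c\<close> by simp
  then show ?thesis using A B by (intro exI[of _ A] exI[of _ B] exI[of _ "D - A - B"]) auto
qed

lemma plane_with_marks:
  assumes "0 < b" "0 < c"
  shows "\<exists>A B C. plane b c A B C \<and> 0 \<in> B \<and> 1 \<in> C" "\<exists>A B C. plane b c A B C \<and> 1 \<in> B \<and> 0 \<in> C"
    "\<exists>A B C. plane b c A B C \<and> 0 \<in> A \<and> 1 \<in> B" "\<exists>A B C. plane b c A B C \<and> 1 \<in> A \<and> 0 \<in> B"
proof -
  let ?N = "{..<2 * (b + c)}" and ?D = "{2..<2 * (b + c)}"
  have N: "?N = insert 0 (insert 1 ?D)" using assms by auto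
  have fin: "finite X" if "X \<subseteq> ?D" for X using that finite_subset by blast
  obtain A B C where 1: "A \<union> B \<union> C = ?D" "A \<inter> B = {}" "A \<inter> C = {}" "B \<inter> C = {}"
    "card A = b + c" "card B = b - 1" "card C = c - 1"
  proof -
    have "card ?D = (b + c) + (b - 1) + (c - 1)" using assms by simp
    from split_three[OF finite_atLeastLessThan this] show thesis using that by (elim exE conjE)
  qed
  have sub: "A \<subseteq> ?D" "B \<subseteq> ?D" "C \<subseteq> ?D" using 1 by auto
  have not: "0 \<notin> A" "0 \<notin> B" "0 \<notin> C" "1 \<notin> A" "1 \<notin> B" "1 \<notin> C" using sub by auto
  have "plane b c A (insert 0 B) (insert 1 C)" "plane b c A (insert 1 B) (insert 0 C)"
    unfolding plane_def N using 1 not fin[OF sub(1)] fin[OF sub(2)] fin[OF sub(3)] assms by auto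
  then show "\<exists>A B C. plane b c A B C \<and> 0 \<in> B \<and> 1 \<in> C" "\<exists>A B C. plane b c A B C \<and> 1 \<in> B \<and> 0 \<in> C"
    by blast+
  obtain A B C where 2: "A \<union> B \<union> C = ?D" "A \<inter> B = {}" "A \<inter> C = {}" "B \<inter> C = {}"
    "card A = b + c - 1" "card B = b - 1" "card C = c"
  proof -
    have "card ?D = (b + c - 1) + (b - 1) + c" using assms by simp
    from split_three[OF finite_atLeastLessThan this] show thesis using that by (elim exE conjE)
  qed
  have sub: "A \<subseteq> ?D" "B \<subseteq> ?D" "C \<subseteq> ?D" using 2 by auto
  have not: "0 \<notin> A" "0 \<notin> B" "0 \<notin> C" "1 \<notin> A" "1 \<notin> B" "1 \<notin> C" using sub by auto
  have "plane b c (insert 0 A) (insert 1 B) C" "plane b c (insert 1 A) (insert 0 B) C"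
    unfolding plane_def N using 2 not fin[OF sub(1)] fin[OF sub(2)] fin[OF sub(3)] assms by auto
  then show "\<exists>A B C. plane b c A B C \<and> 0 \<in> A \<and> 1 \<in> B" "\<exists>A B C. plane b c A B C \<and> 1 \<in> A \<and> 0 \<in> B"
    by blast+
qed

lemma plane_image:
  assumes "plane b c A B C" "\<sigma> permutes {..<2 * (b + c)}"
  shows "plane b c (\<sigma> ` A) (\<sigma> ` B) (\<sigma> ` C)"
proof -
  have inj: "inj \<sigma>" by (rule permutes_inj[OF assms(2)])
  have "\<sigma> ` A \<union> \<sigma> ` B \<union> \<sigma> ` C = \<sigma> ` {..<2 * (b + c)}"
    using assms(1) unfolding plane_def by (metis image_Un)
  then have "\<sigma> ` A \<union> \<sigma> ` B \<union> \<sigma> ` C = {..<2 * (b + c)}"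
    using permutes_image[OF assms(2)] by simp
  moreover have "card (\<sigma> ` S) = card S" for S
    by (rule card_image) (use inj inj_on_subset in blast)
  moreover have "\<sigma> ` S \<inter> \<sigma> ` S' = {}" if "S \<inter> S' = {}" for S S'
    using that image_Int[OF inj, of S S'] by simp
  ultimately show ?thesis using assms(1) unfolding plane_def by (elim conjE, intro conjI) metis+
qed

text \<open>Symmetrizing over the permutations that fix the marks leaves a form W(t, u) in the marks
  and the power sums, and only four coefficients remain in W(t, u) - W(u, t). The vanishing for
  marks in B and C, tested at points with first power sum 0, kills these, against the nonzero value
  for marks in A and B.\<close>

lemma no_quartic_form:
  fixes E :: "'k \<Rightarrow> nat \<Rightarrow> nat" and F :: "'k \<Rightarrow> complex"
  assumes bc: "b \<noteq> c" "0 < b" "0 < c" and \<kappa>: "\<kappa> \<noteq> 0"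
    and deg: "\<And>k. k \<in> K \<Longrightarrow> (\<Sum>i<2 * (b + c). E k i) = 4"
    and eq: "\<And>A B C X Y Z y. plane b c A B C \<Longrightarrow> on_plane y A B C X Y Z \<Longrightarrow> X \<noteq> Y \<Longrightarrow> X \<noteq> Z \<Longrightarrow> Y \<noteq> Z \<Longrightarrow>
      (\<Sum>k\<in>K. F k * (\<Prod>i<2 * (b + c). y i ^ E k i)) = \<kappa> * plane_val b c A B C X Y Z"
  shows False
proof -
  define N where "N = 2 * (b + c)"
  let ?D = "{2..<N}"
  have N2: "2 \<le> N" using bc by (simp add: N_def)
  have NI: "{..<N} = insert 0 (insert 1 ?D)" using N2 by auto
  \<comment> \<open>Permutations fixing the marks carry planes to planes without changing
    \<open>plane_val\<close>, so on a plane \<Psi> is the given sum times their number.\<close>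
  define \<Psi> where "\<Psi> y = (\<Sum>k\<in>K. F k * (y 0 ^ E k 0 * (y 1 ^ E k 1 * sym_monomial ?D (E k) y)))" for y
  have "psum_form N 4 \<Psi>"
    unfolding \<Psi>_def[abs_def]
  proof (rule psum_form_sum, rule psum_form.scale)
    fix k assume "k \<in> K"
    then have "(\<Sum>i\<in>?D. E k i) + E k 1 + E k 0 = 4" using deg[of k] unfolding N_def[symmetric] NI by simp
    then show "psum_form N 4 (\<lambda>y. y 0 ^ E k 0 * (y 1 ^ E k 1 * sym_monomial ?D (E k) y))"
      using psum_form_power(1)[OF psum_form_power(2)[OF psum_form_sym_monomial[OF N2, of "E k"], of "E k 1"], of "E k 0"]
      by (simp only:)
  qed
  then obtain c' where c': "\<And>y. psum N 1 y = 0 \<Longrightarrow>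
    \<Psi> y = wt_form 4 c' (y 0) (y 1) (psum N 2 y) (psum N 3 y) (psum N 4 y)"
    using psum_form_weighted by blast
  define \<kappa>' where "\<kappa>' = of_nat (card {\<sigma>. \<sigma> permutes ?D}) * \<kappa>"
  have "card {\<sigma>. \<sigma> permutes ?D} \<noteq> 0" by (simp add: card_permutations)
  then have \<kappa>': "\<kappa>' \<noteq> 0" using \<kappa> by (simp add: \<kappa>'_def)
  have \<Psi>_val: "\<Psi> y = \<kappa>' * plane_val b c A B C X Y Z"
    if pl: "plane b c A B C" "on_plane y A B C X Y Z" and dist: "X \<noteq> Y" "X \<noteq> Z" "Y \<noteq> Z" for A B C X Y Z y
  proof -
    have val: "(\<Sum>k\<in>K. F k * (\<Prod>i<N. y (\<sigma> i) ^ E k i)) = \<kappa> * plane_val b c A B C X Y Z" if \<sigma>: "\<sigma> permutes ?D" for \<sigma>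
    proof -
      have \<sigma>N: "\<sigma> permutes {..<2 * (b + c)}" by (rule permutes_subset[OF \<sigma>]) (auto simp: N_def)
      let ?\<tau> = "inv \<sigma>"
      have inv: "\<sigma> (?\<tau> i) = i" for i using permutes_inverses(1)[OF \<sigma>] .
      have fix01: "?\<tau> 0 = 0" "?\<tau> 1 = 1" using permutes_not_in[OF permutes_inv[OF \<sigma>]] by auto
      have mem: "?\<tau> i \<in> ?\<tau> ` S \<longleftrightarrow> i \<in> S" for i S
        using permutes_inj[OF permutes_inv[OF \<sigma>]] by (simp add: inj_image_mem_iff)
      have "on_plane (\<lambda>i. y (\<sigma> i)) (?\<tau> ` A) (?\<tau> ` B) (?\<tau> ` C) X Y Z"
        using pl(2) unfolding on_plane_def by (simp add: inv)
      from eq[OF plane_image[OF pl(1) permutes_inv[OF \<sigma>N]] this dist]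
      have "(\<Sum>k\<in>K. F k * (\<Prod>i<N. y (\<sigma> i) ^ E k i)) = \<kappa> * plane_val b c (?\<tau> ` A) (?\<tau> ` B) (?\<tau> ` C) X Y Z"
        by (simp only: N_def)
      moreover have "plane_val b c (?\<tau> ` A) (?\<tau> ` B) (?\<tau> ` C) X Y Z = plane_val b c A B C X Y Z"
        using mem[of 0] mem[of 1] unfolding fix01 plane_val_def Let_def by simp
      ultimately show ?thesis by simp
    qed
    have split: "(\<Prod>i<N. y (\<sigma> i) ^ E k i) = y 0 ^ E k 0 * (y 1 ^ E k 1 * (\<Prod>i\<in>?D. y (\<sigma> i) ^ E k i))"
      if "\<sigma> permutes ?D" for \<sigma> k
      using permutes_not_in[OF that, of 0] permutes_not_in[OF that, of 1] unfolding NI by simp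
    have "\<Psi> y = (\<Sum>k\<in>K. \<Sum>\<sigma> | \<sigma> permutes ?D. F k * (\<Prod>i<N. y (\<sigma> i) ^ E k i))"
      unfolding \<Psi>_def sym_monomial_def sum_distrib_left
      by (intro sum.cong refl) (simp add: split)
    also have "\<dots> = (\<Sum>\<sigma> | \<sigma> permutes ?D. \<Sum>k\<in>K. F k * (\<Prod>i<N. y (\<sigma> i) ^ E k i))" by (rule sum.swap)
    also have "\<dots> = (\<Sum>\<sigma> | \<sigma> permutes ?D. \<kappa> * plane_val b c A B C X Y Z)"
      by (intro sum.cong refl val) simp
    finally show ?thesis by (simp add: \<kappa>'_def)
  qed
  define \<beta> \<gamma> \<alpha> :: complex where "\<beta> = of_nat b" and "\<gamma> = of_nat c" and "\<alpha> = \<beta> + \<gamma>"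
  define P where "P k X Y Z = \<alpha> * X ^ k + \<beta> * Y ^ k + \<gamma> * Z ^ k" for k X Y Z
  define W where "W t u X Y Z = wt_form 4 c' t u (P 2 X Y Z) (P 3 X Y Z) (P 4 X Y Z)" for t u X Y Z
  have W: "W (if 0 \<in> A then X else if 0 \<in> B then Y else Z) (if 1 \<in> A then X else if 1 \<in> B then Y else Z) X Y Z
      = \<kappa>' * plane_val b c A B C X Y Z"
    if pl: "plane b c A B C" and dist: "X \<noteq> Y" "X \<noteq> Z" "Y \<noteq> Z" and P1: "P 1 X Y Z = 0" for A B C X Y Z
  proof -
    define y where "y i = (if i \<in> A then X else if i \<in> B then Y else Z)" for i
    have on: "on_plane y A B C X Y Z" using pl unfolding on_plane_def plane_def y_def by auto
    have fin: "finite A" "finite B" "finite C" using plane_finite[OF pl] by auto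
    have un: "{..<N} = A \<union> B \<union> C" "A \<inter> B = {}" "(A \<union> B) \<inter> C = {}" using pl unfolding plane_def N_def by auto
    have ps: "psum N k y = P k X Y Z" for k
      using plane_sums[OF pl on, of k] fin un(2,3)
      by (simp add: psum_def un(1) sum.union_disjoint P_def \<alpha>_def \<beta>_def \<gamma>_def)
    show ?thesis
      using c'[of y] \<Psi>_val[OF pl on dist] P1 unfolding ps W_def by (simp only: y_def)
  qed
  have BC: "W Y Z X Y Z = 0" "W Z Y X Y Z = 0" and AB: "W X Y X Y Z = \<kappa>' * ((X - Y) * (X - Z) * (Y - Z) * (- \<gamma> * (X - Z)))"
    "W Y X X Y Z = - (\<kappa>' * ((X - Y) * (X - Z) * (Y - Z) * (- \<gamma> * (X - Z))))"
    if dist: "X \<noteq> Y" "X \<noteq> Z" "Y \<noteq> Z" and P1: "P 1 X Y Z = 0" for X Y Z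
  proof -
    obtain A B C where pl: "plane b c A B C" "0 \<in> B" "1 \<in> C" using plane_with_marks(1) bc by blast
    then have "0 \<notin> A" "1 \<notin> A" "1 \<notin> B" by (auto simp: plane_def)
    then show "W Y Z X Y Z = 0" using W[OF pl(1) dist P1] pl by (simp add: plane_val_def)
    obtain A B C where pl: "plane b c A B C" "1 \<in> B" "0 \<in> C" using plane_with_marks(2) bc by blast
    then have "0 \<notin> A" "1 \<notin> A" "0 \<notin> B" by (auto simp: plane_def)
    then show "W Z Y X Y Z = 0" using W[OF pl(1) dist P1] pl by (simp add: plane_val_def)
    obtain A B C where pl: "plane b c A B C" "0 \<in> A" "1 \<in> B" using plane_with_marks(3) bc by blast
    then have "1 \<notin> A" "1 \<notin> C" by (auto simp: plane_def)
    then show "W X Y X Y Z = \<kappa>' * ((X - Y) * (X - Z) * (Y - Z) * (- \<gamma> * (X - Z)))"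
      using W[OF pl(1) dist P1] pl by (simp add: plane_val_def \<gamma>_def)
    obtain A B C where pl: "plane b c A B C" "1 \<in> A" "0 \<in> B" using plane_with_marks(4) bc by blast
    then have "0 \<notin> A" "0 \<notin> C" by (auto simp: plane_def)
    then show "W Y X X Y Z = - (\<kappa>' * ((X - Y) * (X - Z) * (Y - Z) * (- \<gamma> * (X - Z))))"
      using W[OF pl(1) dist P1] pl by (simp add: plane_val_def \<gamma>_def)
  qed
  define d0 d1 d2 d3 where "d0 = c' 0 - c' 4" and "d1 = c' 1 - c' 3" and "d2 = c' 5 - c' 7" and "d3 = c' 8 - c' 9"
  have diff: "W t u X Y Z - W u t X Y Z
      = d0 * (t ^ 4 - u ^ 4) + d1 * (t ^ 3 * u - t * u ^ 3) + P 2 X Y Z * d2 * (t\<^sup>2 - u\<^sup>2) + P 3 X Y Z * d3 * (t - u)"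
    for t u X Y Z
    by (simp add: W_def d0_def d1_def d2_def d3_def algebra_simps)
  have nz: "of_nat k * \<beta> + of_nat l * \<gamma> \<noteq> 0" if "0 < k \<or> 0 < l" for k l
  proof -
    have "k * b + l * c \<noteq> 0" using that bc by auto
    then have "of_nat (k * b + l * c) \<noteq> (0::complex)" by (simp only: of_nat_eq_0_iff not_False_eq_True)
    then show ?thesis by (simp add: \<beta>_def \<gamma>_def)
  qed
  have \<beta>\<gamma>: "\<beta> \<noteq> 0" "\<gamma> \<noteq> 0" "\<beta> - \<gamma> \<noteq> 0" using bc by (auto simp: \<beta>_def \<gamma>_def)
  have \<alpha>: "\<alpha> \<noteq> 0" using nz[of 1 1] by (simp add: \<alpha>_def)
  have eq0: "d0 * (Y ^ 4 - Z ^ 4) + d1 * (Y ^ 3 * Z - Y * Z ^ 3) + P 2 X Y Z * d2 * (Y\<^sup>2 - Z\<^sup>2) + P 3 X Y Z * d3 * (Y - Z) = 0"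
    if "X \<noteq> Y" "X \<noteq> Z" "Y \<noteq> Z" "P 1 X Y Z = 0" for X Y Z
    using diff[of Y Z X Y Z] BC[OF that] by simp
  \<comment> \<open>For Z = - Y the terms with d0, d1, d2 vanish and d3 is left alone; X is dictated
    by the first power sum.\<close>
  have dist1: "\<gamma> - \<beta> \<noteq> \<alpha>" "\<gamma> - \<beta> \<noteq> - \<alpha>" "\<alpha> \<noteq> - \<alpha>" "P 1 (\<gamma> - \<beta>) \<alpha> (- \<alpha>) = 0"
    using \<beta>\<gamma> \<alpha> nz[of 2 2] by (auto simp: \<alpha>_def P_def algebra_simps)
  have P3: "P 3 (\<gamma> - \<beta>) \<alpha> (- \<alpha>) = 4 * \<alpha> * (\<beta> - \<gamma>) * \<beta> * \<gamma>"
    by (simp add: P_def \<alpha>_def power3_eq_cube algebra_simps)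
  have d3: "d3 = 0" using eq0[OF dist1] \<beta>\<gamma> \<alpha> unfolding P3 by (simp add: power4_eq_xxxx power3_eq_cube)
  \<comment> \<open>A zero among Y, Z removes the d1 term. Exchanging the roles of B and C gives a
    second equation for d0 and d2, independent of the first since b \<noteq> c.\<close>
  have dist2: "- \<beta> \<noteq> \<alpha>" "- \<beta> \<noteq> 0" "\<alpha> \<noteq> 0" "P 1 (- \<beta>) \<alpha> 0 = 0"
    using \<beta>\<gamma> \<alpha> nz[of 2 1] by (auto simp: P_def \<alpha>_def add_eq_0_iff2 algebra_simps)
  have dist3: "- \<gamma> \<noteq> 0" "- \<gamma> \<noteq> \<alpha>" "0 \<noteq> \<alpha>" "P 1 (- \<gamma>) 0 \<alpha> = 0"
    using \<beta>\<gamma> \<alpha> nz[of 1 2] by (auto simp: P_def \<alpha>_def add_eq_0_iff2 algebra_simps)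
  have e2: "d0 * \<alpha> ^ 4 + \<alpha> * \<beta> * (\<alpha> + \<beta>) * d2 * \<alpha>\<^sup>2 = 0"
    using eq0[OF dist2] d3 by (simp add: P_def power2_eq_square algebra_simps)
  have e3: "d0 * \<alpha> ^ 4 + \<alpha> * \<gamma> * (\<alpha> + \<gamma>) * d2 * \<alpha>\<^sup>2 = 0"
    using eq0[OF dist3] d3 by (simp add: P_def power2_eq_square algebra_simps add_eq_0_iff)
  have "\<alpha> ^ 3 * (\<beta> - \<gamma>) * (\<alpha> + \<beta> + \<gamma>) * d2 = (d0 * \<alpha> ^ 4 + \<alpha> * \<beta> * (\<alpha> + \<beta>) * d2 * \<alpha>\<^sup>2)
      - (d0 * \<alpha> ^ 4 + \<alpha> * \<gamma> * (\<alpha> + \<gamma>) * d2 * \<alpha>\<^sup>2)"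
    by (simp add: power3_eq_cube power2_eq_square algebra_simps)
  moreover have "\<alpha> + \<beta> + \<gamma> \<noteq> 0" using nz[of 2 2] by (simp add: \<alpha>_def algebra_simps)
  ultimately have d2: "d2 = 0" using e2 e3 \<alpha> \<beta>\<gamma> by simp
  then have d0: "d0 = 0" using e2 \<alpha> by simp
  \<comment> \<open>A point with Y Z (Y^2 - Z^2) \<noteq> 0 detects d1; here this factor is 6
    \<alpha>^4.\<close>
  have "- (2 * \<beta> + \<gamma>) \<noteq> 2 * \<alpha>" "- (2 * \<beta> + \<gamma>) \<noteq> \<alpha>" "2 * \<alpha> \<noteq> \<alpha>" "P 1 (- (2 * \<beta> + \<gamma>)) (2 * \<alpha>) \<alpha> = 0"
    using \<alpha> nz[of 4 3] nz[of 3 2] by (auto simp: P_def \<alpha>_def algebra_simps minus_equation_iff neg_eq_iff_add_eq_0)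
  from eq0[OF this] have "d1 * (6 * \<alpha> ^ 4) = 0"
    using d0 d2 d3 by (simp add: power4_eq_xxxx power3_eq_cube algebra_simps)
  then have d1: "d1 = 0" using \<alpha> by simp
  \<comment> \<open>The point used for d3 again, now with the marks in A and B, where the difference
    is twice a nonzero value.\<close>
  have "W (\<gamma> - \<beta>) \<alpha> (\<gamma> - \<beta>) \<alpha> (- \<alpha>) - W \<alpha> (\<gamma> - \<beta>) (\<gamma> - \<beta>) \<alpha> (- \<alpha>) = 0"
    unfolding diff d0 d1 d2 d3 by simp
  moreover have "\<gamma> - \<beta> + \<alpha> \<noteq> 0" using \<beta>\<gamma> by (simp add: \<alpha>_def)
  ultimately show False
    using AB[OF dist1] \<kappa>' \<beta>\<gamma> dist1 by simp
qed

text \<open>Freeze the coordinates outside the merged block at u and scale the others by t. As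
  \<open>plane_val\<close> has degree 4, comparing coefficients of t^4 picks out the part of p of
  degree 4 in the first coordinates on one side and only the value of Q at t = 0 on the other; that
  value is \<kappa> in \<open>no_quartic_form\<close>.\<close>

lemma plane_fun_not_polynomial:
  assumes bc: "b \<noteq> c" "0 < b" "0 < c"
    and Q: "polyfun n Q" "Q (\<lambda>i. if i < 2 * (b + c) then 0 else u i) \<noteq> 0"
    and p: "\<And>A B C X Y Z y t. plane b c A B C \<Longrightarrow> on_plane y A B C X Y Z \<Longrightarrow> X \<noteq> Y \<Longrightarrow> X \<noteq> Z \<Longrightarrow> Y \<noteq> Z \<Longrightarrow> t \<noteq> 0 \<Longrightarrow>
      peval p (\<lambda>i. if i < 2 * (b + c) then t * y i else u i)
      = Q (\<lambda>i. if i < 2 * (b + c) then t * y i else u i) * plane_fun b c (\<lambda>i. if i < 2 * (b + c) then t * y i else u i)"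
  shows False
proof -
  define N where "N = 2 * (b + c)"
  let ?w = "\<lambda>t y i. if i < N then t * y i else u i"
  define dg where "dg m = (\<Sum>i<N. lkp m i)" for m :: "nat \<Rightarrow>\<^sub>0 nat"
  define G where "G m = lkp p m * (\<Prod>i\<in>supp m - {..<N}. u i ^ lkp m i)" for m
  define K where "K = {m \<in> supp p. dg m = 4}"
  define \<kappa> where "\<kappa> = Q (\<lambda>i. if i < N then 0 else u i)"
  have \<kappa>: "\<kappa> \<noteq> 0" using Q(2) by (simp add: \<kappa>_def N_def)
  have ev: "peval p (?w t y) = (\<Sum>m\<in>supp p. t ^ dg m * (G m * (\<Prod>i<N. y i ^ lkp m i)))" for t y
  proof -
    have "mon_eval m (?w t y) = t ^ dg m * ((\<Prod>i\<in>supp m - {..<N}. u i ^ lkp m i) * (\<Prod>i<N. y i ^ lkp m i))" for m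
    proof -
      have K: "supp m \<union> {..<N} = (supp m - {..<N}) \<union> {..<N}" by auto
      have "mon_eval m (?w t y) = (\<Prod>i\<in>supp m \<union> {..<N}. ?w t y i ^ lkp m i)"
        by (rule mon_eval_superset) auto
      also have "\<dots> = (\<Prod>i\<in>supp m - {..<N}. ?w t y i ^ lkp m i) * (\<Prod>i<N. ?w t y i ^ lkp m i)"
        unfolding K by (rule prod.union_disjoint) auto
      also have "(\<Prod>i\<in>supp m - {..<N}. ?w t y i ^ lkp m i) = (\<Prod>i\<in>supp m - {..<N}. u i ^ lkp m i)"
        by (intro prod.cong) auto
      also have "(\<Prod>i<N. ?w t y i ^ lkp m i) = t ^ dg m * (\<Prod>i<N. y i ^ lkp m i)"
        by (simp add: power_mult_distrib prod.distrib dg_def power_sum)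
      finally show ?thesis by (simp add: mult_ac)
    qed
    then show ?thesis unfolding peval_mon_eval by (intro sum.cong) (simp_all add: G_def mult_ac)
  qed
  have "(\<Sum>m\<in>K. G m * (\<Prod>i<N. y i ^ lkp m i)) = \<kappa> * plane_val b c A B C X Y Z"
    if pl: "plane b c A B C" "on_plane y A B C X Y Z" and dist: "X \<noteq> Y" "X \<noteq> Z" "Y \<noteq> Z" for A B C X Y Z y
  proof -
    let ?v = "plane_val b c A B C X Y Z"
    obtain q where q: "q \<in> polys n" "\<And>x. Q x = peval q x" using Q(1) unfolding polyfun_def by blast
    obtain r where r: "\<And>t. poly r t = peval q (\<lambda>i. (if i < N then 0 else u i) + t * (if i < N then y i else 0))"
      using peval_on_line[of q "\<lambda>i. if i < N then 0 else u i" "\<lambda>i. if i < N then y i else 0"] by blast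
    have line: "(\<lambda>i. (if i < N then 0 else u i) + t * (if i < N then y i else 0)) = ?w t y" for t
      by auto
    define l where "l = (\<Sum>m\<in>supp p. monom (G m * (\<Prod>i<N. y i ^ lkp m i)) (dg m))"
    have "l = monom ?v 4 * r"
    proof (rule poly_eq_nonzero)
      fix t :: complex assume t: "t \<noteq> 0"
      have sub: "A \<subseteq> {..<N}" "B \<subseteq> {..<N}" "C \<subseteq> {..<N}" using plane_subset[OF pl(1)] by (auto simp: N_def)
      have "on_plane (?w t y) A B C (t * X) (t * Y) (t * Z)"
        using pl(2) sub unfolding on_plane_def by auto
      then have "plane_fun b c (?w t y) = t ^ 4 * ?v" using plane_fun_eq[OF pl(1) _ bc] plane_val_scale by simp
      moreover have "poly l t = peval p (?w t y)"
        unfolding ev l_def by (simp add: poly_sum poly_monom mult.commute)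
      moreover have "poly r t = Q (?w t y)" unfolding r line q(2) ..
      ultimately show "poly l t = poly (monom ?v 4 * r) t"
        using p[OF pl dist t] by (simp add: N_def poly_monom)
    qed
    then have "coeff l 4 = ?v * coeff r 0" by (simp add: coeff_monom_mult)
    moreover have "coeff r 0 = \<kappa>"
      using r[of 0] q(2) by (simp add: poly_0_coeff_0 \<kappa>_def)
    moreover have "coeff l 4 = (\<Sum>m\<in>K. G m * (\<Prod>i<N. y i ^ lkp m i))"
      unfolding l_def K_def coeff_sum by (simp add: sum.inter_filter)
    ultimately show ?thesis by simp
  qed
  then show False
    by (intro no_quartic_form[OF bc \<kappa>, of K lkp G]) (auto simp: K_def dg_def N_def)
qed

section \<open>Reduction to the stratum of the merged block\<close>

text \<open>\<pi> sends each part of the fine partition to the coarse part containing it. A coarse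
  part c holds exactly one c, which leaves a single c for the indices below r; this excludes that
  several c fill a b when c divides b. A coarse part b cannot hold just one c, so the spare c lies
  in part 0, together with b + c and one b.\<close>

lemma refinement_counts:
  fixes b c r s :: nat and \<pi> :: "nat \<Rightarrow> nat"
  assumes bc: "0 < c" "c < b" "0 < r" "0 < s"
    and \<pi>: "\<And>k. k < r + s + 1 \<Longrightarrow> \<pi> k < r + s - 1"
    and eq: "\<And>l. l < r + s - 1 \<Longrightarrow> (if l = 0 then 2 * (b + c) else if l < r then b else c) =
      (if \<pi> 0 = l then b + c else 0) + card {k \<in> {1..r}. \<pi> k = l} * b + card {k \<in> {r+1..r+s}. \<pi> k = l} * c"
  shows "\<pi> 0 = 0" "card {k \<in> {1..r}. \<pi> k = 0} = 1" "card {k \<in> {r+1..r+s}. \<pi> k = 0} = 1"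
    "\<And>l. 0 < l \<Longrightarrow> l < r + s - 1 \<Longrightarrow> card {k \<in> {1..r}. \<pi> k = l} + card {k \<in> {r+1..r+s}. \<pi> k = l} = 1"
proof -
  define \<beta> \<gamma> where "\<beta> l = card {k \<in> {1..r}. \<pi> k = l}" and "\<gamma> l = card {k \<in> {r+1..r+s}. \<pi> k = l}" for l
  note eq = eq[folded \<beta>_def \<gamma>_def]
  have C: "\<pi> 0 \<noteq> l \<and> \<beta> l = 0 \<and> \<gamma> l = 1" if "r \<le> l" "l < r + s - 1" for l
  proof -
    have e: "c = (if \<pi> 0 = l then b + c else 0) + \<beta> l * b + \<gamma> l * c" using eq[of l] that bc by auto
    have "\<beta> l = 0" using e bc by (cases "\<beta> l") (auto split: if_splits)
    moreover have "\<pi> 0 \<noteq> l" using e bc by auto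
    ultimately show ?thesis using e bc by auto
  qed
  have "(\<Sum>l<r + s - 1. \<gamma> l) = (\<Sum>l<r + s - 1. \<Sum>k | k \<in> {r+1..r+s} \<and> \<pi> k = l. 1)"
    by (simp add: \<gamma>_def)
  also have "\<dots> = (\<Sum>k\<in>{r+1..r+s}. 1)"
    by (rule sum.group) (use \<pi> in auto)
  finally have tot: "(\<Sum>l<r + s - 1. \<gamma> l) = s" by simp
  have "{..<r + s - 1} = {..<r} \<union> {r..<r + s - 1}" using bc by auto
  then have "(\<Sum>l<r + s - 1. \<gamma> l) = (\<Sum>l<r. \<gamma> l) + (\<Sum>l\<in>{r..<r + s - 1}. \<gamma> l)"
    by (metis finite_atLeastLessThan finite_lessThan ivl_disj_int_one(2) sum.union_disjoint)
  also have "(\<Sum>l\<in>{r..<r + s - 1}. \<gamma> l) = (\<Sum>l\<in>{r..<r + s - 1}. 1)" using C by (intro sum.cong) auto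
  finally have small: "(\<Sum>l<r. \<gamma> l) = 1" using tot bc by simp
  have B: "\<pi> 0 \<noteq> l \<and> \<beta> l = 1 \<and> \<gamma> l = 0" if "0 < l" "l < r" for l
  proof -
    have e: "b = (if \<pi> 0 = l then b + c else 0) + \<beta> l * b + \<gamma> l * c" using eq[of l] that bc by auto
    have "\<gamma> l \<le> (\<Sum>l<r. \<gamma> l)" using that by (intro member_le_sum) auto
    then have "\<gamma> l = 0 \<or> \<gamma> l = 1" using small by auto
    moreover have "\<gamma> l \<noteq> 1" using e bc by (cases "\<beta> l") (auto split: if_splits)
    moreover have "\<pi> 0 \<noteq> l" using e bc by auto
    ultimately have "\<pi> 0 \<noteq> l" "\<gamma> l = 0" "\<beta> l * b = 1 * b" using e by auto
    moreover have "b \<noteq> 0" using bc by simp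
    ultimately show ?thesis using mult_right_cancel[of b "\<beta> l" 1] by blast
  qed
  have "{..<r} = insert 0 {1..<r}" using bc by auto
  moreover have "(\<Sum>l\<in>{1..<r}. \<gamma> l) = 0" using B by simp
  ultimately have \<gamma>0: "\<gamma> 0 = 1" using small by simp
  have "\<pi> 0 < r + s - 1" using \<pi>[of 0] by simp
  then show \<pi>0: "\<pi> 0 = 0" using B[of "\<pi> 0"] C[of "\<pi> 0"] by (metis not_gr_zero not_le_imp_less)
  have "2 * (b + c) = (b + c) + \<beta> 0 * b + c" using eq[of 0] \<pi>0 \<gamma>0 bc by simp
  moreover have "z = b" if "2 * (b + c) = (b + c) + z + c" for z using that by simp
  ultimately have "\<beta> 0 * b = 1 * b" unfolding mult_1_left by blast
  moreover have "b \<noteq> 0" using bc by simp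
  ultimately have "\<beta> 0 = 1" using mult_right_cancel[of b "\<beta> 0" 1] by blast
  then show "card {k \<in> {1..r}. \<pi> k = 0} = 1" unfolding \<beta>_def .
  show "card {k \<in> {r+1..r+s}. \<pi> k = 0} = 1" using \<gamma>0 by (simp add: \<gamma>_def)
  show "card {k \<in> {1..r}. \<pi> k = l} + card {k \<in> {r+1..r+s}. \<pi> k = l} = 1" if "0 < l" "l < r + s - 1" for l
    using B[of l] C[of l] that unfolding \<beta>_def \<gamma>_def by (cases "l < r") auto
qed

section \<open>The partition and its coarsening along the flat\<close>

abbreviation lam_full :: "nat \<Rightarrow> nat \<Rightarrow> nat \<Rightarrow> nat \<Rightarrow> nat list" where
  "lam_full b c r s \<equiv> [b + c] @ replicate r b @ replicate s c"

abbreviation lam_merged :: "nat \<Rightarrow> nat \<Rightarrow> nat \<Rightarrow> nat \<Rightarrow> nat list" where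
  "lam_merged b c r s \<equiv> [2 * (b + c)] @ replicate (r - 1) b @ replicate (s - 1) c"

lemma nth_lam_full:
  "k < r + s + 1 \<Longrightarrow> lam_full b c r s ! k = (if k = 0 then b + c else if k \<le> r then b else c)"
  by (auto simp: nth_Cons' nth_append)

lemma nth_lam_merged:
  "0 < r \<Longrightarrow> 0 < s \<Longrightarrow> l < r + s - 1 \<Longrightarrow>
    lam_merged b c r s ! l = (if l = 0 then 2 * (b + c) else if l < r then b else c)"
  by (auto simp: nth_Cons' nth_append)

lemma sum_lam_merged:
  "0 < r \<Longrightarrow> 0 < s \<Longrightarrow> sum_list (lam_merged b c r s) = sum_list (lam_full b c r s)"
  by (cases r; cases s) (auto simp: sum_list_replicate)

lemma length_lam_merged: "0 < r \<Longrightarrow> 0 < s \<Longrightarrow> length (lam_merged b c r s) = r + s - 1"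
  by simp

lemma blk_lam_merged_0: "blk (lam_merged b c r s) i = 0 \<longleftrightarrow> i < 2 * (b + c)"
  by (simp add: blk_Cons)

text \<open>A block of x cannot meet two blocks of \<open>f\<close>, whose values are separated. So
  the blocks of x refine those of \<open>f\<close>, and \<open>refinement_counts\<close> leaves one
  way: block 0 splits into sizes b + c, b, c and the others stay whole.\<close>

lemma X_arr_refine:
  assumes bc: "0 < c" "c < b" "0 < r" "0 < s"
    and n: "n = sum_list (lam_full b c r s)" and f: "f = blk (lam_merged b c r s)"
    and x: "x \<in> X_arr (lam_full b c r s)"
    and sep: "\<And>i j. i < n \<Longrightarrow> j < n \<Longrightarrow> f i \<noteq> f j \<Longrightarrow> x i \<noteq> x j"
  shows "\<exists>A B C X Y Z. plane b c A B C \<and> on_plane x A B C X Y Z"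
    "\<And>i j. i < n \<Longrightarrow> j < n \<Longrightarrow> f i = f j \<Longrightarrow> f i \<noteq> 0 \<Longrightarrow> x i = x j"
proof -
  let ?lam = "lam_full b c r s" and ?mer = "lam_merged b c r s"
  have nm: "n = sum_list ?mer" using sum_lam_merged bc n by simp
  have len: "length ?lam = r + s + 1" by simp
  obtain w where "\<forall>i<n. w i < r + s + 1" "\<forall>k<r + s + 1. card {i. i < n \<and> w i = k} = ?lam ! k"
    "\<forall>i<n. \<forall>j<n. w i = w j \<longrightarrow> x i = x j"
    using x unfolding X_arr_iff[of x ?lam] n[symmetric] len by (elim conjE exE)
  note w = this[rule_format]
  have nonempty: "\<exists>i. i < n \<and> w i = k" if "k < r + s + 1" for k
  proof -
    have "card {i. i < n \<and> w i = k} \<noteq> 0" unfolding w(2)[OF that] nth_lam_full[OF that] using bc by auto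
    then have "{i. i < n \<and> w i = k} \<noteq> {}" by (metis card.empty)
    then show ?thesis by blast
  qed
  define \<pi> where "\<pi> k = f (SOME i. i < n \<and> w i = k)" for k
  have \<pi>: "f i = \<pi> (w i)" if "i < n" for i
  proof -
    have "(SOME j. j < n \<and> w j = w i) < n \<and> w (SOME j. j < n \<and> w j = w i) = w i"
      by (rule someI[of _ i]) (use that in simp)
    then show ?thesis unfolding \<pi>_def using sep[of i "SOME j. j < n \<and> w j = w i"] w(3)[of i "SOME j. j < n \<and> w j = w i"] that
      by metis
  qed
  have fless: "f i < r + s - 1" if "i < n" for i
    using blk_less[of i ?mer] that nm length_lam_merged bc f by simp
  have \<pi>less: "\<pi> k < r + s - 1" if "k < r + s + 1" for k
    using nonempty[OF that] \<pi> fless by metis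
  have eq: "(if l = 0 then 2 * (b + c) else if l < r then b else c) =
      (if \<pi> 0 = l then b + c else 0) + card {k \<in> {1..r}. \<pi> k = l} * b + card {k \<in> {r+1..r+s}. \<pi> k = l} * c"
    if l: "l < r + s - 1" for l
  proof -
    let ?g = "\<lambda>k. if k = 0 then b + c else if k \<le> r then b else c"
      and ?A = "{0} \<inter> {k. \<pi> k = l}" and ?B = "{k \<in> {1..r}. \<pi> k = l}"
      and ?C = "{k \<in> {r+1..r+s}. \<pi> k = l}"
    let ?U = "{k. k < r + s + 1 \<and> \<pi> k = l}"
    have "{i. i < n \<and> f i = l} = (\<Union>k\<in>?U. {i. i < n \<and> w i = k})"
      using \<pi> w(1) by auto
    then have "card {i. i < n \<and> f i = l} = (\<Sum>k\<in>?U. card {i. i < n \<and> w i = k})"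
      by (simp add: card_UN_disjoint disjoint_iff)
    also have "\<dots> = (\<Sum>k\<in>?U. ?g k)"
      using w(2) nth_lam_full by (intro sum.cong) auto
    also have "?U = ?A \<union> ?B \<union> ?C" by auto
    also have "(\<Sum>k\<in>?A \<union> ?B \<union> ?C. ?g k)
        = (\<Sum>k\<in>?A. ?g k) + (\<Sum>k\<in>?B. ?g k) + (\<Sum>k\<in>?C. ?g k)"
      by (subst sum.union_disjoint; (subst sum.union_disjoint)?) auto
    also have "(\<Sum>k\<in>?A. ?g k) = (if \<pi> 0 = l then b + c else 0)"
      by (cases "\<pi> 0 = l") auto
    also have "(\<Sum>k\<in>?B. ?g k) = (\<Sum>k\<in>?B. b)"
      by (intro sum.cong) auto
    also have "(\<Sum>k\<in>?C. ?g k) = (\<Sum>k\<in>?C. c)"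
      by (intro sum.cong) auto
    finally have "card {i. i < n \<and> f i = l} = (if \<pi> 0 = l then b + c else 0)
        + card ?B * b + card ?C * c" by simp
    moreover have "card {i. i < n \<and> f i = l} = ?mer ! l"
      unfolding f nm by (rule card_blk) (use l length_lam_merged bc in simp)
    ultimately show ?thesis using nth_lam_merged[OF bc(3,4) l] by simp
  qed
  note cnt = refinement_counts[OF bc \<pi>less eq]
  obtain k1 where k1: "{k \<in> {1..r}. \<pi> k = 0} = {k1}" using cnt(2) card_1_singletonE by blast
  obtain k2 where k2: "{k \<in> {r+1..r+s}. \<pi> k = 0} = {k2}" using cnt(3) card_1_singletonE by blast
  have k12: "k1 \<in> {1..r}" "\<pi> k1 = 0" "k2 \<in> {r+1..r+s}" "\<pi> k2 = 0" using k1 k2 by auto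
  define V where "V k = {i. i < n \<and> w i = k}" for k
  have "V 0 \<union> V k1 \<union> V k2 = {..<2 * (b + c)}"
  proof (intro equalityI subsetI)
    fix i assume "i \<in> V 0 \<union> V k1 \<union> V k2"
    then have "i < n" "\<pi> (w i) = 0" using cnt(1) k12 by (auto simp: V_def)
    then show "i \<in> {..<2 * (b + c)}" using \<pi>[of i] blk_lam_merged_0[of b c r s i] f by simp
  next
    fix i assume i: "i \<in> {..<2 * (b + c)}"
    then have "i < n" using nm by simp
    moreover have "f i = 0" using i blk_lam_merged_0[of b c r s i] f by simp
    ultimately have "\<pi> (w i) = 0" "w i < r + s + 1" using \<pi> w(1) by auto
    then have "w i = 0 \<or> w i \<in> {k \<in> {1..r}. \<pi> k = 0} \<or> w i \<in> {k \<in> {r+1..r+s}. \<pi> k = 0}" by auto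
    then show "i \<in> V 0 \<union> V k1 \<union> V k2" using \<open>i < n\<close> unfolding k1 k2 by (auto simp: V_def)
  qed
  moreover have "card (V 0) = b + c" "card (V k1) = b" "card (V k2) = c"
  proof -
    have less: "0 < r + s + 1" "k1 < r + s + 1" "k2 < r + s + 1" using k12 by auto
    show "card (V 0) = b + c" "card (V k1) = b" "card (V k2) = c"
      unfolding V_def w(2)[OF less(1)] w(2)[OF less(2)] w(2)[OF less(3)]
        nth_lam_full[OF less(1)] nth_lam_full[OF less(2)] nth_lam_full[OF less(3)] using k12 by auto
  qed
  moreover have "V 0 \<inter> V k1 = {}" "V 0 \<inter> V k2 = {}" "V k1 \<inter> V k2 = {}" using k12 by (auto simp: V_def)
  ultimately have pl: "plane b c (V 0) (V k1) (V k2)" by (simp add: plane_def)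
  have const: "\<exists>v. \<forall>i\<in>V k. x i = v" for k
  proof (cases "V k = {}")
    case False
    then obtain j where j: "j \<in> V k" by blast
    have "x i = x j" if "i \<in> V k" for i using w(3)[of i j] that j by (simp add: V_def)
    then show ?thesis by blast
  qed simp
  obtain X Y Z where "\<forall>i\<in>V 0. x i = X" "\<forall>i\<in>V k1. x i = Y" "\<forall>i\<in>V k2. x i = Z"
    using const[of 0] const[of k1] const[of k2] by (elim exE)
  then have "on_plane x (V 0) (V k1) (V k2) X Y Z" unfolding on_plane_def by (intro conjI)
  with pl show "\<exists>A B C X Y Z. plane b c A B C \<and> on_plane x A B C X Y Z" by (intro exI conjI)
  fix i j assume ij: "i < n" "j < n" "f i = f j" "f i \<noteq> 0"
  let ?l = "f i"
  have one: "card {k \<in> {1..r}. \<pi> k = ?l} + card {k \<in> {r+1..r+s}. \<pi> k = ?l} = 1"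
    using cnt(4)[of ?l] ij fless by simp
  have mem: "w m \<in> {k \<in> {1..r}. \<pi> k = ?l} \<or> w m \<in> {k \<in> {r+1..r+s}. \<pi> k = ?l}" if "m < n" "f m = ?l" for m
    using w(1)[OF that(1)] \<pi>[OF that(1)] that(2) cnt(1) ij(4) by (cases "w m = 0") auto
  let ?S = "{k \<in> {1..r}. \<pi> k = ?l} \<union> {k \<in> {r+1..r+s}. \<pi> k = ?l}"
  have "card ?S \<le> Suc 0"
    using card_Un_le[of "{k \<in> {1..r}. \<pi> k = ?l}" "{k \<in> {r+1..r+s}. \<pi> k = ?l}"] one by simp
  moreover have "finite ?S" by simp
  moreover have "w i \<in> ?S" "w j \<in> ?S" using mem[OF ij(1)] mem[OF ij(2)] ij(3) by auto
  ultimately have "w i = w j" using card_le_Suc0_iff_eq[of ?S] by blast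
  then show "x i = x j" by (rule w(3)[OF ij(1,2)])
qed

lemma X_arr_construct:
  assumes bc: "0 < c" "c < b" "0 < r" "0 < s"
    and n: "n = sum_list (lam_full b c r s)" and f: "f = blk (lam_merged b c r s)"
    and pl: "plane b c A B C" "on_plane x A B C X Y Z"
    and x: "\<And>i. n \<le> i \<Longrightarrow> x i = 0" "\<And>i j. i < n \<Longrightarrow> j < n \<Longrightarrow> f i = f j \<Longrightarrow> f i \<noteq> 0 \<Longrightarrow> x i = x j"
  shows "x \<in> X_arr (lam_full b c r s)"
proof -
  let ?lam = "lam_full b c r s" and ?mer = "lam_merged b c r s"
  have nm: "n = sum_list ?mer" using sum_lam_merged bc n by simp
  have f0: "f i = 0 \<longleftrightarrow> i < 2 * (b + c)" for i unfolding f by (rule blk_lam_merged_0)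
  have un: "A \<union> B \<union> C = {..<2 * (b + c)}" "A \<inter> B = {}" "A \<inter> C = {}" "B \<inter> C = {}"
    and cards: "card A = b + c" "card B = b" "card C = c"
    using pl(1) by (auto simp: plane_def)
  have mem: "i \<in> A \<or> i \<in> B \<or> i \<in> C \<longleftrightarrow> f i = 0" for i using un(1) f0[of i] by auto
  have Nn: "2 * (b + c) \<le> n" using nm by simp
  have less: "i < n" if "i \<in> A \<or> i \<in> B \<or> i \<in> C" for i using that mem[of i] f0[of i] Nn by auto
  have fless: "f i < r + s - 1" if "i < n" for i
    using blk_less[of i ?mer] that nm length_lam_merged bc f by simp
  \<comment> \<open>The labels 0, 1 and r + 1 are the first parts of sizes b + c, b and c. The
    remaining blocks of size b take 2 to r and those of size c take r + 2 onwards, hence the shifts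
    by 1 and 2.\<close>
  define w where "w i = (if i \<in> A then 0 else if i \<in> B then 1 else if i \<in> C then r + 1
    else if f i < r then f i + 1 else f i + 2)" for i
  have wC: "w i = r + 1 \<longleftrightarrow> i \<in> C" for i
    using un mem[of i] bc by (auto simp: w_def)
  have wB: "w i = 1 \<longleftrightarrow> i \<in> B" for i using un mem[of i] bc by (auto simp: w_def)
  have wA: "w i = 0 \<longleftrightarrow> i \<in> A" for i by (auto simp: w_def)
  have wb: "w i = k \<longleftrightarrow> f i = k - 1" if "2 \<le> k" "k \<le> r" for i k
    using that mem[of i] by (auto simp: w_def)
  have wc: "w i = k \<longleftrightarrow> f i = k - 2" if "r + 2 \<le> k" for i k
    using that mem[of i] bc by (auto simp: w_def)
  have cardf: "card {i. i < n \<and> f i = l} = ?mer ! l" if "l < r + s - 1" for l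
    unfolding f nm by (rule card_blk) (use that length_lam_merged bc in simp)
  have "card {i. i < n \<and> w i = k} = ?lam ! k" if k: "k < r + s + 1" for k
  proof -
    consider "k = 0" | "k = 1" | "2 \<le> k" "k \<le> r" | "k = r + 1" | "r + 2 \<le> k" by linarith
    then show ?thesis
    proof cases
      case 1
      then have "{i. i < n \<and> w i = k} = A" using wA less by auto
      then show ?thesis using nth_lam_full[OF k] 1 cards by simp
    next
      case 2
      then have "{i. i < n \<and> w i = k} = B" using wB less by auto
      then show ?thesis using nth_lam_full[OF k] 2 cards bc by simp
    next
      case 3
      then have "{i. i < n \<and> w i = k} = {i. i < n \<and> f i = k - 1}" using wb by auto
      then show ?thesis using nth_lam_full[OF k] nth_lam_merged[of r s "k - 1" b c] cardf[of "k - 1"] 3 k bc by auto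
    next
      case 4
      then have "{i. i < n \<and> w i = k} = C" using wC less by auto
      then show ?thesis using nth_lam_full[OF k] 4 cards by simp
    next
      case 5
      then have "{i. i < n \<and> w i = k} = {i. i < n \<and> f i = k - 2}" using wc by auto
      then show ?thesis using nth_lam_full[OF k] nth_lam_merged[of r s "k - 2" b c] cardf[of "k - 2"] 5 k bc by auto
    qed
  qed
  note m1 = this
  have m2: "w i < r + s + 1" if "i < n" for i using fless[OF that] bc by (auto simp: w_def)
  have m3: "x i = x j" if ij: "i < n" "j < n" "w i = w j" for i j
  proof (cases "f i = 0")
    case True
    then have "i \<in> A \<and> j \<in> A \<or> i \<in> B \<and> j \<in> B \<or> i \<in> C \<and> j \<in> C"
      using mem[of i] wA[of i] wA[of j] wB[of i] wB[of j] wC[of i] wC[of j] ij(3) by metis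
    then show ?thesis using pl(2) by (auto simp: on_plane_def)
  next
    case False
    then have i: "i \<notin> A" "i \<notin> B" "i \<notin> C" using mem[of i] by auto
    then have "j \<notin> A" "j \<notin> B" "j \<notin> C" using wA wB wC ij(3) by metis+
    then have "f i = f j" using ij(3) i by (auto simp: w_def split: if_splits)
    then show ?thesis using x(2) ij False by blast
  qed
  have m4: "x \<in> cn n" using x(1) by (simp add: cn_def)
  have len: "length ?lam = r + s + 1" by simp
  show ?thesis unfolding X_arr_iff[of x ?lam] n[symmetric] len
    by (intro conjI exI[of _ w] allI impI m1 m2 m3 m4)
qed

text \<open>A sequence of length at least r + s + 1 exceeds the number r + s - 1 of blocks of the
  flat by two, which is what \<open>regular_seq_extension\<close> asks for. It supplies the
  saturation for \<open>one_denominator\<close>, so h would be polynomial off the flat.\<close>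

lemma regular_seq_length_X_arr:
  assumes bc: "0 < c" "c < b" "0 < r" "0 < s"
    and n: "n = sum_list (lam_full b c r s)"
    and reg: "regular_seq n (van_ideal n (X_arr (lam_full b c r s))) fs"
  shows "length fs < length (lam_full b c r s)"
proof (rule ccontr)
  assume long: "\<not> ?thesis"
  let ?X = "X_arr (lam_full b c r s)" and ?N = "2 * (b + c)"
  have bc': "b \<noteq> c" "0 < b" "0 < c" using bc by auto
  define f where "f = blk (lam_merged b c r s)"
  have nm: "n = sum_list (lam_merged b c r s)" using sum_lam_merged bc n by simp
  have f0: "f i = 0 \<longleftrightarrow> i < ?N" for i unfolding f_def by (rule blk_lam_merged_0)
  have Nn: "?N \<le> n" using nm by simp
  have fless: "f i < r + s - 1" if "i < n" for i
    using blk_less[of i "lam_merged b c r s"] that nm length_lam_merged bc f_def by simp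
  define Q where "Q x = (\<Prod>i<n. \<Prod>j<n. if f i \<noteq> f j then x i - x j else 1)" for x :: "nat \<Rightarrow> complex"
  have Q: "polyfun n Q" unfolding Q_def[abs_def]
  proof (intro polyfun_prod)
    fix i j assume "i \<in> {..<n}" "j \<in> {..<n}"
    then show "polyfun n (\<lambda>x. if f i \<noteq> f j then x i - x j else 1)"
      by (cases "f i = f j") (auto intro!: polyfun_diff polyfun_coord)
  qed
  have Q_nz: "Q x \<noteq> 0 \<longleftrightarrow> (\<forall>i<n. \<forall>j<n. f i \<noteq> f j \<longrightarrow> x i \<noteq> x j)" for x
    by (auto simp: Q_def)
  define q where "q = (\<Sum>i<n. \<Sum>j<n. if f i \<noteq> f j then 1 else (0::nat))"
  have Q_hom: "Q (\<lambda>i. t * x i) = t ^ q * Q x" for t x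
  proof -
    have "Q (\<lambda>i. t * x i) = (\<Prod>i<n. \<Prod>j<n. t ^ (if f i \<noteq> f j then 1 else 0) * (if f i \<noteq> f j then x i - x j else 1))"
      unfolding Q_def by (intro prod.cong refl) (simp add: right_diff_distrib)
    then show ?thesis by (simp add: prod.distrib Q_def q_def power_sum)
  qed
  define h where "h x = Q x * plane_fun b c x" for x
  have refine: "\<exists>A B C X Y Z. plane b c A B C \<and> on_plane x A B C X Y Z"
    and refine_eq: "\<And>i j. i < n \<Longrightarrow> j < n \<Longrightarrow> f i = f j \<Longrightarrow> f i \<noteq> 0 \<Longrightarrow> x i = x j"
    if "x \<in> ?X" "Q x \<noteq> 0" for x
    using X_arr_refine[OF bc n f_def that(1)] that(2) unfolding Q_nz by blast+
  have h_hom: "h (\<lambda>i. t * x i) = t ^ (q + 4) * h x" if x: "x \<in> ?X" for x t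
  proof (cases "Q x = 0")
    case False
    obtain A B C X Y Z where pl: "plane b c A B C" "on_plane x A B C X Y Z" using refine[OF x False] by blast
    then have "on_plane (\<lambda>i. t * x i) A B C (t * X) (t * Y) (t * Z)" by (auto simp: on_plane_def)
    then show ?thesis
      using plane_fun_eq[OF pl bc'] plane_fun_eq[OF pl(1) _ bc'] by (simp add: h_def Q_hom plane_val_scale power_add)
  qed (simp add: h_def Q_hom)
  define \<rho> where "\<rho> i = (LEAST j. f j = f i)" for i
  define F where "F = {x :: nat \<Rightarrow> complex. \<forall>i<n. x i = x (\<rho> i)}"
  have \<rho>: "f (\<rho> i) = f i" "\<rho> i \<le> i" for i
    unfolding \<rho>_def by (rule LeastI[of _ i], simp) (rule Least_le, simp)
  have \<rho>0: "\<rho> i = 0" if "i < ?N" for i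
    unfolding \<rho>_def by (rule Least_equality) (use that f0[of i] f0[of 0] bc in auto)
  let ?J = "denoms n (?X - F) h"
  have one: "(\<lambda>x. 1) \<in> denoms n (?X - F) (\<lambda>x. Q x * plane_fun b c x)"
  proof (rule one_denominator[OF bc' Nn _ Q], unfold h_def[symmetric])
    show "\<exists>A B C X Y Z. plane b c A B C \<and> on_plane x A B C X Y Z" if "x \<in> ?X - F" "Q x \<noteq> 0" for x
      using refine that by blast
    fix k e
    assume k: "polyfun n k" and hom: "\<And>t x. k (\<lambda>i. t * x i) = t ^ e * k x"
      and mult: "\<And>i. i < ?N \<Longrightarrow> (\<lambda>x. (x i - x 0) * k x) \<in> ?J"
    define rs where "rs = map (\<lambda>l. LEAST j. f j = l) [0..<r + s - 1]"
    \<comment> \<open>The extension is applied to k h; for indices in the merged block its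
      hypothesis is exactly that (x_i - x_0) k is a denominator.\<close>
    have "\<exists>w\<in>polys n. \<forall>x\<in>?X - F. peval w x = k x * h x"
    proof (rule regular_seq_extension[OF X_arr_cone reg _ _ _ F_def])
      show "set rs \<subseteq> {..<n}"
      proof
        fix j assume "j \<in> set rs"
        then obtain l where l: "l < r + s - 1" "j = (LEAST j. f j = l)" by (auto simp: rs_def)
        have "card {i. i < n \<and> f i = l} = lam_merged b c r s ! l"
          unfolding f_def nm by (rule card_blk) (use l length_lam_merged bc in simp)
        also have "\<dots> \<noteq> 0" unfolding nth_lam_merged[OF bc(3,4) l(1)] using bc by auto
        finally have "{i. i < n \<and> f i = l} \<noteq> {}" by (metis card.empty)
        then obtain i where "i < n" "f i = l" by blast
        then show "j \<in> {..<n}" using Least_le[of "\<lambda>j. f j = l" i] l(2) by simp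
      qed
      show "\<rho> i \<in> set rs" if "i < n" for i
        using fless[OF that] by (auto simp: rs_def \<rho>_def)
      show "length rs + 2 \<le> length fs" using long bc by (simp add: rs_def)
      show "k (\<lambda>i. t * x i) * h (\<lambda>i. t * x i) = t ^ (e + (q + 4)) * (k x * h x)" if "x \<in> ?X" "t \<noteq> 0" for x t
        using hom h_hom[OF that(1)] by (simp add: power_add)
      fix i assume i: "i < n"
      show "\<exists>g\<in>polys n. \<forall>x\<in>?X - F. peval g x = (x i - x (\<rho> i)) * (k x * h x)"
      proof (cases "i < ?N")
        case True
        obtain g where "polyfun n g" "\<forall>x\<in>?X - F. g x = (x i - x 0) * k x * h x"
          using mult[OF True] unfolding denoms_def by blast
        then obtain g' where "g' \<in> polys n" "\<forall>x\<in>?X - F. peval g' x = (x i - x 0) * k x * h x"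
          unfolding polyfun_def by auto
        then show ?thesis unfolding \<rho>0[OF True] mult.assoc by (intro bexI[of _ g'])
      next
        case False
        \<comment> \<open>Outside the merged block x_i and x_(\<rho> i) agree on X wherever Q is
          nonzero, and elsewhere h = 0.\<close>
        have "(x i - x (\<rho> i)) * (k x * h x) = 0" if x: "x \<in> ?X" for x
        proof (cases "Q x = 0")
          case False
          have "\<rho> i < n" using \<rho>(2)[of i] i by simp
          moreover have "f i \<noteq> 0" using f0[of i] \<open>\<not> i < ?N\<close> by simp
          ultimately have "x i = x (\<rho> i)" using refine_eq[OF x False i, of "\<rho> i"] \<rho>(1)[of i] by simp
          then show ?thesis by simp
        qed (simp add: h_def)
        then show ?thesis by (intro bexI[of _ 0]) auto
      qed
    qed
    then show "k \<in> ?J" using k unfolding denoms_def by (auto intro!: polyfun_peval)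
  qed
  then obtain g where "polyfun n g" "\<forall>x\<in>?X - F. g x = 1 * (Q x * plane_fun b c x)"
    unfolding denoms_def by blast
  then obtain p where p: "p \<in> polys n" "\<And>x. x \<in> ?X - F \<Longrightarrow> peval p x = Q x * plane_fun b c x"
    unfolding polyfun_def by auto
  \<comment> \<open>Block numbers are distinct values for distinct blocks, and number 0 of the
    merged block agrees with the point t = 0, so Q is nonzero there.\<close>
  define u where "u i = (if i < n then of_nat (f i) else 0 :: complex)" for i
  have u0: "(if i < ?N then 0 else u i) = of_nat (f i)" if "i < n" for i
    using f0[of i] that by (cases "i < ?N") (simp_all add: u_def)
  show False
  proof (rule plane_fun_not_polynomial[OF bc' Q, of u p])
    show "Q (\<lambda>i. if i < ?N then 0 else u i) \<noteq> 0"
      unfolding Q_nz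
    proof (intro allI impI)
      fix i j assume "i < n" "j < n" "f i \<noteq> f j"
      then show "(if i < ?N then 0 else u i) \<noteq> (if j < ?N then 0 else u j)"
        unfolding u0[OF \<open>i < n\<close>] u0[OF \<open>j < n\<close>] by simp
    qed
    fix A B C X Y Z y and t :: complex
    assume pl: "plane b c A B C" "on_plane y A B C X Y Z" and dist: "X \<noteq> Y" "X \<noteq> Z" "Y \<noteq> Z" and t: "t \<noteq> 0"
    let ?x = "\<lambda>i. if i < ?N then t * y i else u i"
    have sub: "A \<subseteq> {..<?N}" "B \<subseteq> {..<?N}" "C \<subseteq> {..<?N}" using plane_subset[OF pl(1)] by auto
    have on: "on_plane ?x A B C (t * X) (t * Y) (t * Z)" using pl(2) sub unfolding on_plane_def by auto
    have "?x \<in> ?X"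
    proof (rule X_arr_construct[OF bc n f_def pl(1) on])
      show "?x i = 0" if "n \<le> i" for i using that Nn by (simp add: u_def)
      show "?x i = ?x j" if "i < n" "j < n" "f i = f j" "f i \<noteq> 0" for i j
        using that f0[of i] f0[of j] by (simp add: u_def)
    qed
    \<comment> \<open>F demands one value on the merged block, but the values on A and B
      differ.\<close>
    moreover have "?x \<notin> F"
    proof
      have F: "z i = z (\<rho> i)" if "z \<in> F" "i < n" for z i using that by (simp add: F_def)
      assume xF: "?x \<in> F"
      obtain i j where ij: "i \<in> A" "j \<in> B" using plane_nonempty[OF pl(1) bc'(2,3)] by blast
      then have less: "i < ?N" "j < ?N" using sub by auto
      have "?x i = ?x (\<rho> i)" "?x j = ?x (\<rho> j)"
        by (rule F[OF xF], use less Nn in simp)+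
      then have "?x i = ?x j" unfolding \<rho>0[OF less(1)] \<rho>0[OF less(2)] by simp
      moreover have "?x i = t * X" "?x j = t * Y" using on ij unfolding on_plane_def by blast+
      ultimately show False using dist(1) t by simp
    qed
    ultimately show "peval p ?x = Q ?x * plane_fun b c ?x" using p(2) by blast
  qed
qed

theorem theorem7p2:
  fixes b c r s :: nat
  assumes "0 < c" and "c < b" and "0 < r" and "0 < s"
  shows "\<not> arr_CM ([b + c] @ replicate r b @ replicate s c)"
proof
  let ?lam = "[b + c] @ replicate r b @ replicate s c"
  let ?n = "sum_list ?lam"
  let ?I = "van_ideal ?n (X_arr ?lam)"
  assume "arr_CM ?lam"
  then have eq: "depth_ring ?n ?I = krull_dim ?n ?I" by (simp only: arr_CM_def cohen_macaulay_def)
  have "enat (length ?lam) \<le> krull_dim ?n ?I"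
    by (rule krull_dim_X_arr) (use assms in auto)
  also have "krull_dim ?n ?I = depth_ring ?n ?I" by (rule eq[symmetric])
  also have "depth_ring ?n ?I \<le> enat (length ?lam - 1)"
    unfolding depth_ring_def
  proof (rule Sup_least)
    fix e assume "e \<in> {enat (length fs) | fs. regular_seq ?n ?I fs}"
    then obtain fs where "e = enat (length fs)" "regular_seq ?n ?I fs" by blast
    then show "e \<le> enat (length ?lam - 1)"
      using regular_seq_length_X_arr[OF assms refl, of fs] by simp
  qed
  finally have "enat (length ?lam) \<le> enat (length ?lam - 1)" .
  then show False by simp
qed

end
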